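(* Let $0<\alpha<1$, let $A$ be a selfadjoint operator in a separable Hilbert space $H$, and let $F$ be a nonlinearity satisfying the Lipschitz assumption (A) described in the context, with associated norm $\rho(\cdot)$. Let $x\in D(A)$ be such that $|x|_1:=\max\{\|x\|_{D(A)},\rho(x)\}<\infty$. Then there exists a positive number $T$, depending only on $\|x\|_{D(A)}$ and $\rho(x)$, such that the problem $$iD_t^\alpha u+Au+F(u)=0\quad(t>0),\qquad u(0)=x,$$ admits a unique strict solution $u$ on $[0,T]$, in the class $$u\in C([0,T];D(A)),\qquad \mathbf{D}_t^\alpha(u-x)\in C([0,T];H).$$ Moreover, if $u(t),v(t)$ are strict solutions of this equation (on $[0,T]$) with initial data $x,y$ respectively, then there exists a positive constant $C$, depending on $\rho(x),\rho(y)$ and on $\|u\|_{L^\infty((0,T);D(A))}$, $\|v\|_{L^\infty((0,T);D(A))}$, such that $$\|u(t)-v(t)\|_{D(A)}\le C\,E_{\alpha,1}\big(\Gamma(\alpha)t^\alpha\big)\,\|x-y\|_{D(A)}.$$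
   Context: $D(A)$ carries the graph norm $\|x\|_{D(A)}=\|x\|_H+\|Ax\|_H$. For $\beta>0$ let $g_\beta(t)=t^{\beta-1}/\Gamma(\beta)$ for $t>0$ and $g_\beta(t)=0$ for $t\le 0$, and $(f*h)(t)=\int_0^t f(t-\tau)h(\tau)\,d\tau$. The Riemann--Liouville derivative is $\mathbf{D}_t^\alpha u=\frac{d}{dt}(g_{1-\alpha}*u)$ and the Caputo derivative is $D_t^\alpha u=\mathbf{D}_t^\alpha(u-u(0))$. The Mittag-Leffler function is $E_{\alpha,\beta}(z)=\sum_{k\ge0}z^k/\Gamma(\alpha k+\beta)$. The nonlinearity is a map $F:D(A)\to D(A)$, and for a $D(A)$-valued function $u$ of $t$, $F(u)$ denotes $t\mapsto F(u(t))$. Assumption (A): $F(0)=0$; and, for a fixed norm $\rho(\cdot)$ on initial data, whenever $u,v$ are $D(A)$-valued functions such that $\|u(t)\|_{D(A)}$ and $\|v(t)\|_{D(A)}$ are bounded a.e. on an interval $I\subset[0,\infty)$, then $\|F(u)-F(v)\|_{D(A)}\le C\|u(t)-v(t)\|_{D(A)}$ for a.e. $t\in I$, where $C$ depends on $\rho(u(0)),\rho(v(0))$ and on the essential upper bounds of $\|u(t)\|_{D(A)}$ and $\|v(t)\|_{D(A)}$ on $I$. (The norm $\rho$ is allowed to be infinite for some elements.) A strict solution on $[0,T]$ with initial value $x$ is a function $u:[0,T]\to H$ with $u\in C([0,T];D(A))$, $\mathbf{D}_t^\alpha(u-u(0))\in C([0,T];H)$, $u(0)=x$, satisfying the equation.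 *)

theory Defs
  imports "HOL-Analysis.Analysis" "HOL-Probability.Essential_Supremum"
begin

section \<open>Complex Hilbert spaces\<close>

text \<open>
  Complex Hilbert spaces as a type class over the real ones. The inner product
  \<open>cinner\<close> is linear in its first argument, and the real inner product of
  the underlying real Hilbert space is its real part, so that the norm of the space is
  the one induced by \<open>cinner\<close>. Separability is expressed by adding the sort
  \<^class>\<open>second_countable_topology\<close>, which is also what the Bochner integral requires.
\<close>

class complex_hilbert = real_inner + banach +
  fixes scaleC :: "complex \<Rightarrow> 'a \<Rightarrow> 'a"  (infixr \<open>*\<^sub>C\<close> 75)
    and cinner :: "'a \<Rightarrow> 'a \<Rightarrow> complex"
  assumes scaleC_add_right: "a *\<^sub>C (x + y) = a *\<^sub>C x + a *\<^sub>C y"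
    and scaleC_add_left: "(a + b) *\<^sub>C x = a *\<^sub>C x + b *\<^sub>C x"
    and scaleC_scaleC: "a *\<^sub>C (b *\<^sub>C x) = (a * b) *\<^sub>C x"
    and scaleC_of_real: "complex_of_real r *\<^sub>C x = r *\<^sub>R x"
    and cinner_commute: "cinner x y = cnj (cinner y x)"
    and cinner_add_left: "cinner (x + y) z = cinner x z + cinner y z"
    and cinner_scaleC_left: "cinner (a *\<^sub>C x) y = a * cinner x y"
    and inner_eq_Re_cinner: "inner x y = Re (cinner x y)"

instantiation complex :: complex_hilbert
begin

definition "scaleC_complex (a :: complex) (x :: complex) = a * x"
definition "cinner_complex (x :: complex) (y :: complex) = x * cnj y"

instance
  by standard
    (simp_all add: scaleC_complex_def cinner_complex_def inner_complex_def
      scaleR_conv_of_real algebra_simps)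

end

section \<open>Unbounded selfadjoint operators\<close>

text \<open>
  An operator with domain \<open>D\<close> is a total function \<open>A\<close> whose values outside
  \<open>D\<close> are irrelevant.
\<close>

definition operator_on :: "'a::complex_hilbert set \<Rightarrow> ('a \<Rightarrow> 'a) \<Rightarrow> bool" where
  "operator_on D A \<longleftrightarrow>
     0 \<in> D \<and>
     (\<forall>x\<in>D. \<forall>y\<in>D. x + y \<in> D \<and> A (x + y) = A x + A y) \<and>
     (\<forall>c. \<forall>x\<in>D. c *\<^sub>C x \<in> D \<and> A (c *\<^sub>C x) = c *\<^sub>C A x)"

definition adjoint_graph :: "'a::complex_hilbert set \<Rightarrow> ('a \<Rightarrow> 'a) \<Rightarrow> ('a \<times> 'a) set" where
  "adjoint_graph D A = {(y, z). \<forall>x\<in>D. cinner (A x) y = cinner x z}"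

definition selfadjoint :: "'a::complex_hilbert set \<Rightarrow> ('a \<Rightarrow> 'a) \<Rightarrow> bool" where
  "selfadjoint D A \<longleftrightarrow>
     operator_on D A \<and> closure D = UNIV \<and> adjoint_graph D A = {(y, A y) | y. y \<in> D}"

definition graph_norm :: "('a::real_normed_vector \<Rightarrow> 'a) \<Rightarrow> 'a \<Rightarrow> real" where
  "graph_norm A x = norm x + norm (A x)"

definition continuous_graph ::
  "'a::real_normed_vector set \<Rightarrow> ('a \<Rightarrow> 'a) \<Rightarrow> real set \<Rightarrow> (real \<Rightarrow> 'a) \<Rightarrow> bool" where
  "continuous_graph D A S u \<longleftrightarrow>
     (\<forall>t\<in>S. u t \<in> D) \<and>
     (\<forall>t\<in>S. ((\<lambda>s. graph_norm A (u s - u t)) \<longlongrightarrow> 0) (at t within S))"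

text \<open>
  The norm of \<open>L\<^sup>\<infinity>(S; D(A))\<close>. It is \<open>\<infinity>\<close> if the
  graph norm of \<open>u\<close> is not measurable or not essentially bounded on \<open>S\<close>
  (and \<open>-\<infinity>\<close> if \<open>S\<close> is a null set).
\<close>

definition Linf_norm :: "('a::real_normed_vector \<Rightarrow> 'a) \<Rightarrow> real set \<Rightarrow> (real \<Rightarrow> 'a) \<Rightarrow> ereal" where
  "Linf_norm A S u = esssup (lebesgue_on S) (\<lambda>t. ereal (graph_norm A (u t)))"

section \<open>The nonlinearity\<close>

text \<open>A norm on \<open>D\<close> that may take the value \<open>\<infinity>\<close>.\<close>

definition extended_norm_on :: "'a::complex_hilbert set \<Rightarrow> ('a \<Rightarrow> ennreal) \<Rightarrow> bool" where
  "extended_norm_on D \<rho> \<longleftrightarrow>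
     (\<forall>x\<in>D. \<rho> x = 0 \<longleftrightarrow> x = 0) \<and>
     (\<forall>c. \<forall>x\<in>D. \<rho> (c *\<^sub>C x) = ennreal (cmod c) * \<rho> x) \<and>
     (\<forall>x\<in>D. \<forall>y\<in>D. \<rho> (x + y) \<le> \<rho> x + \<rho> y)"

text \<open>
  The dependence of the Lipschitz constant on the initial values and on the essential
  upper bounds is expressed by the function \<open>L\<close>, chosen before the interval and the
  functions. Nothing is required when an initial value has infinite \<open>\<rho>\<close>.
\<close>

definition lipschitz_nonlinearity ::
  "'a::complex_hilbert set \<Rightarrow> ('a \<Rightarrow> 'a) \<Rightarrow> ('a \<Rightarrow> ennreal) \<Rightarrow> ('a \<Rightarrow> 'a) \<Rightarrow> bool" where
  "lipschitz_nonlinearity D A \<rho> F \<longleftrightarrow>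
     F \<in> D \<rightarrow> D \<and> F 0 = 0 \<and>
     (\<exists>L :: ennreal \<Rightarrow> ennreal \<Rightarrow> ereal \<Rightarrow> ereal \<Rightarrow> real.
        \<forall>I u v. is_interval I \<longrightarrow> I \<subseteq> {0..} \<longrightarrow>
          (\<forall>t\<ge>0. u t \<in> D \<and> v t \<in> D) \<longrightarrow>
          \<rho> (u 0) < \<infinity> \<longrightarrow> \<rho> (v 0) < \<infinity> \<longrightarrow>
          Linf_norm A I u < \<infinity> \<longrightarrow> Linf_norm A I v < \<infinity> \<longrightarrow>
          (AE t in lebesgue_on I.
             graph_norm A (F (u t) - F (v t))
               \<le> L (\<rho> (u 0)) (\<rho> (v 0)) (Linf_norm A I u) (Linf_norm A I v)
                   * graph_norm A (u t - v t)))"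

definition data_norm ::
  "('a::real_normed_vector \<Rightarrow> 'a) \<Rightarrow> ('a \<Rightarrow> ennreal) \<Rightarrow> 'a \<Rightarrow> ennreal" where
  "data_norm A \<rho> x = max (ennreal (graph_norm A x)) (\<rho> x)"

section \<open>Fractional derivatives\<close>

definition frac_kernel :: "real \<Rightarrow> real \<Rightarrow> real" where
  "frac_kernel \<beta> t = (if t > 0 then t powr (\<beta> - 1) / Gamma \<beta> else 0)"

definition convolution ::
  "(real \<Rightarrow> real) \<Rightarrow> (real \<Rightarrow> 'a::{banach, second_countable_topology}) \<Rightarrow> real \<Rightarrow> 'a" where
  "convolution f h t = (LINT \<tau>:{0..t}|lborel. f (t - \<tau>) *\<^sub>R h \<tau>)"

text \<open>
  Derivatives on \<open>[0, T]\<close> are taken within \<open>[0, T]\<close>, i.e. they are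
  one-sided at the endpoints, since the functions are only given there.
\<close>

definition RL_differentiable ::
  "real \<Rightarrow> real \<Rightarrow> (real \<Rightarrow> 'a::{banach, second_countable_topology}) \<Rightarrow> bool" where
  "RL_differentiable \<alpha> T u \<longleftrightarrow>
     (\<forall>t\<in>{0..T}. convolution (frac_kernel (1 - \<alpha>)) u differentiable (at t within {0..T}))"

definition RL_deriv ::
  "real \<Rightarrow> real \<Rightarrow> (real \<Rightarrow> 'a::{banach, second_countable_topology}) \<Rightarrow> real \<Rightarrow> 'a" where
  "RL_deriv \<alpha> T u t =
     vector_derivative (convolution (frac_kernel (1 - \<alpha>)) u) (at t within {0..T})"

definition caputo_deriv ::
  "real \<Rightarrow> real \<Rightarrow> (real \<Rightarrow> 'a::{banach, second_countable_topology}) \<Rightarrow> real \<Rightarrow> 'a" where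
  "caputo_deriv \<alpha> T u = RL_deriv \<alpha> T (\<lambda>t. u t - u 0)"

definition mittag_leffler :: "real \<Rightarrow> real \<Rightarrow> 'b::{real_normed_field, banach} \<Rightarrow> 'b" where
  "mittag_leffler \<alpha> \<beta> z = (\<Sum>k. z ^ k / of_real (Gamma (\<alpha> * real k + \<beta>)))"

section \<open>Strict solutions\<close>

definition strict_solution ::
  "real \<Rightarrow> 'a::{complex_hilbert, second_countable_topology} set \<Rightarrow> ('a \<Rightarrow> 'a) \<Rightarrow> ('a \<Rightarrow> 'a) \<Rightarrow>
   real \<Rightarrow> 'a \<Rightarrow> (real \<Rightarrow> 'a) \<Rightarrow> bool" where
  "strict_solution \<alpha> D A F T x u \<longleftrightarrow>
     continuous_graph D A {0..T} u \<and>
     RL_differentiable \<alpha> T (\<lambda>t. u t - u 0) \<and>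
     continuous_on {0..T} (RL_deriv \<alpha> T (\<lambda>t. u t - u 0)) \<and>
     u 0 = x \<and>
     (\<forall>t\<in>{0<..T}. \<i> *\<^sub>C caputo_deriv \<alpha> T u t + A (u t) + F (u t) = 0)"

end

theory Submission
  imports Defs
begin

text \<open>
  With \<open>B = \<i> A\<close> the equation reads \<open>D\<^sub>t\<^sup>\<alpha> u = B u + \<i> F(u)\<close>, and by \<open>g\<^sub>\<alpha> * g\<^bsub>1-\<alpha>\<^esub> = 1\<close> a strict
  solution is a continuous \<open>D(A)\<close>-valued solution of the Volterra equation
  \<open>u = x + g\<^sub>\<alpha> * (B u + \<i> F(u))\<close>.

  The spectral theorem is avoided. An extremum principle for the fractional derivative yields the
  energy estimate \<open>\<parallel>u\<parallel> \<le> \<parallel>x\<parallel> + g\<^sub>\<alpha> * \<parallel>f\<parallel>\<close> for solutions of \<open>u = x + g\<^sub>\<alpha> * (L u + f)\<close> whenever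
  \<open>L\<close> is dissipative. Applied to the bounded Yosida approximations of \<open>B\<close>, it shows that their
  solutions converge and so solves the linear problem in \<open>D(A)\<close>, with the estimate in the graph
  norm. As \<open>F\<close> is Lipschitz on balls of \<open>D(A)\<close>, the contraction principle gives the local
  solution, and a Gronwall argument with exponential weights gives uniqueness and stability. The
  factor \<open>E\<^bsub>\<alpha>,1\<^esub>\<close> is at least \<open>1\<close>.
\<close>

section \<open>Fractional integrals\<close>

text \<open>Since \<open>A\<close> is unbounded, the Volterra map of the whole equation loses a
  derivative and is no contraction. The linear part is inverted instead: its solution operator loses
  nothing in \<open>D(A)\<close>, so the perturbation argument can run there, which is where
  \<open>F\<close> is Lipschitz.

  The obstacle is regularity. A solution is \<open>x + frac_int \<alpha> q\<close> with
  \<open>q\<close> merely continuous and need not be differentiable, so an inequality for the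
  fractional derivative of the squared norm that presumes smoothness is out of reach. Hence the
  extremum principle is stated for the density \<open>q\<close>, and the norm is reached by testing
  with one fixed unit vector.

  A second obstacle is that \<open>B u\<close> formally solves the same equation with data
  \<open>B x\<close> and \<open>B f\<close>, while \<open>B (B u)\<close> need not exist. Only
  bounded operators are therefore pulled through the integral: resolvents and Yosida approximations,
  which commute with one another, carry the statements about \<open>B u\<close>, and domain
  membership is recovered at the end from closedness of the graph.\<close>

lemma has_bochner_integral_lborel_nonneg:
  fixes f :: "real \<Rightarrow> real"
  assumes "f \<in> borel_measurable borel" "\<And>x. 0 \<le> f x" "(f has_integral I) UNIV"
  shows "has_bochner_integral lborel f I"
proof (rule has_bochner_integral_nn_integral)
  show "0 \<le> I" by (rule has_integral_nonneg[OF assms(3)]) (use assms in auto)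
  show "integral\<^sup>N lborel f = ennreal I"
    using nn_integral_has_integral_lborel[OF assms] .
qed (use assms in auto)

abbreviation frac_int ::
  "real \<Rightarrow> (real \<Rightarrow> 'a::{banach, second_countable_topology}) \<Rightarrow> real \<Rightarrow> 'a" where
  "frac_int \<beta> \<equiv> convolution (frac_kernel \<beta>)"

section \<open>The Riemann-Liouville kernel and its integrals\<close>

lemma frac_kernel_nonneg: "0 < \<beta> \<Longrightarrow> 0 \<le> frac_kernel \<beta> t"
  by (auto simp: frac_kernel_def intro!: divide_nonneg_pos Gamma_real_pos)

lemma frac_kernel_nonpos_arg [simp]: "t \<le> 0 \<Longrightarrow> frac_kernel \<beta> t = 0"
  by (auto simp: frac_kernel_def)

lemma frac_kernel_measurable [measurable]: "frac_kernel \<beta> \<in> borel_measurable borel"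
  unfolding frac_kernel_def by measurable

lemma frac_kernel_one [simp]: "0 < t \<Longrightarrow> frac_kernel 1 t = 1"
  by (simp add: frac_kernel_def)

lemma frac_kernel_antimono:
  assumes "0 < \<beta>" "\<beta> \<le> 1" "0 < s" "s \<le> t"
  shows "frac_kernel \<beta> t \<le> frac_kernel \<beta> s"
proof -
  have "t powr (\<beta> - 1) \<le> s powr (\<beta> - 1)"
    using assms by (intro powr_mono2') auto
  then show ?thesis
    using assms by (auto simp: frac_kernel_def Gamma_real_pos divide_right_mono less_imp_le)
qed

lemma frac_kernel_has_integral:
  assumes "0 < \<beta>" "0 \<le> c"
  shows "has_bochner_integral lborel (\<lambda>s. indicator {0..c} s *\<^sub>R frac_kernel \<beta> s) (c powr \<beta> / Gamma
    (\<beta> + 1))"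
proof (rule has_bochner_integral_lborel_nonneg)
  have "((\<lambda>x. x powr (\<beta> - 1) / Gamma \<beta>) has_integral (c powr \<beta> / \<beta> / Gamma \<beta>)) {0..c}"
    using has_integral_divide[OF has_integral_powr_from_0[of "\<beta> - 1" c]] assms by simp
  moreover have "c powr \<beta> / \<beta> / Gamma \<beta> = c powr \<beta> / Gamma (\<beta> + 1)"
    using Gamma_plus1[of \<beta>] assms nonpos_Ints_nonpos[of \<beta>] by fastforce
  moreover have "frac_kernel \<beta> x = x powr (\<beta> - 1) / Gamma \<beta>" if "x \<in> {0..c} - {0}" for x
    using that by (auto simp: frac_kernel_def)
  ultimately have "(frac_kernel \<beta> has_integral (c powr \<beta> / Gamma (\<beta> + 1))) {0..c}"
    using has_integral_spike_finite[of "{0}" "{0..c}" "frac_kernel \<beta>" "\<lambda>x. x powr (\<beta> - 1) / Gamma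
      \<beta>"]
    by (metis finite.emptyI finite.insertI)
  then show "((\<lambda>s. indicator {0..c} s *\<^sub>R frac_kernel \<beta> s) has_integral (c powr \<beta> / Gamma (\<beta> + 1)))
    UNIV"
    unfolding indicator_scaleR_eq_if has_integral_restrict_UNIV .
qed (use assms in \<open>auto simp: indicator_def frac_kernel_nonneg\<close>)

lemma frac_kernel_reflected_has_integral:
  assumes "0 < \<beta>" "a \<le> t"
  shows "has_bochner_integral lborel (\<lambda>s. indicator {a..t} s *\<^sub>R frac_kernel \<beta> (t - s))
    ((t - a) powr \<beta> / Gamma (\<beta> + 1))"
proof -
  have "has_bochner_integral lborel (\<lambda>s. indicator {0..t-a} (t + (-1) * s) *\<^sub>R frac_kernel \<beta> (t
    + (-1) * s))
     (((t - a) powr \<beta> / Gamma (\<beta> + 1)) /\<^sub>R \<bar>-1\<bar>)"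
    using frac_kernel_has_integral[of \<beta> "t - a"] assms
    by (subst lborel_has_bochner_integral_real_affine_iff[of "-1" _ _ t, symmetric]) auto
  moreover have "(\<lambda>s. indicator {0..t-a} (t + (-1) * s) *\<^sub>R frac_kernel \<beta> (t + (-1) * s))
    = (\<lambda>s. indicator {a..t} s *\<^sub>R frac_kernel \<beta> (t - s))"
    by (auto simp: indicator_def fun_eq_iff)
  ultimately show ?thesis by simp
qed

text \<open>The kernel vanishes for \<open>s\<close> beyond \<open>t\<close> and the bound on
  \<open>h\<close> for \<open>s\<close> before \<open>a\<close>, so a constant multiple of the
  kernel on \<open>{a..t}\<close> dominates. One bound on \<open>h\<close> thus serves every
  \<open>t\<close>.\<close>

lemma frac_kernel_mult_integrable:
  fixes h :: "real \<Rightarrow> 'a::{banach, second_countable_topology}"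
  assumes "0 < \<beta>" "h \<in> borel_measurable borel" "\<And>s. norm (h s) \<le> M * indicator {a..} s"
  shows "integrable lborel (\<lambda>s. frac_kernel \<beta> (t - s) *\<^sub>R h s)"
proof (cases "a \<le> t")
  case True
  have "integrable lborel (\<lambda>s. indicator {a..t} s *\<^sub>R frac_kernel \<beta> (t - s) * M)"
    using frac_kernel_reflected_has_integral[OF assms(1) True]
    by (simp add: has_bochner_integral_iff)
  then show ?thesis
  proof (rule Bochner_Integration.integrable_bound)
    show "AE s in lborel. norm (frac_kernel \<beta> (t - s) *\<^sub>R h s)
        \<le> norm (indicator {a..t} s *\<^sub>R frac_kernel \<beta> (t - s) * M)"
    proof (intro AE_I2)
      fix s
      have M: "0 \<le> M" using assms(3)[of a] norm_ge_zero[of "h a"] by (simp del: norm_ge_zero)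
      show "norm (frac_kernel \<beta> (t - s) *\<^sub>R h s) \<le> norm (indicator {a..t} s *\<^sub>R frac_kernel \<beta> (t
        - s) * M)"
        using assms(3)[of s] M frac_kernel_nonneg[OF assms(1), of "t - s"]
        by (cases "s \<le> t"; cases "a \<le> s") (auto intro!: mult_left_mono)
    qed
    show "(\<lambda>s. frac_kernel \<beta> (t - s) *\<^sub>R h s) \<in> borel_measurable lborel"
      using assms(2) by measurable
  qed
next
  case False
  have "h s = 0" if "s < a" for s using assms(3)[of s] that by simp
  then have "(\<lambda>s. frac_kernel \<beta> (t - s) *\<^sub>R h s) = (\<lambda>s. 0)"
    using False by (auto simp: fun_eq_iff) (smt (verit) frac_kernel_nonpos_arg)
  then show ?thesis by simp
qed

section \<open>Fractional integrals of continuous functions\<close>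

lemma continuous_on_indicator_measurable:
  fixes h :: "real \<Rightarrow> 'a::real_normed_vector"
  assumes "continuous_on {0..T} h"
  shows "(\<lambda>s. indicator {0..T} s *\<^sub>R h s) \<in> borel_measurable borel"
  using assms by (intro borel_measurable_continuous_on_indicator) auto

lemma continuous_on_Icc_norm_bound:
  fixes h :: "real \<Rightarrow> 'a::real_normed_vector"
  assumes "continuous_on {0..T} h"
  obtains M where "0 \<le> M" "\<And>s. s \<in> {0..T} \<Longrightarrow> norm (h s) \<le> M"
proof -
  have "bounded (h ` {0..T})"
    using assms by (intro compact_imp_bounded compact_continuous_image) auto
  then obtain M where "\<forall>y\<in>h ` {0..T}. norm y \<le> M" unfolding bounded_iff by blast
  then show ?thesis by (intro that[of "max M 0"]) (auto simp: le_max_iff_disj)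
qed

text \<open>The cut at \<open>t\<close> is made by the kernel, which is \<open>0\<close> at
  nonpositive arguments, so with \<open>{0..T}\<close> fixed the variable \<open>t\<close> occurs
  only in the kernel. Integrals for different \<open>t\<close> become integrals over one space and
  can be subtracted, compared and fed to Fubini.\<close>

lemma frac_int_eq_lborel:
  assumes "t \<le> T"
  shows "frac_int \<beta> h t = (\<integral>s. frac_kernel \<beta> (t - s) *\<^sub>R (indicator {0..T} s *\<^sub>R h s) \<partial>lborel)"
  unfolding convolution_def set_lebesgue_integral_def
proof (rule Bochner_Integration.integral_cong[OF refl])
  fix s
  show "indicat_real {0..t} s *\<^sub>R frac_kernel \<beta> (t - s) *\<^sub>R h s
      = frac_kernel \<beta> (t - s) *\<^sub>R indicat_real {0..T} s *\<^sub>R h s"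
    using assms by (cases "s \<le> t"; cases "0 \<le> s") simp_all
qed

lemma frac_int_integrable:
  fixes h :: "real \<Rightarrow> 'a::{banach, second_countable_topology}"
  assumes "0 < \<beta>" "continuous_on {0..T} h"
  shows "integrable lborel (\<lambda>s. frac_kernel \<beta> (t - s) *\<^sub>R (indicator {0..T} s *\<^sub>R h s))"
proof -
  obtain M where M: "0 \<le> M" "\<And>s. s \<in> {0..T} \<Longrightarrow> norm (h s) \<le> M"
    using continuous_on_Icc_norm_bound[OF assms(2)] by blast
  show ?thesis
    by (rule frac_kernel_mult_integrable[where M=M and a=0,
        OF assms(1) continuous_on_indicator_measurable[OF assms(2)]])
      (use M in \<open>auto simp: indicator_def\<close>)
qed

lemma frac_int_cong:
  assumes "\<And>s. 0 \<le> s \<Longrightarrow> s \<le> t \<Longrightarrow> h s = k s"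
  shows "frac_int \<beta> h t = frac_int \<beta> k t"
  unfolding convolution_def by (intro set_lebesgue_integral_cong) (use assms in auto)

lemma frac_int_0 [simp]: "frac_int \<beta> h 0 = 0"
  unfolding convolution_def set_lebesgue_integral_def
  by (subst Bochner_Integration.integral_cong[OF refl, where g="\<lambda>_. 0"])
    (auto simp: indicator_def)

lemma frac_int_const:
  fixes c :: "'a::{banach, second_countable_topology}"
  assumes "0 < \<beta>" "0 \<le> t"
  shows "frac_int \<beta> (\<lambda>_. c) t = (t powr \<beta> / Gamma (\<beta> + 1)) *\<^sub>R c"
proof -
  have "frac_int \<beta> (\<lambda>_. c) t = (\<integral>s. (indicator {0..t} s *\<^sub>R frac_kernel \<beta> (t - s)) *\<^sub>R c \<partial>lborel)"
    unfolding convolution_def set_lebesgue_integral_def by simp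
  also have "\<dots> = (t powr \<beta> / Gamma (\<beta> + 1)) *\<^sub>R c"
    using frac_kernel_reflected_has_integral[OF assms]
    by (simp add: has_bochner_integral_iff)
  finally show ?thesis .
qed

context
  fixes \<beta> T :: real and h k :: "real \<Rightarrow> 'a::{banach, second_countable_topology}"
  assumes \<beta>: "0 < \<beta>" and h: "continuous_on {0..T} h" and k: "continuous_on {0..T} k"
begin

lemma frac_int_add:
  "t \<le> T \<Longrightarrow> frac_int \<beta> (\<lambda>s. h s + k s) t = frac_int \<beta> h t + frac_int \<beta> k t"
  using frac_int_integrable[OF \<beta> h, of t] frac_int_integrable[OF \<beta> k, of t]
  by (simp add: frac_int_eq_lborel[of t T] scaleR_add_right)

lemma frac_int_diff:
  "t \<le> T \<Longrightarrow> frac_int \<beta> (\<lambda>s. h s - k s) t = frac_int \<beta> h t - frac_int \<beta> k t"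
  using frac_int_integrable[OF \<beta> h, of t] frac_int_integrable[OF \<beta> k, of t]
  by (simp add: frac_int_eq_lborel[of t T] scaleR_diff_right)

end

lemma frac_int_bounded_linear:
  fixes h :: "real \<Rightarrow> 'a::{banach, second_countable_topology}"
    and L :: "'a \<Rightarrow> 'b::{banach, second_countable_topology}"
  assumes \<beta>: "0 < \<beta>" and h: "continuous_on {0..T} h" and L: "bounded_linear L" and "t \<le> T"
  shows "frac_int \<beta> (\<lambda>s. L (h s)) t = L (frac_int \<beta> h t)"
proof -
  interpret L: bounded_linear L by fact
  show ?thesis
    using integral_bounded_linear[OF L frac_int_integrable[OF \<beta> h, of t]] \<open>t \<le> T\<close>
    by (simp add: frac_int_eq_lborel[of t T] L.scaleR)
qed

lemma frac_int_mono:
  fixes h k :: "real \<Rightarrow> real"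
  assumes \<beta>: "0 < \<beta>" and h: "continuous_on {0..T} h" and k: "continuous_on {0..T} k"
    and le: "\<And>s. 0 \<le> s \<Longrightarrow> s \<le> T \<Longrightarrow> h s \<le> k s" and "t \<le> T"
  shows "frac_int \<beta> h t \<le> frac_int \<beta> k t"
  unfolding frac_int_eq_lborel[OF \<open>t \<le> T\<close>]
  by (rule integral_mono[OF frac_int_integrable[OF \<beta> h] frac_int_integrable[OF \<beta> k]])
    (use le in \<open>auto simp: indicator_def frac_kernel_nonneg[OF \<beta>] intro!: mult_left_mono\<close>)

lemma norm_frac_int_le:
  fixes h :: "real \<Rightarrow> 'a::{banach, second_countable_topology}"
  assumes \<beta>: "0 < \<beta>" and h: "continuous_on {0..T} h" and p: "continuous_on {0..T} p"
    and le: "\<And>s. 0 \<le> s \<Longrightarrow> s \<le> T \<Longrightarrow> norm (h s) \<le> p s" and "t \<le> T"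
  shows "norm (frac_int \<beta> h t) \<le> frac_int \<beta> p t"
  unfolding frac_int_eq_lborel[OF \<open>t \<le> T\<close>]
proof (rule Bochner_Integration.integral_norm_bound_integral[OF frac_int_integrable[OF \<beta> h]
  frac_int_integrable[OF \<beta> p]])
  fix s
  show "norm (frac_kernel \<beta> (t - s) *\<^sub>R indicat_real {0..T} s *\<^sub>R h s)
         \<le> frac_kernel \<beta> (t - s) *\<^sub>R indicat_real {0..T} s *\<^sub>R p s"
    using le[of s] frac_kernel_nonneg[OF \<beta>, of "t - s"]
    by (auto simp: indicator_def intro!: mult_left_mono)
qed

lemma norm_frac_int_le_const:
  fixes h :: "real \<Rightarrow> 'a::{banach, second_countable_topology}"
  assumes "0 < \<beta>" "continuous_on {0..T} h" "0 \<le> t" "t \<le> T"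
    and "\<And>s. 0 \<le> s \<Longrightarrow> s \<le> T \<Longrightarrow> norm (h s) \<le> c"
  shows "norm (frac_int \<beta> h t) \<le> t powr \<beta> / Gamma (\<beta> + 1) * c"
  using norm_frac_int_le[of \<beta> T h "\<lambda>_. c" t] assms by (simp add: frac_int_const)

lemma frac_int_continuous_on:
  fixes h :: "real \<Rightarrow> 'a::{banach, second_countable_topology}"
  assumes \<beta>: "0 < \<beta>" and h: "continuous_on {0..T} h"
  shows "continuous_on {0..T} (frac_int \<beta> h)"
proof -
  define H where "H s = indicator {0..T} s *\<^sub>R h s" for s
  have Hm [measurable]: "H \<in> borel_measurable borel"
    unfolding H_def using continuous_on_indicator_measurable[OF h] .
  obtain M where M: "0 \<le> M" "\<And>s. s \<in> {0..T} \<Longrightarrow> norm (h s) \<le> M"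
    using continuous_on_Icc_norm_bound[OF h] by blast
  have HM: "norm (H s) \<le> M" for s using M by (auto simp: H_def indicator_def)
  define K where "K s = indicator {0..T} s *\<^sub>R frac_kernel \<beta> s" for s
  \<comment> \<open>Reflecting the variable keeps the singular kernel fixed and moves only the
    bounded factor, which makes dominated convergence applicable.\<close>
  have alt: "frac_int \<beta> h t = (\<integral>s. K s *\<^sub>R H (t - s) \<partial>lborel)" if "t \<in> {0..T}" for t
  proof -
    have "frac_int \<beta> h t = (\<integral>s. frac_kernel \<beta> (t - s) *\<^sub>R H s \<partial>lborel)"
      using that by (simp add: frac_int_eq_lborel[of t T] H_def)
    also have "\<dots> = (\<integral>s. frac_kernel \<beta> s *\<^sub>R H (t - s) \<partial>lborel)"
      using lborel_integral_real_affine[of "-1" "\<lambda>s. frac_kernel \<beta> (t - s) *\<^sub>R H s" t] by simp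
    also have "\<dots> = (\<integral>s. K s *\<^sub>R H (t - s) \<partial>lborel)"
    proof (rule Bochner_Integration.integral_cong[OF refl])
      fix s show "frac_kernel \<beta> s *\<^sub>R H (t - s) = K s *\<^sub>R H (t - s)"
        using that by (cases "s < 0"; cases "s \<le> T") (simp_all add: K_def H_def)
    qed
    finally show ?thesis .
  qed
  show ?thesis
    unfolding continuous_on_sequentially
  proof (intro allI ballI impI, elim conjE)
    fix x :: "nat \<Rightarrow> real" and t assume t: "t \<in> {0..T}" and x: "\<forall>n. x n \<in> {0..T}" and lim: "x \<longlonglongrightarrow> t"
    have "(\<lambda>n. \<integral>s. K s *\<^sub>R H (x n - s) \<partial>lborel) \<longlonglongrightarrow> (\<integral>s. K s *\<^sub>R H (t - s) \<partial>lborel)"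
    proof (rule integral_dominated_convergence[where w="\<lambda>s. K s * M"])
      have "integrable lborel K"
        using frac_kernel_has_integral[OF \<beta>, of T] t unfolding K_def
        by (auto simp: has_bochner_integral_iff)
      then show "integrable lborel (\<lambda>s. K s * M)" by simp
      show "AE s in lborel. norm (K s *\<^sub>R H (x n - s)) \<le> K s * M" for n
        using HM frac_kernel_nonneg[OF \<beta>]
          by (intro AE_I2) (auto simp: K_def indicator_def intro!: mult_left_mono)
      \<comment> \<open>The truncated function \<open>H\<close> jumps at \<open>0\<close>, and its
        argument \<open>t - s\<close> reaches \<open>0\<close> exactly for \<open>s = t\<close>. The
        jump at \<open>T\<close> does no harm, since \<open>x n - s \<le> T\<close> for
        \<open>s \<ge> 0\<close>.\<close>
      have "AE s in lborel. s \<noteq> t" by (rule AE_lborel_singleton)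
      then show "AE s in lborel. (\<lambda>n. K s *\<^sub>R H (x n - s)) \<longlonglongrightarrow> K s *\<^sub>R H (t - s)"
      proof eventually_elim
        case (elim s)
        consider "s < 0" | "0 \<le> s" "s < t" | "t < s" using elim by linarith
        then show ?case
        proof cases
          case 1 then show ?thesis by (simp add: K_def)
        next
          case 2
          have ev: "\<forall>\<^sub>F n in sequentially. s < x n" using order_tendstoD(1)[OF lim \<open>s < t\<close>] .
          have 1: "\<forall>\<^sub>F n in sequentially. x n - s \<in> {0..T}"
            using ev by eventually_elim (use x 2 in \<open>auto simp: less_imp_le intro: order_trans\<close>,
              smt (verit) x atLeastAtMost_iff)
          have 2: "t - s \<in> {0..T}" using 2 t by auto
          have "(\<lambda>n. h (x n - s)) \<longlonglongrightarrow> h (t - s)"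
            by (rule continuous_on_tendsto_compose[OF h _ 2 1]) (intro tendsto_intros lim)
          moreover have "\<forall>\<^sub>F n in sequentially. h (x n - s) = H (x n - s)"
            using 1 by eventually_elim (simp add: H_def)
          ultimately have "(\<lambda>n. H (x n - s)) \<longlonglongrightarrow> h (t - s)"
            by (rule Lim_transform_eventually)
          moreover have "h (t - s) = H (t - s)" using 2 by (simp add: H_def)
          ultimately have "(\<lambda>n. H (x n - s)) \<longlonglongrightarrow> H (t - s)" by simp
          then show ?thesis by (intro tendsto_intros)
        next
          case 3
          have "\<forall>\<^sub>F n in sequentially. x n < s" using order_tendstoD(2)[OF lim 3] .
          then have "\<forall>\<^sub>F n in sequentially. K s *\<^sub>R H (x n - s) = K s *\<^sub>R H (t - s)"
            by eventually_elim (use 3 in \<open>auto simp: H_def\<close>)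
          then show ?thesis by (rule tendsto_eventually)
        qed
      qed
    qed (auto simp: K_def)
    then show "((frac_int \<beta> h) \<circ> x) \<longlonglongrightarrow> frac_int \<beta> h t"
      using alt t x by (simp add: o_def)
  qed
qed

section \<open>Semigroup law of fractional integration\<close>

lemma frac_kernel_mult_arg:
  assumes "0 < c" shows "frac_kernel \<beta> (c * x) = c powr (\<beta> - 1) * frac_kernel \<beta> x"
proof (cases "0 < x")
  case True
  then have "0 < c * x" "(c * x) powr (\<beta> - 1) = c powr (\<beta> - 1) * x powr (\<beta> - 1)"
    using assms by (simp_all add: powr_mult)
  then show ?thesis using True unfolding frac_kernel_def
    by (simp only: if_True times_divide_eq_right split: if_split)
next
  case False
  then have "c * x \<le> 0" using assms by (intro mult_nonneg_nonpos) auto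
  then show ?thesis using False by simp
qed

text \<open>Scaling \<open>{s..t}\<close> to the unit interval leaves Euler's Beta integral, whose
  Gamma factors cancel to \<open>1 / Gamma (\<beta> + \<gamma>)\<close>. The homogeneity of the two
  kernels and the Jacobian supply \<open>c powr (\<beta> + \<gamma> - 1)\<close> with
  \<open>c = t - s\<close>.\<close>

lemma frac_kernel_convolution:
  assumes \<beta>: "0 < \<beta>" and \<gamma>: "0 < \<gamma>" and st: "s < t"
  shows "has_bochner_integral lborel (\<lambda>\<tau>. frac_kernel \<beta> (t - \<tau>) * frac_kernel \<gamma> (\<tau> - s))
    (frac_kernel (\<beta> + \<gamma>) (t - s))"
proof -
  define \<phi> where "\<phi> x = frac_kernel \<beta> (1 - x) * frac_kernel \<gamma> x" for x
  have beta: "((\<lambda>x. x powr (\<gamma> - 1) * (1 - x) powr (\<beta> - 1) / (Gamma \<beta> * Gamma \<gamma>)) has_integral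
      (Beta \<gamma> \<beta> / (Gamma \<beta> * Gamma \<gamma>))) {0..1}"
    using has_integral_divide[OF has_integral_Beta_real[OF \<gamma> \<beta>]] .
  have eq: "Beta \<gamma> \<beta> / (Gamma \<beta> * Gamma \<gamma>) = 1 / Gamma (\<beta> + \<gamma>)"
    using Gamma_real_pos[OF \<beta>] Gamma_real_pos[OF \<gamma>] by (simp add: Beta_def add.commute)
  have "(\<phi> has_integral (Beta \<gamma> \<beta> / (Gamma \<beta> * Gamma \<gamma>))) {0..1}"
    by (rule has_integral_spike_finite[of "{0, 1}" _ _ _, OF _ _ beta])
      (auto simp: \<phi>_def frac_kernel_def)
  moreover have "(\<lambda>x. if x \<in> {0..1} then \<phi> x else 0) = \<phi>"
    by (auto simp: \<phi>_def fun_eq_iff)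
  ultimately have "(\<phi> has_integral (1 / Gamma (\<beta> + \<gamma>))) UNIV"
    using has_integral_restrict_UNIV[of "{0..1}" \<phi>] eq by simp
  moreover have "\<phi> \<in> borel_measurable borel" unfolding \<phi>_def by measurable
  ultimately have "has_bochner_integral lborel \<phi> (1 / Gamma (\<beta> + \<gamma>))"
    by (intro has_bochner_integral_lborel_nonneg)
      (auto simp: \<phi>_def frac_kernel_nonneg \<beta> \<gamma>)
  define c where "c = t - s"
  have c: "0 < c" using st by (simp add: c_def)
  have "has_bochner_integral lborel (\<lambda>\<tau>. \<phi> (- s / c + (1 / c) * \<tau>)) ((1 / Gamma (\<beta> + \<gamma>)) /\<^sub>R \<bar>1 /
    c\<bar>)"
    using \<open>has_bochner_integral lborel \<phi> _\<close> c
    by (subst lborel_has_bochner_integral_real_affine_iff[of "1 / c" _ _ "- s / c", symmetric]) auto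
  then have "has_bochner_integral lborel (\<lambda>\<tau>. c powr (\<beta> - 1) * c powr (\<gamma> - 1) * \<phi> (- s / c
    + (1 / c) * \<tau>))
     (c powr (\<beta> - 1) * c powr (\<gamma> - 1) * ((1 / Gamma (\<beta> + \<gamma>)) /\<^sub>R \<bar>1 / c\<bar>))"
    by (rule has_bochner_integral_mult_right)
  moreover have "c powr (\<beta> - 1) * c powr (\<gamma> - 1) * \<phi> (- s / c + (1 / c) * \<tau>)
      = frac_kernel \<beta> (t - \<tau>) * frac_kernel \<gamma> (\<tau> - s)" for \<tau>
  proof -
    have "c * (- s / c + (1 / c) * \<tau>) = \<tau> - s" using c by (simp add: right_diff_distrib)
    then have "t - \<tau> = c * (1 - (- s / c + (1 / c) * \<tau>))" "\<tau> - s = c * (- s / c + (1 / c) * \<tau>)"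
      by (simp_all add: c_def right_diff_distrib)
    then have "frac_kernel \<beta> (t - \<tau>) = c powr (\<beta> - 1) * frac_kernel \<beta> (1 - (- s / c + (1 / c) * \<tau>))"
      "frac_kernel \<gamma> (\<tau> - s) = c powr (\<gamma> - 1) * frac_kernel \<gamma> (- s / c + (1 / c) * \<tau>)"
      by (simp_all only: frac_kernel_mult_arg[OF c])
    then show ?thesis by (simp only: \<phi>_def mult_ac)
  qed
  moreover have "c powr (\<beta> - 1) * c powr (\<gamma> - 1) * ((1 / Gamma (\<beta> + \<gamma>)) /\<^sub>R \<bar>1 / c\<bar>)
    = frac_kernel (\<beta> + \<gamma>) (t - s)"
  proof -
    have "c powr (\<beta> + \<gamma> - 1) = c powr ((\<beta> - 1) + (\<gamma> - 1) + 1)"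
      by (simp add: add.commute diff_add_eq)
    also have "\<dots> = c powr (\<beta> - 1) * c powr (\<gamma> - 1) * c powr 1" by (simp only: powr_add)
    finally have eq: "c powr (\<beta> + \<gamma> - 1) = c powr (\<beta> - 1) * c powr (\<gamma> - 1) * c" using c by simp
    have "frac_kernel (\<beta> + \<gamma>) (t - s) = c powr (\<beta> + \<gamma> - 1) / Gamma (\<beta> + \<gamma>)"
      using c unfolding frac_kernel_def c_def by simp
    also have "\<dots> = c powr (\<beta> - 1) * c powr (\<gamma> - 1) * (1 / Gamma (\<beta> + \<gamma>) * c)"
      unfolding eq by (simp only: mult_ac divide_inverse mult_1_left)
    also have "1 / Gamma (\<beta> + \<gamma>) * c = (1 / Gamma (\<beta> + \<gamma>)) /\<^sub>R \<bar>1 / c\<bar>"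
      using c by simp
    finally show ?thesis by simp
  qed
  ultimately show ?thesis by simp
qed

text \<open>Exchanging the order of integration reduces the claim to
  \<open>frac_kernel_convolution\<close>. The absolute integrability that Fubini asks for comes from
  the same inner integral taken for \<open>norm (h s)\<close>, which is again a fractional integral
  of a continuous function.\<close>

lemma frac_int_compose:
  fixes h :: "real \<Rightarrow> 'a::{banach, second_countable_topology}"
  assumes \<beta>: "0 < \<beta>" and \<gamma>: "0 < \<gamma>" and h: "continuous_on {0..T} h" and tT: "t \<le> T"
  shows "frac_int \<beta> (frac_int \<gamma> h) t = frac_int (\<beta> + \<gamma>) h t"
proof -
  define H where "H s = indicator {0..T} s *\<^sub>R h s" for s
  have Hm [measurable]: "H \<in> borel_measurable borel"
    unfolding H_def using continuous_on_indicator_measurable[OF h] .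
  have H0: "H s = 0" if "s < 0" for s using that by (simp add: H_def)
  define f where "f = (\<lambda>(\<tau>, s). (frac_kernel \<beta> (t - \<tau>) * frac_kernel \<gamma> (\<tau> - s)) *\<^sub>R H s)"
  have fm [measurable]: "f \<in> borel_measurable (lborel \<Otimes>\<^sub>M lborel)"
    unfolding f_def by measurable
  have int_\<gamma>: "integrable lborel (\<lambda>s. frac_kernel \<gamma> (\<tau> - s) *\<^sub>R H s)" for \<tau>
    using frac_int_integrable[OF \<gamma> h] by (simp add: H_def)
  have nh: "continuous_on {0..T} (\<lambda>s. norm (h s))"
    by (intro continuous_intros h)
  have inner: "frac_kernel \<beta> (t - \<tau>) *\<^sub>R (indicator {0..T} \<tau> *\<^sub>R frac_int \<gamma> h \<tau>)
    = (\<integral>s. f (\<tau>, s) \<partial>lborel)"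
    and inner_norm: "frac_kernel \<beta> (t - \<tau>) *\<^sub>R (indicator {0..T} \<tau> *\<^sub>R frac_int \<gamma> (\<lambda>s. norm (h s))
      \<tau>)
      = (\<integral>s. norm (f (\<tau>, s)) \<partial>lborel)" for \<tau>
  proof -
    consider "\<tau> < 0" | "\<tau> \<in> {0..T}" | "T < \<tau>" by fastforce
    then have "frac_kernel \<beta> (t - \<tau>) *\<^sub>R (indicator {0..T} \<tau> *\<^sub>R frac_int \<gamma> h \<tau>)
      = (\<integral>s. f (\<tau>, s) \<partial>lborel)
      \<and> frac_kernel \<beta> (t - \<tau>) *\<^sub>R (indicator {0..T} \<tau> *\<^sub>R frac_int \<gamma> (\<lambda>s. norm (h s)) \<tau>)
      = (\<integral>s. norm (f (\<tau>, s)) \<partial>lborel)"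
    proof cases
      case 1
      then have "f (\<tau>, s) = 0" for s by (cases "s < 0") (auto simp: f_def H0)
      then show ?thesis using 1 by simp
    next
      case 2
      have "(\<integral>s. norm (f (\<tau>, s)) \<partial>lborel) = (\<integral>s. frac_kernel \<beta> (t - \<tau>) * (frac_kernel \<gamma> (\<tau> - s) *
        norm (H s)) \<partial>lborel)"
        by (intro Bochner_Integration.integral_cong) (auto simp: f_def frac_kernel_nonneg \<beta> \<gamma>)
      also have "\<dots> = frac_kernel \<beta> (t - \<tau>) * (\<integral>s. frac_kernel \<gamma> (\<tau> - s) * norm (H s) \<partial>lborel)"
        by simp
      also have "(\<integral>s. frac_kernel \<gamma> (\<tau> - s) * norm (H s) \<partial>lborel) = frac_int \<gamma> (\<lambda>s. norm (h s)) \<tau>"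
        using 2 by (simp add: frac_int_eq_lborel[of \<tau> T] H_def)
      finally have 3: "(\<integral>s. norm (f (\<tau>, s)) \<partial>lborel) = frac_kernel \<beta> (t - \<tau>) * frac_int \<gamma>
        (\<lambda>s. norm (h s)) \<tau>" .
      have "(\<integral>s. f (\<tau>, s) \<partial>lborel) = (\<integral>s. frac_kernel \<beta> (t - \<tau>) *\<^sub>R (frac_kernel \<gamma> (\<tau> - s) *\<^sub>R H s)
        \<partial>lborel)"
        by (simp add: f_def)
      also have "\<dots> = frac_kernel \<beta> (t - \<tau>) *\<^sub>R frac_int \<gamma> h \<tau>"
        using 2 by (simp add: frac_int_eq_lborel[of \<tau> T] H_def del: scaleR_scaleR)
      finally show ?thesis using 2 3 by simp
    next
      case 3
      then show ?thesis using tT by (simp add: f_def)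
    qed
    then show "frac_kernel \<beta> (t - \<tau>) *\<^sub>R (indicator {0..T} \<tau> *\<^sub>R frac_int \<gamma> h \<tau>)
      = (\<integral>s. f (\<tau>, s) \<partial>lborel)"
      and "frac_kernel \<beta> (t - \<tau>) *\<^sub>R (indicator {0..T} \<tau> *\<^sub>R frac_int \<gamma> (\<lambda>s. norm (h s)) \<tau>)
      = (\<integral>s. norm (f (\<tau>, s)) \<partial>lborel)" by blast+
  qed
  have intf: "integrable (lborel \<Otimes>\<^sub>M lborel) f"
  proof (rule lborel_pair.Fubini_integrable)
    show "integrable lborel (\<lambda>\<tau>. \<integral>s. norm (f (\<tau>, s)) \<partial>lborel)"
      unfolding inner_norm[symmetric]
      by (rule frac_int_integrable[OF \<beta> frac_int_continuous_on[OF \<gamma> nh]])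
    show "AE \<tau> in lborel. integrable lborel (\<lambda>s. f (\<tau>, s))"
    proof (intro AE_I2)
      fix \<tau> show "integrable lborel (\<lambda>s. f (\<tau>, s))"
        using integrable_scaleR_right[OF int_\<gamma>, of "frac_kernel \<beta> (t - \<tau>)" \<tau>] by (simp add: f_def)
    qed
  qed fact
  have "frac_int \<beta> (frac_int \<gamma> h) t = (\<integral>\<tau>. (\<integral>s. f (\<tau>, s) \<partial>lborel) \<partial>lborel)"
    unfolding frac_int_eq_lborel[OF tT, of \<beta>] inner[symmetric] ..
  also have "\<dots> = (\<integral>s. (\<integral>\<tau>. f (\<tau>, s) \<partial>lborel) \<partial>lborel)"
    using lborel_pair.Fubini_integral[of "\<lambda>\<tau> s. f (\<tau>, s)"] intf by simp
  also have "\<dots> = (\<integral>s. frac_kernel (\<beta> + \<gamma>) (t - s) *\<^sub>R (indicator {0..T} s *\<^sub>R h s) \<partial>lborel)"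
  proof (rule Bochner_Integration.integral_cong[OF refl])
    fix s
    show "(\<integral>\<tau>. f (\<tau>, s) \<partial>lborel) = frac_kernel (\<beta> + \<gamma>) (t - s) *\<^sub>R (indicator {0..T} s *\<^sub>R h s)"
    proof (cases "s < t")
      case True
      have "(\<integral>\<tau>. f (\<tau>, s) \<partial>lborel)
          = (\<integral>\<tau>. frac_kernel \<beta> (t - \<tau>) * frac_kernel \<gamma> (\<tau> - s) \<partial>lborel) *\<^sub>R H s"
        using frac_kernel_convolution[OF \<beta> \<gamma> True]
        unfolding f_def has_bochner_integral_iff by (simp del: scaleR_scaleR)
      also have "\<dots> = frac_kernel (\<beta> + \<gamma>) (t - s) *\<^sub>R H s"
        using frac_kernel_convolution[OF \<beta> \<gamma> True] unfolding has_bochner_integral_iff by simp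
      finally show ?thesis unfolding H_def .
    next
      case False
      then have "f (\<tau>, s) = 0" for \<tau>
        by (cases "\<tau> < t") (auto simp: f_def)
      then show ?thesis using False by simp
    qed
  qed
  also have "\<dots> = frac_int (\<beta> + \<gamma>) h t"
    by (rule frac_int_eq_lborel[OF tT, symmetric])
  finally show ?thesis .
qed

section \<open>Inversion: Volterra equations and fractional derivatives\<close>

lemma frac_int_1_has_vector_derivative:
  fixes h :: "real \<Rightarrow> 'a::{banach, second_countable_topology}"
  assumes h: "continuous_on {0..T} h" and x: "x \<in> {0..T}"
  shows "(frac_int 1 h has_vector_derivative h x) (at x within {0..T})"
  unfolding has_vector_derivative_def has_derivative_within_alt
proof (intro conjI allI impI bounded_linear_scaleR_left)
  fix e :: real assume e: "0 < e"
  obtain d where d: "0 < d" "\<And>y. y \<in> {0..T} \<Longrightarrow> dist y x < d \<Longrightarrow> dist (h y) (h x) < e"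
    using h x e unfolding continuous_on_iff by blast
  \<comment> \<open>The integral of the constant \<open>h x\<close> is exactly the linear term of
    the derivative, so only increments of the integral of \<open>k\<close> remain, and
    \<open>k\<close> is at most \<open>e\<close> near \<open>x\<close>.\<close>
  define k where "k s = h s - h x" for s
  have k: "continuous_on {0..T} k" unfolding k_def by (intro continuous_intros h)
  have main: "norm (frac_int 1 k b - frac_int 1 k a) \<le> e * (b - a)"
    if ab: "0 \<le> a" "a \<le> b" "b \<le> T" and le: "\<And>s. s \<in> {a..b} \<Longrightarrow> norm (k s) \<le> e" for a b
  proof -
    let ?K = "\<lambda>s. indicator {0..T} s *\<^sub>R k s"
    have i: "integrable lborel (\<lambda>s. frac_kernel 1 (c - s) *\<^sub>R ?K s)" for c
      using frac_int_integrable[OF _ k, of 1] by simp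
    have "frac_int 1 k b - frac_int 1 k a
        = (\<integral>s. frac_kernel 1 (b - s) *\<^sub>R ?K s - frac_kernel 1 (a - s) *\<^sub>R ?K s \<partial>lborel)"
      using ab i by (simp add: frac_int_eq_lborel[of _ T] del: scaleR_scaleR)
    also have "norm \<dots> \<le> (\<integral>s. indicator {a..b} s * e \<partial>lborel)"
    proof (rule Bochner_Integration.integral_norm_bound_integral)
      show "norm (frac_kernel 1 (b - s) *\<^sub>R ?K s - frac_kernel 1 (a - s) *\<^sub>R ?K s)
        \<le> indicator {a..b} s * e" for s
      proof -
        consider "s < a" | "a \<le> s" "s < b" | "b \<le> s" by linarith
        then show ?thesis
        proof cases
          case 1 then show ?thesis using ab by simp
        next
          case 2 then show ?thesis using ab le[of s] by simp
        next
          case 3 then show ?thesis using ab e by (auto simp: indicator_def)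
        qed
      qed
      show "integrable lborel (\<lambda>s. indicat_real {a..b} s * e)"
        using ab by (intro integrable_mult_left integrable_real_indicator) auto
    qed (use i in \<open>auto simp del: scaleR_scaleR\<close>)
    also have "\<dots> = e * (b - a)" using ab by (simp add: mult.commute)
    finally show ?thesis .
  qed
  show "\<exists>d>0. \<forall>y\<in>{0..T}. norm (y - x) < d \<longrightarrow>
      norm (frac_int 1 h y - frac_int 1 h x - (y - x) *\<^sub>R h x) \<le> e * norm (y - x)"
  proof (intro exI[of _ d] conjI ballI impI)
    fix y assume y: "y \<in> {0..T}" "norm (y - x) < d"
    have kh: "frac_int 1 k y' = frac_int 1 h y' - y' *\<^sub>R h x" if "y' \<in> {0..T}" for y'
      unfolding k_def using that frac_int_diff[OF _ h continuous_on_const, of 1 y']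
      by (simp add: frac_int_const Gamma_numeral)
    have eq: "frac_int 1 h y - frac_int 1 h x - (y - x) *\<^sub>R h x = frac_int 1 k y - frac_int 1 k x"
      using x y by (simp add: kh algebra_simps)
    have le: "norm (k s) \<le> e" if "s \<in> {x..y} \<union> {y..x}" for s
      using d(2)[of s] that x y by (force simp: k_def dist_norm)
    show "norm (frac_int 1 h y - frac_int 1 h x - (y - x) *\<^sub>R h x) \<le> e * norm (y - x)"
    proof (cases "x \<le> y")
      case True
      then show ?thesis using main[of x y] le x y by (simp add: eq)
    next
      case False
      then show ?thesis using main[of y x] le x y by (simp add: eq norm_minus_commute)
    qed
  qed (rule d)
qed

lemma frac_int_1_eq_0D:
  fixes h :: "real \<Rightarrow> 'a::{banach, second_countable_topology}"
  assumes T: "0 < T" and h: "continuous_on {0..T} h"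
    and zero: "\<And>t. t \<in> {0..T} \<Longrightarrow> frac_int 1 h t = 0" and t: "t \<in> {0..T}"
  shows "h t = 0"
proof (rule vector_derivative_unique_within_closed_interval[of 0 T t "frac_int 1 h"])
  show "(frac_int 1 h has_vector_derivative 0) (at t within cbox 0 T)"
    by (rule has_vector_derivative_transform[of t "cbox 0 T" _ "\<lambda>_. 0"])
      (use t zero in \<open>auto simp: has_vector_derivative_const\<close>)
qed (use T t frac_int_1_has_vector_derivative[OF h t] in \<open>auto simp: box_real\<close>)

lemma has_vector_derivative_zero_eq:
  fixes f :: "real \<Rightarrow> 'a::real_normed_vector"
  assumes "\<And>t. t \<in> {0..T} \<Longrightarrow> (f has_vector_derivative 0) (at t within {0..T})" "t \<in> {0..T}"
  shows "f t = f 0"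
proof -
  have "0 \<in> {0..T}" using assms(2) by auto
  obtain c where "\<And>x. x \<in> {0..T} \<Longrightarrow> f x = c"
    by (rule has_vector_derivative_zero_constant[of "{0..T}" f]) (use assms(1) in auto)
  then show ?thesis using assms(2) \<open>0 \<in> {0..T}\<close> by metis
qed

text \<open>Convolving with the complementary kernel turns \<open>frac_int \<alpha> q\<close> into
  \<open>frac_int 1 q\<close>, a primitive of \<open>q\<close>.\<close>

lemma RL_of_volterra:
  fixes u q :: "real \<Rightarrow> 'a::{banach, second_countable_topology}"
  assumes \<alpha>: "0 < \<alpha>" "\<alpha> < 1" and q: "continuous_on {0..T} q"
    and eq: "\<And>t. t \<in> {0..T} \<Longrightarrow> u t = x + frac_int \<alpha> q t" and t: "t \<in> {0..T}"
  shows "(frac_int (1 - \<alpha>) (\<lambda>s. u s - x) has_vector_derivative q t) (at t within {0..T})"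
proof (rule has_vector_derivative_transform[OF t _ frac_int_1_has_vector_derivative[OF q t]])
  fix s assume s: "s \<in> {0..T}"
  have "frac_int (1 - \<alpha>) (\<lambda>s. u s - x) s = frac_int (1 - \<alpha>) (frac_int \<alpha> q) s"
    by (rule frac_int_cong) (use s eq in auto)
  also have "\<dots> = frac_int 1 q s"
    using frac_int_compose[of "1 - \<alpha>" \<alpha> T q s] \<alpha> q s by simp
  finally show "frac_int (1 - \<alpha>) (\<lambda>s. u s - x) s = frac_int 1 q s" .
qed

text \<open>Both \<open>frac_int (1 - \<alpha>) w\<close> and \<open>frac_int 1 q\<close> vanish at
  \<open>0\<close> and have derivative \<open>q\<close>, so they agree. Applying
  \<open>frac_int \<alpha>\<close> to both gives the claim under one ordinary integral, which is
  injective on continuous functions.\<close>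

lemma volterra_of_RL:
  fixes u q :: "real \<Rightarrow> 'a::{banach, second_countable_topology}"
  assumes \<alpha>: "0 < \<alpha>" "\<alpha> < 1" and T: "0 < T"
    and u: "continuous_on {0..T} u" and q: "continuous_on {0..T} q"
    and der: "\<And>t. t \<in> {0..T} \<Longrightarrow>
      (frac_int (1 - \<alpha>) (\<lambda>s. u s - x) has_vector_derivative q t) (at t within {0..T})"
    and t: "t \<in> {0..T}"
  shows "u t = x + frac_int \<alpha> q t"
proof -
  define w where "w s = u s - x" for s
  have w: "continuous_on {0..T} w" unfolding w_def by (intro continuous_intros u)
  have 1: "frac_int (1 - \<alpha>) w s = frac_int 1 q s" if s: "s \<in> {0..T}" for s
  proof -
    have "((\<lambda>s. frac_int (1 - \<alpha>) w s - frac_int 1 q s) has_vector_derivative (q t - q t))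
      (at t within {0..T})"
      if "t \<in> {0..T}" for t
      using der[OF that] frac_int_1_has_vector_derivative[OF q that]
      unfolding w_def by (rule has_vector_derivative_diff)
    then have "frac_int (1 - \<alpha>) w s - frac_int 1 q s = frac_int (1 - \<alpha>) w 0 - frac_int 1 q 0"
      using s by (intro has_vector_derivative_zero_eq) auto
    then show ?thesis by simp
  qed
  have Iq: "continuous_on {0..T} (frac_int \<alpha> q)"
    by (rule frac_int_continuous_on[OF \<alpha>(1) q])
  have "frac_int 1 (\<lambda>s. w s - frac_int \<alpha> q s) s = 0" if s: "s \<in> {0..T}" for s
  proof -
    have "frac_int 1 w s = frac_int \<alpha> (frac_int (1 - \<alpha>) w) s"
      using frac_int_compose[of \<alpha> "1 - \<alpha>" T w s] \<alpha> w s by simp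
    also have "\<dots> = frac_int \<alpha> (frac_int 1 q) s"
      by (rule frac_int_cong) (use 1 s in auto)
    also have "\<dots> = frac_int 1 (frac_int \<alpha> q) s"
      using frac_int_compose[of \<alpha> 1 T q s] frac_int_compose[of 1 \<alpha> T q s] \<alpha> q s
      by (simp add: add.commute)
    finally show ?thesis
      using frac_int_diff[OF _ w Iq, of 1 s] s by simp
  qed
  then have "w t - frac_int \<alpha> q t = 0"
    using frac_int_1_eq_0D[OF T continuous_on_diff[OF w Iq] _ t] by blast
  then show ?thesis by (simp add: w_def algebra_simps)
qed

section \<open>The extremum principle and the energy estimate\<close>

text \<open>Near \<open>t0\<close> the density differs little from its nonpositive end value, and
  the remote part of the integral contributes only a term linear in the increment. So the upward
  Hoelder constant of order \<alpha>, the natural regularity here, can be made as small as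
  desired.\<close>

lemma frac_int_increment_le:
  fixes q :: "real \<Rightarrow> real"
  assumes \<alpha>: "0 < \<alpha>" and \<alpha>1: "\<alpha> \<le> 1" and t0: "0 < t0" and q: "continuous_on {0..t0} q"
    and neg: "q t0 \<le> 0" and \<epsilon>: "0 < \<epsilon>"
  obtains C where "0 \<le> C" "\<And>b. 0 \<le> b \<Longrightarrow> b \<le> t0 \<Longrightarrow>
    frac_int \<alpha> q t0 - frac_int \<alpha> q b \<le> 2 * \<epsilon> / Gamma (\<alpha> + 1) * (t0 - b) powr \<alpha> + C * (t0 - b)"
proof -
  define q' where "q' s = q s - q t0" for s
  have q': "continuous_on {0..t0} q'" unfolding q'_def by (intro continuous_intros q)
  obtain d where d: "0 < d" "\<And>s. s \<in> {0..t0} \<Longrightarrow> dist s t0 < d \<Longrightarrow> dist (q s) (q t0) < \<epsilon>"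
    using q t0 \<epsilon> unfolding continuous_on_iff by (metis atLeastAtMost_iff less_eq_real_def)
  obtain M0 where M0: "0 \<le> M0" "\<And>s. s \<in> {0..t0} \<Longrightarrow> norm (q' s) \<le> M0"
    using continuous_on_Icc_norm_bound[OF q'] by blast
  define M where "M = M0 / d"
  have M: "0 \<le> M" using M0 d by (simp add: M_def)
  have q'_le: "\<bar>q' s\<bar> \<le> \<epsilon> + M * (t0 - s)" if s: "s \<in> {0..t0}" for s
  proof (cases "t0 - s < d")
    case True
    have "dist (q s) (q t0) < \<epsilon>" using d(2)[OF s] True s by (simp add: dist_real_def)
    moreover have "0 \<le> M * (t0 - s)" using M s by simp
    ultimately show ?thesis by (simp add: q'_def dist_real_def)
  next
    case False
    have "M0 = M * d" using d by (simp add: M_def)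
    also have "\<dots> \<le> M * (t0 - s)" using False M by (intro mult_left_mono) auto
    finally show ?thesis using M0(2)[OF s] \<epsilon> by simp
  qed
  \<comment> \<open>In this affine majorant of \<open>\<bar>q' s\<bar>\<close> the constant serves
    near \<open>t0\<close>, and the slope \<open>M0 / d\<close> serves at distance at least
    \<open>d\<close>. Its fractional integral is explicit.\<close>
  define P where "P s = \<epsilon> + M * (t0 - s)" for s
  have P: "continuous_on {0..t0} P" unfolding P_def by (intro continuous_intros)
  have P_int: "frac_int \<alpha> P t = (\<epsilon> + M * t0) * (t powr \<alpha> / Gamma (\<alpha> + 1))
    - M * (t powr \<alpha> * t / Gamma (\<alpha> + 2))"
    if t: "t \<in> {0..t0}" for t
  proof -
    have "frac_int \<alpha> (\<lambda>s. s) t = frac_int \<alpha> (frac_int 1 (\<lambda>_. 1)) t"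
      by (rule frac_int_cong) (simp add: frac_int_const Gamma_numeral)
    also have "\<dots> = frac_int (\<alpha> + 1) (\<lambda>_. 1) t"
      using frac_int_compose[of \<alpha> 1 t0 "\<lambda>_. 1::real" t] \<alpha> t by simp
    also have "\<dots> = t powr \<alpha> * t / Gamma (\<alpha> + 2)"
      using \<alpha> t by (cases "t = 0") (simp_all add: frac_int_const powr_add algebra_simps)
    finally have id: "frac_int \<alpha> (\<lambda>s. s) t = t powr \<alpha> * t / Gamma (\<alpha> + 2)" .
    have "frac_int \<alpha> P t = frac_int \<alpha> (\<lambda>s. (\<epsilon> + M * t0) - M * s) t"
      by (rule frac_int_cong) (simp add: P_def algebra_simps)
    also have "\<dots> = frac_int \<alpha> (\<lambda>s. \<epsilon> + M * t0) t - frac_int \<alpha> (\<lambda>s. M * s) t"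
      using t by (intro frac_int_diff[of \<alpha> t0] \<alpha>) (auto intro!: continuous_intros)
    also have "frac_int \<alpha> (\<lambda>s. M * s) t = M * frac_int \<alpha> (\<lambda>s. s) t"
      using t by (intro frac_int_bounded_linear[of \<alpha> t0] \<alpha> bounded_linear_mult_right)
        (auto intro!: continuous_intros)
    finally show ?thesis using t \<alpha> by (simp add: id frac_int_const mult.commute)
  qed
  \<comment> \<open>The first summand comes from the increment of the fractional integral of
    \<open>P\<close>, the second from \<open>2 * M * h * h powr \<alpha>\<close> with
    \<open>h powr \<alpha> \<le> t0 powr \<alpha>\<close>.\<close>
  define C where "C = M * t0 powr \<alpha> / Gamma (\<alpha> + 2) + 2 * M * t0 powr \<alpha> / Gamma (\<alpha> + 1)"
  have G1: "0 < Gamma (\<alpha> + 1)" and G2: "0 < Gamma (\<alpha> + 2)"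
    using \<alpha> by (auto intro: Gamma_real_pos)
  have G12: "Gamma (\<alpha> + 1) \<le> Gamma (\<alpha> + 2)"
    using Gamma_plus1[of "\<alpha> + 1"] \<alpha> G1 nonpos_Ints_nonpos[of "\<alpha> + 1"]
    by (fastforce simp: algebra_simps)
  show ?thesis
  proof (rule that)
    show "0 \<le> C" unfolding C_def using M G1 G2 by simp
    fix b assume b: "0 \<le> b" "b \<le> t0"
    let ?g = "frac_kernel \<alpha>" and ?I = "\<lambda>k s. indicator {0..t0} s *\<^sub>R k s"
    have i: "integrable lborel (\<lambda>s. ?g (c - s) *\<^sub>R ?I k s)" if "continuous_on {0..t0} k"
      for c and k :: "real \<Rightarrow> real"
      using frac_int_integrable[OF \<alpha> that] .
    have Ig: "has_bochner_integral lborel (\<lambda>s. indicator {b..t0} s *\<^sub>R ?g (t0 - s)) ((t0 - b) powr \<alpha>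
      / Gamma (\<alpha> + 1))"
      by (rule frac_kernel_reflected_has_integral[OF \<alpha> b(2)])
    define h where "h = t0 - b"
    have "frac_int \<alpha> q' t0 - frac_int \<alpha> q' b = (\<integral>s. ?g (t0 - s) *\<^sub>R ?I q' s - ?g (b - s) *\<^sub>R ?I q' s
      \<partial>lborel)"
      using b i[OF q'] by (simp add: frac_int_eq_lborel[of _ t0] del: real_scaleR_def)
    \<comment> \<open>Before \<open>b\<close> the kernel decreases from \<open>?g (b - s)\<close> to
      \<open>?g (t0 - s)\<close> and \<open>\<bar>q' s\<bar> \<le> P s\<close>. After
      \<open>b\<close> only \<open>?g (t0 - s)\<close> is present, and
      \<open>q' s + P s \<le> 2 * P s \<le> 2 * (\<epsilon> + M * h)\<close>. The resulting
      integrand involves \<open>P\<close> alone.\<close>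
    also have "\<dots> \<le> (\<integral>s. (?g (b - s) *\<^sub>R ?I P s - ?g (t0 - s) *\<^sub>R ?I P s)
        + 2 * (\<epsilon> + M * h) * (indicator {b..t0} s *\<^sub>R ?g (t0 - s)) \<partial>lborel)"
    proof (rule integral_mono)
      show "integrable lborel (\<lambda>s. ?g (t0 - s) *\<^sub>R ?I q' s - ?g (b - s) *\<^sub>R ?I q' s)"
        by (intro Bochner_Integration.integrable_diff i q')
      show "integrable lborel (\<lambda>s. (?g (b - s) *\<^sub>R ?I P s - ?g (t0 - s) *\<^sub>R ?I P s)
        + 2 * (\<epsilon> + M * h) * (indicator {b..t0} s *\<^sub>R ?g (t0 - s)))"
        using Ig by (intro Bochner_Integration.integrable_diff Bochner_Integration.integrable_add
            integrable_mult_right i P) (auto simp: has_bochner_integral_iff)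
      fix s
      consider "s < 0 \<or> t0 < s" | "0 \<le> s" "s < b" | "0 \<le> s" "b \<le> s" "s \<le> t0" using b by linarith
      then show "?g (t0 - s) *\<^sub>R ?I q' s - ?g (b - s) *\<^sub>R ?I q' s
        \<le> (?g (b - s) *\<^sub>R ?I P s - ?g (t0 - s) *\<^sub>R ?I P s)
        + 2 * (\<epsilon> + M * h) * (indicator {b..t0} s *\<^sub>R ?g (t0 - s))"
      proof cases
        case 1
        then show ?thesis using b by auto
      next
        case 2
        have "(?g (t0 - s) - ?g (b - s)) * q' s \<le> \<bar>?g (t0 - s) - ?g (b - s)\<bar> * \<bar>q' s\<bar>"
          by (simp add: abs_mult[symmetric])
        also have "\<dots> \<le> \<bar>?g (t0 - s) - ?g (b - s)\<bar> * P s"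
          using q'_le[of s] 2 b by (intro mult_left_mono) (auto simp: P_def)
        finally have "(?g (t0 - s) - ?g (b - s)) * q' s \<le> (?g (b - s) - ?g (t0 - s)) * P s"
          using frac_kernel_antimono[of \<alpha> "b - s" "t0 - s"] 2 b \<alpha> \<alpha>1 by simp
        then show ?thesis using 2 b by (simp add: algebra_simps)
      next
        case 3
        have "P s \<le> \<epsilon> + M * h" using 3 M by (auto simp: P_def h_def intro!: mult_left_mono)
        moreover have "q' s \<le> P s" using q'_le[of s] 3 b by (auto simp: P_def)
        ultimately have "?g (t0 - s) * q' s \<le> ?g (t0 - s) * (2 * (\<epsilon> + M * h) - P s)"
          using frac_kernel_nonneg[OF \<alpha>, of "t0 - s"] by (intro mult_left_mono) auto
        then show ?thesis using 3 b by (simp add: algebra_simps)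
      qed
    qed
    also have "\<dots> = frac_int \<alpha> P b - frac_int \<alpha> P t0 + 2 * (\<epsilon> + M * h) * (h powr \<alpha> / Gamma (\<alpha> + 1))"
      using has_bochner_integral_add[OF has_bochner_integral_diff[OF
          has_bochner_integral_integrable[OF i[OF P]] has_bochner_integral_integrable[OF i[OF P]]]
          has_bochner_integral_mult_right[OF Ig], THEN has_bochner_integral_integral_eq]
        b unfolding h_def by (simp only: frac_int_eq_lborel[of _ t0] order_refl)
    finally have 1: "frac_int \<alpha> q' t0 - frac_int \<alpha> q' b
      \<le> frac_int \<alpha> P b - frac_int \<alpha> P t0 + 2 * (\<epsilon> + M * h) * (h powr \<alpha> / Gamma (\<alpha> + 1))" .
    have mono: "b powr \<alpha> \<le> t0 powr \<alpha>" using b \<alpha> by (intro powr_mono2) auto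
    have 2: "frac_int \<alpha> P b - frac_int \<alpha> P t0 \<le> M * t0 powr \<alpha> / Gamma (\<alpha> + 2) * h"
    proof -
      define X where "X = t0 powr \<alpha> - b powr \<alpha>"
      have X: "0 \<le> X" using mono by (simp add: X_def)
      have "frac_int \<alpha> P b - frac_int \<alpha> P t0
        = M * t0 powr \<alpha> / Gamma (\<alpha> + 2) * h + M * (b * X / Gamma (\<alpha> + 2) - t0 * X / Gamma (\<alpha> + 1))
          - \<epsilon> * X / Gamma (\<alpha> + 1)"
        using b t0 G1 G2 by (simp add: P_int X_def h_def field_simps)
      moreover have "b * X / Gamma (\<alpha> + 2) \<le> t0 * X / Gamma (\<alpha> + 1)"
        using b X G1 G12 by (intro frac_le mult_right_mono) auto
      moreover have "0 \<le> \<epsilon> * X / Gamma (\<alpha> + 1)" using \<epsilon> X G1 by simp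
      ultimately show ?thesis using M by (smt (verit) mult_nonneg_nonpos)
    qed
    have 3: "M * h * h powr \<alpha> / Gamma (\<alpha> + 1) \<le> M * h * t0 powr \<alpha> / Gamma (\<alpha> + 1)"
      using b M G1 \<alpha> by (intro divide_right_mono mult_left_mono powr_mono2) (auto simp: h_def)
    have "frac_int \<alpha> q' t0 - frac_int \<alpha> q' b \<le> 2 * \<epsilon> / Gamma (\<alpha> + 1) * h powr \<alpha> + C * h"
    proof -
      have e: "2 * (\<epsilon> + M * h) * (h powr \<alpha> / Gamma (\<alpha> + 1))
         = 2 * \<epsilon> / Gamma (\<alpha> + 1) * h powr \<alpha> + 2 * (M * h * h powr \<alpha> / Gamma (\<alpha> + 1))"
        using G1 by (simp add: field_simps)
      have "C * h = M * t0 powr \<alpha> / Gamma (\<alpha> + 2) * h + 2 * (M * h * t0 powr \<alpha> / Gamma (\<alpha> + 1))"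
        by (simp add: C_def algebra_simps)
      then show ?thesis using 1 2 3 e by linarith
    qed
    \<comment> \<open>Putting the end value back adds \<open>q t0\<close> times the increment of
      \<open>t powr \<alpha> / Gamma (\<alpha> + 1)\<close>, which is nonpositive because
      \<open>q t0 \<le> 0\<close>.\<close>
    moreover have "frac_int \<alpha> q' t = frac_int \<alpha> q t - t powr \<alpha> / Gamma (\<alpha> + 1) * q t0"
      if "t \<in> {0..t0}" for t
      unfolding q'_def using that \<alpha> frac_int_diff[OF \<alpha> q continuous_on_const, of t]
      by (simp add: frac_int_const)
    moreover have "(t0 powr \<alpha> - b powr \<alpha>) / Gamma (\<alpha> + 1) * q t0 \<le> 0"
      using mono G1 neg by (intro mult_nonneg_nonpos) auto
    ultimately show "frac_int \<alpha> q t0 - frac_int \<alpha> q b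
       \<le> 2 * \<epsilon> / Gamma (\<alpha> + 1) * (t0 - b) powr \<alpha> + C * (t0 - b)"
      using b t0 by (simp add: h_def diff_divide_distrib left_diff_distrib)
  qed
qed

text \<open>If \<open>q t0\<close> were negative, consider
  \<open>z = - c0 - frac_int \<alpha> q\<close>, which is nonnegative and vanishes at
  \<open>t0\<close>. Applying \<open>frac_int (1 - \<alpha>)\<close> to \<open>z\<close> yields
  minus the ordinary primitive of \<open>q\<close> plus a nondecreasing term, so it would gain at
  least \<open>\<delta> * h\<close> over the last stretch of length \<open>h\<close>. But
  \<open>z\<close> is so small there, by \<open>frac_int_increment_le\<close>, that the gain is at
  most \<open>3 / 4 * \<delta> * h\<close>.\<close>

lemma frac_extremum_principle:
  fixes q :: "real \<Rightarrow> real"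
  assumes \<alpha>: "0 < \<alpha>" "\<alpha> < 1" and t0: "0 < t0" and q: "continuous_on {0..t0} q" and c0: "c0 \<le> 0"
    and le: "\<And>s. 0 \<le> s \<Longrightarrow> s \<le> t0 \<Longrightarrow> c0 + frac_int \<alpha> q s \<le> 0"
    and eq: "c0 + frac_int \<alpha> q t0 = 0"
  shows "0 \<le> q t0"
proof (rule ccontr)
  assume "\<not> 0 \<le> q t0"
  then have neg: "q t0 < 0" by simp
  define \<delta> where "\<delta> = - q t0 / 2"
  have \<delta>: "0 < \<delta>" using neg by (simp add: \<delta>_def)
  obtain d where d: "0 < d" "\<And>s. s \<in> {0..t0} \<Longrightarrow> dist s t0 < d \<Longrightarrow> dist (q s) (q t0) < \<delta>"
    using q t0 \<delta> unfolding continuous_on_iff by (metis atLeastAtMost_iff less_eq_real_def)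
  have q_le: "q s \<le> - \<delta>" if "s \<in> {0..t0}" "t0 - s < d" for s
    using d(2)[OF that(1)] that by (auto simp: dist_real_def \<delta>_def)
  define \<kappa> where "\<kappa> = 1 - \<alpha>"
  have \<kappa>: "0 < \<kappa>" "\<kappa> < 1" using \<alpha> by (auto simp: \<kappa>_def)
  have G: "0 < Gamma (\<alpha> + 1)" "0 < Gamma \<kappa>" using \<alpha> \<kappa> by (auto intro: Gamma_real_pos)
  \<comment> \<open>Chosen so that the Hoelder term in the bound for \<open>z\<close>, multiplied by
    the kernel \<open>r powr (- \<alpha>) / Gamma \<kappa>\<close>, gives exactly
    \<open>\<delta> / 2\<close>.\<close>
  define \<epsilon> where "\<epsilon> = \<delta> * Gamma \<kappa> * Gamma (\<alpha> + 1) / 4"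
  have \<epsilon>: "0 < \<epsilon>" using \<delta> G by (simp add: \<epsilon>_def)
  obtain C where C: "0 \<le> C" "\<And>b. 0 \<le> b \<Longrightarrow> b \<le> t0 \<Longrightarrow>
    frac_int \<alpha> q t0 - frac_int \<alpha> q b \<le> 2 * \<epsilon> / Gamma (\<alpha> + 1) * (t0 - b) powr \<alpha> + C * (t0 - b)"
    using frac_int_increment_le[OF \<alpha>(1) less_imp_le[OF \<alpha>(2)] t0 q less_imp_le[OF neg] \<epsilon>] by blast
  have c1: "2 * \<epsilon> / Gamma (\<alpha> + 1) = \<delta> * Gamma \<kappa> / 2" using G by (simp add: \<epsilon>_def)
  \<comment> \<open>The last entry makes \<open>C * h powr \<kappa>\<close> at most
    \<open>\<delta> * Gamma \<kappa> / 4\<close>, so that the linear term costs another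
    \<open>\<delta> / 4\<close>; \<open>C + 1\<close> keeps the quotient meaningful for
    \<open>C = 0\<close>.\<close>
  define h where "h = Min {d / 2, t0, (\<delta> * Gamma \<kappa> / (4 * (C + 1))) powr (1 / \<kappa>)}"
  have h: "0 < h" "h < d" "h \<le> t0" "h \<le> (\<delta> * Gamma \<kappa> / (4 * (C + 1))) powr (1 / \<kappa>)"
    using d(1) t0 \<delta> G C(1) unfolding h_def by auto
  have "h powr \<kappa> \<le> ((\<delta> * Gamma \<kappa> / (4 * (C + 1))) powr (1 / \<kappa>)) powr \<kappa>"
    using h \<kappa> by (intro powr_mono2) auto
  also have "\<dots> = \<delta> * Gamma \<kappa> / (4 * (C + 1))" using \<kappa> \<delta> G C(1) by (simp add: powr_powr)
  finally have "(C + 1) * h powr \<kappa> \<le> \<delta> * Gamma \<kappa> / 4"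
    using C(1) by (simp add: field_simps)
  then have Ch: "C * h powr \<kappa> \<le> \<delta> * Gamma \<kappa> / 4"
    by (simp add: distrib_right) (smt (verit) powr_ge_zero)
  define b where "b = t0 - h"
  have b: "0 \<le> b" "b < t0" "t0 - b = h" using h by (auto simp: b_def)
  define z where "z s = - c0 - frac_int \<alpha> q s" for s
  have Iq: "continuous_on {0..t0} (frac_int \<alpha> q)" by (rule frac_int_continuous_on[OF \<alpha>(1) q])
  have z: "continuous_on {0..t0} z" unfolding z_def by (intro continuous_intros Iq)
  have z0: "0 \<le> z s" if "s \<in> {0..t0}" for s using le[of s] that by (auto simp: z_def)
  have z_le: "z s \<le> \<delta> * Gamma \<kappa> / 2 * (t0 - s) powr \<alpha> + C * (t0 - s)" if "s \<in> {0..t0}" for s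
    using C(2)[of s] that eq by (simp add: z_def c1)
  have Iz: "frac_int \<kappa> z t = t powr \<kappa> / Gamma (\<kappa> + 1) * (- c0) - frac_int 1 q t" if t: "t \<in> {0..t0}"
    for t
  proof -
    have "frac_int \<kappa> z t = frac_int \<kappa> (\<lambda>_. - c0) t - frac_int \<kappa> (frac_int \<alpha> q) t"
      unfolding z_def using t by (intro frac_int_diff[of _ t0] \<kappa> Iq) auto
    also have "frac_int \<kappa> (frac_int \<alpha> q) t = frac_int 1 q t"
      using frac_int_compose[OF \<kappa>(1) \<alpha>(1) q, of t] t by (simp add: \<kappa>_def)
    finally show ?thesis using \<kappa> t by (simp add: frac_int_const)
  qed
  let ?I = "\<lambda>k s. indicator {0..t0} s *\<^sub>R k s"
  have i: "integrable lborel (\<lambda>s. frac_kernel \<beta> (c - s) *\<^sub>R ?I k s)"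
    if "0 < \<beta>" "continuous_on {0..t0} k" for \<beta> c and k :: "real \<Rightarrow> real"
    using frac_int_integrable[OF that] .
  \<comment> \<open>Used for \<open>q\<close> with the kernel of order \<open>1\<close> and a
    negative \<open>c\<close>, and for \<open>z\<close> with the singular kernel. At
    \<open>s = t0\<close> every kernel is \<open>0\<close> by convention, so the bound there has to
    read \<open>max 0 c\<close>; the point is a null set.\<close>
  have incr: "frac_int \<beta> k t0 - frac_int \<beta> k b \<le> c * h"
    if \<beta>: "0 < \<beta>" and k: "continuous_on {0..t0} k"
      and l: "\<And>s. s \<in> {b..t0} \<Longrightarrow> frac_kernel \<beta> (t0 - s) * k s \<le> (if s = t0 then max 0 c else c)"
      and l': "\<And>s. s \<in> {0..<b} \<Longrightarrow> (frac_kernel \<beta> (t0 - s) - frac_kernel \<beta> (b - s)) * k s \<le> 0"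
    for \<beta> c and k :: "real \<Rightarrow> real"
  proof -
    have "frac_int \<beta> k t0 - frac_int \<beta> k b = (\<integral>s. frac_kernel \<beta> (t0 - s) *\<^sub>R ?I k s - frac_kernel \<beta>
      (b - s) *\<^sub>R ?I k s \<partial>lborel)"
      using b i[OF \<beta> k] by (simp add: frac_int_eq_lborel[of _ t0] del: real_scaleR_def)
    also have "\<dots> \<le> (\<integral>s. indicator {b..t0} s * c \<partial>lborel)"
    proof (rule integral_mono_AE)
      show "integrable lborel (\<lambda>s. frac_kernel \<beta> (t0 - s) *\<^sub>R ?I k s - frac_kernel \<beta> (b - s) *\<^sub>R ?I
        k s)"
        by (intro Bochner_Integration.integrable_diff i \<beta> k)
      show "integrable lborel (\<lambda>s. indicat_real {b..t0} s * c)"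
        using b by (intro integrable_mult_left integrable_real_indicator) auto
      have "AE s in lborel. s \<noteq> t0" by (rule AE_lborel_singleton)
      then show "AE s in lborel. frac_kernel \<beta> (t0 - s) *\<^sub>R ?I k s - frac_kernel \<beta> (b - s) *\<^sub>R ?I k
        s \<le> indicator {b..t0} s * c"
      proof eventually_elim
        case (elim s)
        consider "s < 0 \<or> t0 < s" | "0 \<le> s" "s < b" | "0 \<le> s" "b \<le> s" "s < t0" using b elim
          by linarith
        then show ?case
        proof cases
          case 1
          then show ?thesis using b by auto
        next
          case 2
          then show ?thesis using l'[of s] b by (simp add: left_diff_distrib)
        next
          case 3
          then show ?thesis using l[of s] b by simp
        qed
      qed
    qed
    also have "\<dots> = c * h" using b by (simp add: mult.commute)
    finally show ?thesis .
  qed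
  have 1: "frac_int 1 q t0 - frac_int 1 q b \<le> (- \<delta>) * h"
  proof (rule incr)
    fix s assume "s \<in> {b..t0}"
    then show "frac_kernel 1 (t0 - s) * q s \<le> (if s = t0 then max 0 (- \<delta>) else - \<delta>)"
      using q_le[of s] b h by simp
  next
    fix s assume "s \<in> {0..<b}"
    then show "(frac_kernel 1 (t0 - s) - frac_kernel 1 (b - s)) * q s \<le> 0" using b by simp
  qed (use q in auto)
  have 2: "frac_int \<kappa> z t0 - frac_int \<kappa> z b \<le> (3 / 4 * \<delta>) * h"
  proof (rule incr)
    fix s assume s: "s \<in> {b..t0}"
    show "frac_kernel \<kappa> (t0 - s) * z s \<le> (if s = t0 then max 0 (3 / 4 * \<delta>) else 3 / 4 * \<delta>)"
    proof (cases "s = t0")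
      case False
      define r where "r = t0 - s"
      have r: "0 < r" "r \<le> h" using False s b by (auto simp: r_def)
      have "frac_kernel \<kappa> r * z s \<le> frac_kernel \<kappa> r * (\<delta> * Gamma \<kappa> / 2 * r powr \<alpha> + C * r)"
        using z_le[of s] s b \<kappa> by (intro mult_left_mono frac_kernel_nonneg) (auto simp: r_def)
      also have "\<dots> = (r powr (\<kappa> - 1) * r powr \<alpha>) * \<delta> / 2 + C * (r powr (\<kappa> - 1) * r powr 1) / Gamma
        \<kappa>"
        using r G by (simp add: frac_kernel_def field_simps)
      also have "\<dots> = \<delta> / 2 + C * r powr \<kappa> / Gamma \<kappa>"
        using r unfolding powr_add[symmetric] by (simp add: \<kappa>_def)
      also have "\<dots> \<le> \<delta> / 2 + C * h powr \<kappa> / Gamma \<kappa>"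
        using C(1) G r \<kappa> by (intro add_left_mono divide_right_mono mult_left_mono powr_mono2) auto
      also have "\<dots> \<le> \<delta> / 2 + (\<delta> * Gamma \<kappa> / 4) / Gamma \<kappa>"
        using Ch G by (intro add_left_mono divide_right_mono) auto
      finally show ?thesis using False G by (simp add: r_def)
    qed simp
  next
    fix s assume s: "s \<in> {0..<b}"
    have "frac_kernel \<kappa> (t0 - s) \<le> frac_kernel \<kappa> (b - s)"
      using s b \<kappa> by (intro frac_kernel_antimono) auto
    then show "(frac_kernel \<kappa> (t0 - s) - frac_kernel \<kappa> (b - s)) * z s \<le> 0"
      using z0[of s] s b by (intro mult_nonpos_nonneg) auto
  qed (use \<kappa> z in auto)
  have "0 \<le> (t0 powr \<kappa> - b powr \<kappa>) / Gamma (\<kappa> + 1) * (- c0)"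
    using c0 b \<kappa> by (intro mult_nonneg_nonneg divide_nonneg_nonneg) (auto intro!: powr_mono2
      Gamma_real_nonneg)
  moreover have "frac_int \<kappa> z t0 - frac_int \<kappa> z b
    = (t0 powr \<kappa> - b powr \<kappa>) / Gamma (\<kappa> + 1) * (- c0) - (frac_int 1 q t0 - frac_int 1 q b)"
    using Iz[of t0] Iz[of b] b t0 by (simp add: diff_divide_distrib left_diff_distrib)
  moreover have "(- \<delta>) * h = - (\<delta> * h)" "(3 / 4 * \<delta>) * h = 3 / 4 * (\<delta> * h)" by simp_all
  ultimately have "\<delta> * h \<le> 3 / 4 * (\<delta> * h)" using 1 2 by linarith
  moreover have "0 < \<delta> * h" using \<delta> h by simp
  ultimately show False by linarith
qed

text \<open>
  Project the solution onto its direction at the first time where the bound is violated and apply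
  the extremum principle.
\<close>

lemma frac_energy_estimate:
  fixes w q :: "real \<Rightarrow> 'a::{real_inner, banach, second_countable_topology}" and p :: "real \<Rightarrow> real"
  assumes \<alpha>: "0 < \<alpha>" "\<alpha> < 1" and q: "continuous_on {0..T} q" and p: "continuous_on {0..T} p"
    and eq: "\<And>t. t \<in> {0..T} \<Longrightarrow> w t = x + frac_int \<alpha> q t"
    and le: "\<And>t. t \<in> {0..T} \<Longrightarrow> inner (q t) (w t) \<le> p t * norm (w t)"
    and p0: "\<And>t. t \<in> {0..T} \<Longrightarrow> 0 \<le> p t" and t: "t \<in> {0..T}"
  shows "norm (w t) \<le> norm x + frac_int \<alpha> p t"
proof -
  have w: "continuous_on {0..T} w"
    using continuous_on_add[OF continuous_on_const frac_int_continuous_on[OF \<alpha>(1) q], of x]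
    by (rule continuous_on_eq) (use eq in auto)
  \<comment> \<open>The slack \<open>e\<close> separates the barrier from the norm at time
    \<open>0\<close> and makes the final inequality strict; it is sent to \<open>0\<close>
    afterwards.\<close>
  have main: "norm (w t) \<le> norm x + e + frac_int \<alpha> (\<lambda>s. p s + e) t" if e: "0 < e" for e
  proof (rule ccontr)
    define \<phi> where "\<phi> t = norm x + e + frac_int \<alpha> (\<lambda>s. p s + e) t" for t
    have pe: "continuous_on {0..T} (\<lambda>s. p s + e)" by (intro continuous_intros p)
    have \<phi>: "continuous_on {0..T} \<phi>"
      unfolding \<phi>_def by (intro continuous_intros frac_int_continuous_on[OF \<alpha>(1) pe])
    have \<phi>_pos: "0 < \<phi> s" if s: "s \<in> {0..T}" for s
    proof -
      have "frac_int \<alpha> (\<lambda>s. 0) s \<le> frac_int \<alpha> (\<lambda>s. p s + e) s"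
        using s e p0 by (intro frac_int_mono[OF \<alpha>(1) _ pe]) (auto intro: add_nonneg_nonneg)
      moreover have "frac_int \<alpha> (\<lambda>s. 0::real) s = 0" using s \<alpha> by (simp add: frac_int_const)
      ultimately show ?thesis using e by (simp add: \<phi>_def add_nonneg_pos add_pos_nonneg)
    qed
    assume "\<not> norm (w t) \<le> norm x + e + frac_int \<alpha> (\<lambda>s. p s + e) t"
    then have bad: "\<phi> t \<le> norm (w t)" by (simp add: \<phi>_def)
    define S where "S = {s \<in> {0..T}. \<phi> s \<le> norm (w s)}"
    have "closed S"
      unfolding S_def by (rule continuous_on_closed_Collect_le[OF \<phi> continuous_on_norm[OF w]]) simp
    then have "compact ({0..T} \<inter> S)" by (intro compact_Int_closed) auto
    moreover have "{0..T} \<inter> S = S" by (auto simp: S_def)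
    ultimately have "compact S" by simp
    then obtain t0 where t0: "t0 \<in> S" "\<And>s. s \<in> S \<Longrightarrow> t0 \<le> s"
      using compact_attains_inf[of S] t bad by (auto simp: S_def)
    have t0T: "t0 \<in> {0..T}" using t0 by (simp add: S_def)
    define W where "W = norm (w t0)"
    have W: "0 < W" "\<phi> t0 \<le> W" using t0 \<phi>_pos[OF t0T] by (auto simp: S_def W_def)
    have "t0 \<noteq> 0"
    proof
      assume "t0 = 0"
      then have "W = norm x" "\<phi> t0 = norm x + e" using eq[OF t0T] by (auto simp: W_def \<phi>_def)
      then show False using W e by simp
    qed
    then have t0_pos: "0 < t0" using t0T by simp
    \<comment> \<open>The direction is frozen at \<open>t0\<close>: \<open>inner (w s) d\<close> is
      \<open>inner x d\<close> plus a scalar fractional integral, is dominated by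
      \<open>norm (w s)\<close> and equals it at \<open>t0\<close>.\<close>
    define d where "d = w t0 /\<^sub>R W"
    have d: "norm d = 1" using W by (simp add: d_def W_def)
    have sub: "{0..t0} \<subseteq> {0..T}" using t0T by auto
    note q0 = continuous_on_subset[OF q sub] and pe0 = continuous_on_subset[OF pe sub]
    have qd: "continuous_on {0..t0} (\<lambda>s. inner (q s) d)" by (intro continuous_intros q0)
    have int: "frac_int \<alpha> (\<lambda>s. inner (q s) d - (p s + e)) s = inner (w s - x) d - (\<phi> s - norm x
      - e)"
      if s: "s \<in> {0..t0}" for s
    proof -
      have "frac_int \<alpha> (\<lambda>s. inner (q s) d - (p s + e)) s
        = frac_int \<alpha> (\<lambda>s. inner (q s) d) s - frac_int \<alpha> (\<lambda>s. p s + e) s"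
        using s by (intro frac_int_diff[OF \<alpha>(1) qd pe0]) auto
      also have "frac_int \<alpha> (\<lambda>s. inner (q s) d) s = inner (frac_int \<alpha> q s) d"
        using s by (intro frac_int_bounded_linear[OF \<alpha>(1) q0 bounded_linear_inner_left]) auto
      finally show ?thesis using eq[of s] s t0T by (simp add: \<phi>_def)
    qed
    \<comment> \<open>The shift \<open>W - \<phi> t0\<close> makes the scalar function vanish at
      \<open>t0\<close>, since membership in \<open>S\<close> only gives
      \<open>\<phi> t0 \<le> W\<close>. It is nonnegative, so earlier values stay
      nonpositive.\<close>
    define y0 where "y0 = inner x d - norm x - e - (W - \<phi> t0)"
    have xd: "inner v d \<le> norm v" for v using norm_cauchy_schwarz[of v d] d by simp
    have "0 \<le> inner (q t0) d - (p t0 + e)"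
    proof (rule frac_extremum_principle[OF \<alpha> t0_pos, of "\<lambda>s. inner (q s) d - (p s + e)" y0])
      show "continuous_on {0..t0} (\<lambda>s. inner (q s) d - (p s + e))"
        by (intro continuous_on_diff qd pe0)
      show "y0 \<le> 0" using xd[of x] e W by (simp add: y0_def)
      have wd: "inner (w t0) d = W"
        using W by (simp add: d_def W_def dot_square_norm power2_eq_square)
      show "y0 + frac_int \<alpha> (\<lambda>s. inner (q s) d - (p s + e)) t0 = 0"
        using int[of t0] t0_pos wd by (simp add: y0_def inner_diff_left)
      fix s assume s: "0 \<le> s" "s \<le> t0"
      have "norm (w s) \<le> \<phi> s \<or> s = t0"
        using t0(2)[of s] s t0T by (force simp: S_def)
      then have "inner (w s) d \<le> \<phi> s + (W - \<phi> t0)"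
        using xd[of "w s"] W wd by auto
      then show "y0 + frac_int \<alpha> (\<lambda>s. inner (q s) d - (p s + e)) s \<le> 0"
        using int[of s] s by (simp add: y0_def inner_diff_left)
    qed
    moreover have "inner (q t0) d \<le> p t0"
      using le[OF t0T] W by (simp add: d_def W_def field_simps)
    ultimately show False using e by simp
  qed
  define c where "c = 1 + t powr \<alpha> / Gamma (\<alpha> + 1)"
  have "norm (w t) \<le> norm x + frac_int \<alpha> p t + e * c" if "0 < e" for e
  proof -
    have "frac_int \<alpha> (\<lambda>s. p s + e) t = frac_int \<alpha> p t + t powr \<alpha> / Gamma (\<alpha> + 1) * e"
      using t \<alpha> frac_int_add[OF \<alpha>(1) p continuous_on_const, of t e] by (simp add: frac_int_const)
    then show ?thesis using main[OF that] by (simp add: c_def algebra_simps)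
  qed
  moreover have "0 < c" using \<alpha>
    by (auto simp: c_def intro!: add_pos_nonneg divide_nonneg_nonneg Gamma_real_nonneg)
  ultimately have "norm (w t) \<le> norm x + frac_int \<alpha> p t + e" if "0 < e" for e
    using that by (metis divide_pos_pos less_numeral_extra(3) nonzero_divide_eq_eq)
  then show ?thesis by (rule field_le_epsilon)
qed


section \<open>Exponential weights: Gronwall inequality and contraction principle\<close>

lemma exp_weight_exists:
  assumes \<alpha>: "0 < \<alpha>" and K: "0 \<le> K"
  obtains r :: real where "0 \<le> r"
    "\<And>t. t \<in> {0..T} \<Longrightarrow> K * frac_int \<alpha> (\<lambda>s. exp (r * s)) t \<le> exp (r * t) / 2"
proof -
  define k where "k s = indicator {0..T} s *\<^sub>R frac_kernel \<alpha> s" for s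
  have k0: "0 \<le> k s" for s using \<alpha> by (simp add: k_def frac_kernel_nonneg)
  have intk: "integrable lborel k" if "0 \<le> T"
    using frac_kernel_has_integral[OF \<alpha> that] unfolding k_def
      by (simp add: has_bochner_integral_iff)
  have [measurable]: "k \<in> borel_measurable borel" unfolding k_def by measurable
  have ke: "norm (k s * exp (- (r * s))) \<le> k s" if "0 \<le> r" for r s
  proof (cases "0 \<le> s")
    case True
    then show ?thesis using k0[of s] that by (auto simp: abs_mult intro!: mult_left_le)
  qed (simp add: k_def)
  have intke: "integrable lborel (\<lambda>s. k s * exp (- (r * s)))" if "0 \<le> r" "0 \<le> T" for r
  proof (rule Bochner_Integration.integrable_bound[OF intk[OF that(2)]])
    show "AE s in lborel. norm (k s * exp (- (r * s))) \<le> norm (k s)"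
      using ke[OF that(1)] by (intro AE_I2) (simp add: k0)
  qed measurable
  \<comment> \<open>After reflection, \<open>frac_int \<alpha> (\<lambda>s. exp (r * s)) t\<close>
    is at most \<open>exp (r * t)\<close> times the Laplace transform at \<open>r\<close> of the
    truncated kernel, which tends to \<open>0\<close> as \<open>r\<close> grows.\<close>
  have "(\<lambda>n. \<integral>s. k s * exp (- (real n * s)) \<partial>lborel) \<longlonglongrightarrow> integral\<^sup>L lborel (\<lambda>_::real. 0)"
    if T: "0 \<le> T"
  proof (rule integral_dominated_convergence[where w=k])
    show "integrable lborel k" using intk[OF T] .
    show "AE s in lborel. (\<lambda>n. k s * exp (- (real n * s))) \<longlonglongrightarrow> 0"
    proof (intro AE_I2)
      fix s
      show "(\<lambda>n. k s * exp (- (real n * s))) \<longlonglongrightarrow> 0"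
      proof (cases "0 < s")
        case True
        have "(\<lambda>n. exp (- s) ^ n) \<longlonglongrightarrow> 0" using True by (intro LIMSEQ_power_zero) simp
        then have "(\<lambda>n. k s * exp (- s) ^ n) \<longlonglongrightarrow> 0" using tendsto_mult_right_zero by blast
        then show ?thesis by (simp add: exp_of_nat_mult[symmetric])
      qed (simp add: k_def)
    qed
    show "AE s in lborel. norm (k s * exp (- (real n * s))) \<le> k s" for n
      using ke[of "real n"] by simp
  qed measurable
  then have lim: "(\<lambda>n. K * (\<integral>s. k s * exp (- (real n * s)) \<partial>lborel)) \<longlonglongrightarrow> 0" if "0 \<le> T"
    using tendsto_mult_right_zero that by fastforce
  obtain r where r: "0 \<le> r" "0 \<le> T \<Longrightarrow> K * (\<integral>s. k s * exp (- (r * s)) \<partial>lborel) \<le> 1 / 2"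
  proof (cases "0 \<le> T")
    case True
    have "\<forall>\<^sub>F n in sequentially. K * (\<integral>s. k s * exp (- (real n * s)) \<partial>lborel) < 1 / 2"
      using order_tendstoD(2)[OF lim[OF True], of "1/2"] by simp
    then obtain n where "K * (\<integral>s. k s * exp (- (real n * s)) \<partial>lborel) < 1 / 2"
      unfolding eventually_sequentially by blast
    then show ?thesis using that[of "real n"] by simp
  qed (use that[of 0] in auto)
  show ?thesis
  proof (rule that[OF r(1)])
    fix t assume t: "t \<in> {0..T}"
    then have T: "0 \<le> T" by simp
    let ?F = "\<lambda>s. frac_kernel \<alpha> (t - s) * (indicator {0..T} s * exp (r * s))"
    have ce: "continuous_on {0..T} (\<lambda>s. exp (r * s))" by (intro continuous_intros)
    have intF: "integrable lborel ?F" using frac_int_integrable[OF \<alpha> ce] by simp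
    have "frac_int \<alpha> (\<lambda>s. exp (r * s)) t = (\<integral>s. ?F s \<partial>lborel)"
      using t by (simp add: frac_int_eq_lborel[of t T])
    also have "\<dots> = (\<integral>s. ?F (t - s) \<partial>lborel)"
      using lborel_integral_real_affine[of "-1" ?F t] by simp
    also have "\<dots> \<le> (\<integral>s. exp (r * t) * (k s * exp (- (r * s))) \<partial>lborel)"
    proof (rule integral_mono)
      show "integrable lborel (\<lambda>s. ?F (t - s))"
        using lborel_integrable_real_affine[OF intF, of "-1" t] by simp
      show "integrable lborel (\<lambda>s. exp (r * t) * (k s * exp (- (r * s))))"
        by (intro integrable_mult_right intke r T)
      fix s
      have e: "exp (r * (t - s)) = exp (r * t) * exp (- (r * s))"
        by (simp add: exp_add[symmetric] right_diff_distrib)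
      consider "s \<le> 0" | "0 < s" "s \<le> t" | "0 < s" "t < s" by linarith
      then show "?F (t - s) \<le> exp (r * t) * (k s * exp (- (r * s)))"
        by cases (use t k0[of s] in \<open>auto simp: k_def e\<close>)
    qed
    also have "\<dots> = exp (r * t) * (\<integral>s. k s * exp (- (r * s)) \<partial>lborel)" by simp
    finally have "K * frac_int \<alpha> (\<lambda>s. exp (r * s)) t
      \<le> exp (r * t) * (K * (\<integral>s. k s * exp (- (r * s)) \<partial>lborel))"
      using mult_left_mono[OF _ K] by (fastforce simp: mult_ac)
    also have "\<dots> \<le> exp (r * t) * (1 / 2)" using r T by (intro mult_left_mono) auto
    finally show "K * frac_int \<alpha> (\<lambda>s. exp (r * s)) t \<le> exp (r * t) / 2" by simp
  qed
qed

text \<open>At a maximum point \<open>t1\<close> of \<open>exp (- (r * s)) * m s\<close> the weight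
  lets the integral term account for at most half of \<open>m t1\<close> when this is positive,
  whence \<open>m t1 \<le> 2 * a\<close>. Any \<open>K\<close> and \<open>T\<close> are thus treated
  in one step, without iterating the kernel.\<close>

lemma frac_gronwall:
  assumes \<alpha>: "0 < \<alpha>" and K: "0 \<le> K" and a: "0 \<le> a" and r: "0 \<le> r"
    and weight: "\<And>t. t \<in> {0..T} \<Longrightarrow> K * frac_int \<alpha> (\<lambda>s. exp (r * s)) t \<le> exp (r * t) / 2"
    and m: "continuous_on {0..T} m"
    and le: "\<And>t. t \<in> {0..T} \<Longrightarrow> m t \<le> a + K * frac_int \<alpha> m t" and t: "t \<in> {0..T}"
  shows "m t \<le> 2 * a * exp (r * T)"
proof -
  have "continuous_on {0..T} (\<lambda>s. exp (- (r * s)) * m s)" by (intro continuous_intros m)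
  then obtain t1 where t1: "t1 \<in> {0..T}"
    "\<And>s. s \<in> {0..T} \<Longrightarrow> exp (- (r * s)) * m s \<le> exp (- (r * t1)) * m t1"
    using continuous_attains_sup[of "{0..T}" "\<lambda>s. exp (- (r * s)) * m s"] t by auto
  define S where "S = exp (- (r * t1)) * m t1"
  have mS: "m s \<le> S * exp (r * s)" if "s \<in> {0..T}" for s
  proof -
    have "m s = exp (r * s) * (exp (- (r * s)) * m s)" by (simp add: exp_minus)
    also have "\<dots> \<le> exp (r * s) * S" using t1(2)[OF that]
      by (intro mult_left_mono) (auto simp: S_def)
    finally show ?thesis by (simp add: mult.commute)
  qed
  have "S * exp (r * t1) \<le> 2 * a"
  proof (cases "S \<le> 0")
    case True
    then have "S * exp (r * t1) \<le> 0" by (intro mult_nonpos_nonneg) auto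
    then show ?thesis using a by simp
  next
    case False
    have "S * exp (r * t1) = m t1" by (simp add: S_def exp_minus)
    also have "\<dots> \<le> a + K * frac_int \<alpha> m t1" by (rule le[OF t1(1)])
    also have "frac_int \<alpha> m t1 \<le> frac_int \<alpha> (\<lambda>s. S * exp (r * s)) t1"
      using t1(1) mS by (intro frac_int_mono[OF \<alpha> m]) (auto intro!: continuous_intros)
    also have "\<dots> = S * frac_int \<alpha> (\<lambda>s. exp (r * s)) t1"
      using t1(1) by (intro frac_int_bounded_linear[OF \<alpha>, of T] bounded_linear_mult_right)
        (auto intro!: continuous_intros)
    also have "K * (S * frac_int \<alpha> (\<lambda>s. exp (r * s)) t1) \<le> S * (exp (r * t1) / 2)"
      using mult_left_mono[OF weight[OF t1(1)], of S] False by (simp add: mult_ac)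
    finally show ?thesis using K by (simp add: mult_left_mono)
  qed
  moreover have "1 \<le> exp (r * t1)" using r t1 by simp
  ultimately have "S \<le> 2 * a" using a
    by (smt (verit, ccfv_SIG) mult_less_cancel_left2 mult_nonneg_nonneg)
  have "m t \<le> S * exp (r * t)" by (rule mS[OF t])
  also have "\<dots> \<le> 2 * a * exp (r * t)" using \<open>S \<le> 2 * a\<close> by (intro mult_right_mono) auto
  also have "\<dots> \<le> 2 * a * exp (r * T)" using a r t
    by (intro mult_left_mono) (auto intro: mult_left_mono)
  finally show ?thesis .
qed

text \<open>This is the contraction principle for the supremum of
  \<open>norm (u t) / \<omega> t\<close>, with factor \<open>1 / 2\<close>. Only values on
  \<open>{0..T}\<close> matter, so distances between total functions are expressed by pointwise
  bounds there.\<close>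

lemma weighted_contraction_fixpoint:
  fixes \<Phi> :: "(real \<Rightarrow> 'b::banach) \<Rightarrow> real \<Rightarrow> 'b"
  assumes u0: "u0 \<in> S" and maps: "\<And>u. u \<in> S \<Longrightarrow> \<Phi> u \<in> S"
    and cont: "\<And>u. u \<in> S \<Longrightarrow> continuous_on {0..T} u"
    and closed: "\<And>X u. (\<And>n. X n \<in> S) \<Longrightarrow> uniform_limit {0..T} X u sequentially \<Longrightarrow> u \<in> S"
    and \<omega>: "\<And>t. t \<in> {0..T} \<Longrightarrow> 1 \<le> \<omega> t \<and> \<omega> t \<le> W"
    and contr: "\<And>u v c t. u \<in> S \<Longrightarrow> v \<in> S \<Longrightarrow> 0 \<le> c \<Longrightarrow>
      (\<And>t. t \<in> {0..T} \<Longrightarrow> norm (u t - v t) \<le> c * \<omega> t) \<Longrightarrow> t \<in> {0..T} \<Longrightarrow>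
      norm (\<Phi> u t - \<Phi> v t) \<le> c / 2 * \<omega> t"
  shows "\<exists>u\<in>S. \<forall>t\<in>{0..T}. \<Phi> u t = u t"
proof -
  define X where "X n = (\<Phi> ^^ n) u0" for n
  have X0: "X 0 = u0" and XS: "X (Suc n) = \<Phi> (X n)" for n by (simp_all add: X_def)
  have XinS: "X n \<in> S" for n by (induction n) (simp_all add: X0 XS u0 maps)
  obtain c where c: "0 \<le> c" "\<And>t. t \<in> {0..T} \<Longrightarrow> norm (X 1 t - X 0 t) \<le> c"
    using continuous_on_Icc_norm_bound[OF
      continuous_on_diff[OF cont[OF XinS[of 1]] cont[OF XinS[of 0]]]] by blast
  have step: "\<forall>t\<in>{0..T}. norm (X (Suc n) t - X n t) \<le> c / 2 ^ n * \<omega> t" for n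
  proof (induction n)
    case 0
    show ?case
    proof
      fix t assume t: "t \<in> {0..T}"
      have "c * 1 \<le> c * \<omega> t" using c \<omega>[OF t] by (intro mult_left_mono) auto
      then show "norm (X (Suc 0) t - X 0 t) \<le> c / 2 ^ 0 * \<omega> t" using c(2)[OF t] by simp
    qed
  next
    case (Suc n)
    show ?case
    proof
      fix t assume t: "t \<in> {0..T}"
      have "norm (\<Phi> (X (Suc n)) t - \<Phi> (X n) t) \<le> (c / 2 ^ n) / 2 * \<omega> t"
        by (rule contr[OF XinS XinS _ _ t]) (use c Suc in auto)
      then show "norm (X (Suc (Suc n)) t - X (Suc n) t) \<le> c / 2 ^ Suc n * \<omega> t"
        by (simp add: XS)
    qed
  qed
  define u where "u t = u0 t + (\<Sum>n. X (Suc n) t - X n t)" for t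
  have "uniform_limit {0..T} (\<lambda>n t. \<Sum>i<n. X (Suc i) t - X i t) (\<lambda>t. \<Sum>i. X (Suc i) t - X i t)
    sequentially"
  proof (rule Weierstrass_m_test)
    show "norm (X (Suc n) t - X n t) \<le> (c * W) * (1 / 2) ^ n" if t: "t \<in> {0..T}" for n t
    proof -
      have "norm (X (Suc n) t - X n t) \<le> c / 2 ^ n * \<omega> t" using step t by blast
      also have "\<dots> \<le> c / 2 ^ n * W" using \<omega>[OF t] c by (intro mult_left_mono) auto
      finally show ?thesis by (simp add: power_divide)
    qed
    show "summable (\<lambda>n. (c * W) * (1 / 2) ^ n)" by (intro summable_mult summable_geometric) simp
  qed
  then have "uniform_limit {0..T} (\<lambda>n t. u0 t + (\<Sum>i<n. X (Suc i) t - X i t)) u sequentially"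
    unfolding u_def by (intro uniform_limit_intros)
  moreover have "(\<lambda>n t. u0 t + (\<Sum>i<n. X (Suc i) t - X i t)) = X"
    using sum_lessThan_telescope[of "\<lambda>i. X i t" for t] by (simp add: fun_eq_iff X0)
  ultimately have lim: "uniform_limit {0..T} X u sequentially" by simp
  have uS: "u \<in> S" by (rule closed[OF XinS lim])
  show ?thesis
  proof (intro bexI[OF _ uS] ballI)
    fix t assume t: "t \<in> {0..T}"
    have W: "1 \<le> W" using \<omega>[OF t] by linarith
    have "(\<lambda>n. X (Suc n) t) \<longlonglongrightarrow> \<Phi> u t"
    proof (rule LIMSEQ_I)
      fix e :: real assume e: "0 < e"
      have "\<forall>\<^sub>F n in sequentially. \<forall>t\<in>{0..T}. dist (X n t) (u t) < e / W"
        using uniform_limitD[OF lim, of "e / W"] e W by simp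
      then obtain N where N: "\<And>n t. N \<le> n \<Longrightarrow> t \<in> {0..T} \<Longrightarrow> dist (X n t) (u t) < e / W"
        unfolding eventually_sequentially by blast
      show "\<exists>N. \<forall>n\<ge>N. norm (X (Suc n) t - \<Phi> u t) < e"
      proof (intro exI allI impI)
        fix n assume n: "N \<le> n"
        have "norm (\<Phi> (X n) t - \<Phi> u t) \<le> (e / W) / 2 * \<omega> t"
        proof (rule contr[OF XinS uS _ _ t])
          show "0 \<le> e / W" using e W by simp
          fix s assume s: "s \<in> {0..T}"
          have "e / W * 1 \<le> e / W * \<omega> s" using \<omega>[OF s] e W by (intro mult_left_mono) auto
          then show "norm (X n s - u s) \<le> e / W * \<omega> s"
            using N[OF n s] by (simp add: dist_norm)
        qed
        also have "\<dots> \<le> (e / W) / 2 * W" using \<omega>[OF t] e W by (intro mult_left_mono) auto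
        also have "\<dots> < e" using e W by simp
        finally show "norm (X (Suc n) t - \<Phi> u t) < e" by (simp add: XS)
      qed
    qed
    moreover have "(\<lambda>n. X (Suc n) t) \<longlonglongrightarrow> u t"
      using tendsto_uniform_limitI[OF lim t] by (rule LIMSEQ_Suc)
    ultimately show "\<Phi> u t = u t" by (rule LIMSEQ_unique)
  qed
qed

section \<open>Linear problems with dissipative operators\<close>

text \<open>Cauchy-Schwarz leaves \<open>norm (f s) * norm (u s)\<close> once the dissipative term
  is dropped. The size of \<open>L\<close> does not enter the bound, which is what makes it uniform
  over the Yosida approximations.\<close>

lemma dissipative_solution_bound:
  fixes u f :: "real \<Rightarrow> 'a::{real_inner, banach, second_countable_topology}"
  assumes \<alpha>: "0 < \<alpha>" "\<alpha> < 1"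
    and Lu: "continuous_on {0..T} (\<lambda>s. L (u s))" and f: "continuous_on {0..T} f"
    and diss: "\<And>t. t \<in> {0..T} \<Longrightarrow> inner (L (u t)) (u t) \<le> 0"
    and eq: "\<And>t. t \<in> {0..T} \<Longrightarrow> u t = x + frac_int \<alpha> (\<lambda>s. L (u s) + f s) t"
    and t: "t \<in> {0..T}"
  shows "norm (u t) \<le> norm x + frac_int \<alpha> (\<lambda>s. norm (f s)) t"
proof (rule frac_energy_estimate[OF \<alpha>, of T "\<lambda>s. L (u s) + f s"])
  fix s assume s: "s \<in> {0..T}"
  show "inner (L (u s) + f s) (u s) \<le> norm (f s) * norm (u s)"
    using diss[OF s] norm_cauchy_schwarz[of "f s" "u s"] by (simp add: inner_add_left)
next
  show "continuous_on {0..T} (\<lambda>s. L (u s) + f s)" by (intro continuous_on_add Lu f)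
  show "continuous_on {0..T} (\<lambda>s. norm (f s))" by (intro continuous_on_norm f)
qed (assumption | rule eq t norm_ge_zero)+

text \<open>The exponential weight absorbs the norm of \<open>L\<close>, so the contraction
  principle applies on the whole of \<open>{0..T}\<close> without any smallness.\<close>

lemma bounded_volterra_solution:
  fixes f :: "real \<Rightarrow> 'a::{banach, second_countable_topology}"
  assumes \<alpha>: "0 < \<alpha>" and L: "bounded_linear L" and f: "continuous_on {0..T} f"
  shows "\<exists>u. continuous_on {0..T} u \<and> (\<forall>t\<in>{0..T}. u t = x + frac_int \<alpha> (\<lambda>s. L (u s) + f s) t)"
proof -
  interpret L: bounded_linear L by fact
  obtain K where "0 < K" "\<And>v. norm (L v) \<le> norm v * K"
    using L.pos_bounded by blast
  then have K: "0 < K" "\<And>v. norm (L v) \<le> K * norm v" by (simp_all add: mult.commute)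
  obtain r where r: "0 \<le> r"
    "\<And>t. t \<in> {0..T} \<Longrightarrow> K * frac_int \<alpha> (\<lambda>s. exp (r * s)) t \<le> exp (r * t) / 2"
    using exp_weight_exists[OF \<alpha> less_imp_le[OF K(1)]] by blast
  define S where "S = {u :: real \<Rightarrow> 'a. continuous_on {0..T} u}"
  define \<Phi> where "\<Phi> u t = x + frac_int \<alpha> (\<lambda>s. L (u s) + f s) t" for u t
  have Lc: "continuous_on {0..T} (\<lambda>s. L (u s))" if "u \<in> S" for u
    using that L by (auto simp: S_def intro: bounded_linear.continuous_on)
  have "\<exists>u\<in>S. \<forall>t\<in>{0..T}. \<Phi> u t = u t"
  proof (rule weighted_contraction_fixpoint[where \<omega>="\<lambda>t. exp (r * t)" and W="exp (r * T)"])
    show "(\<lambda>_. 0) \<in> S" by (simp add: S_def)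
    show "\<Phi> u \<in> S" if "u \<in> S" for u
      unfolding S_def \<Phi>_def mem_Collect_eq
      by (intro continuous_intros frac_int_continuous_on[OF \<alpha>] Lc that f)
    show "u \<in> S" if "\<And>n. X n \<in> S" "uniform_limit {0..T} X u sequentially" for X u
      using that(1) uniform_limit_theorem[OF _ that(2)] by (simp add: S_def)
    show "1 \<le> exp (r * t) \<and> exp (r * t) \<le> exp (r * T)" if "t \<in> {0..T}" for t
      using r that by (auto intro: mult_left_mono)
    fix u v c t
    assume uv: "u \<in> S" "v \<in> S" and c: "0 \<le> c" and t: "t \<in> {0..T}"
      and le: "\<And>t. t \<in> {0..T} \<Longrightarrow> norm (u t - v t) \<le> c * exp (r * t)"
    have "\<Phi> u t - \<Phi> v t = frac_int \<alpha> (\<lambda>s. L (u s) + f s) t - frac_int \<alpha> (\<lambda>s. L (v s) + f s) t"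
      by (simp add: \<Phi>_def)
    also have "\<dots> = frac_int \<alpha> (\<lambda>s. (L (u s) + f s) - (L (v s) + f s)) t"
      using t by (intro frac_int_diff[symmetric, of \<alpha> T] \<alpha> continuous_on_add Lc uv f) auto
    also have "norm \<dots> \<le> frac_int \<alpha> (\<lambda>s. K * c * exp (r * s)) t"
    proof (rule norm_frac_int_le[OF \<alpha>])
      fix s assume s: "0 \<le> s" "s \<le> T"
      have "norm (L (u s - v s)) \<le> K * norm (u s - v s)" by (rule K)
      also have "\<dots> \<le> K * (c * exp (r * s))" using le[of s] s K by (intro mult_left_mono) auto
      finally show "norm (L (u s) + f s - (L (v s) + f s)) \<le> K * c * exp (r * s)"
        by (simp add: L.diff)
    next
      show "continuous_on {0..T} (\<lambda>s. L (u s) + f s - (L (v s) + f s))"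
        by (intro continuous_intros Lc uv f)
    qed (use t in \<open>auto intro!: continuous_intros Lc uv f\<close>)
    also have "\<dots> = K * c * frac_int \<alpha> (\<lambda>s. exp (r * s)) t"
      using t by (intro frac_int_bounded_linear[OF \<alpha>, of T] bounded_linear_mult_right)
        (auto intro!: continuous_intros)
    also have "\<dots> \<le> c / 2 * exp (r * t)"
      using mult_left_mono[OF r(2)[OF t] c] by (simp add: mult_ac)
    finally show "norm (\<Phi> u t - \<Phi> v t) \<le> c / 2 * exp (r * t)" .
  qed (simp add: S_def)
  then show ?thesis unfolding S_def \<Phi>_def by fastforce
qed

lemma uniform_limit_frac_int:
  fixes h :: "nat \<Rightarrow> real \<Rightarrow> 'a::{banach, second_countable_topology}"
  assumes \<alpha>: "0 < \<alpha>" and h: "\<And>n. continuous_on {0..T} (h n)"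
    and lim: "uniform_limit {0..T} h k sequentially" and t: "t \<in> {0..T}"
  shows "(\<lambda>n. frac_int \<alpha> (h n) t) \<longlonglongrightarrow> frac_int \<alpha> k t"
proof (rule LIMSEQ_I)
  fix e :: real assume e: "0 < e"
  have k: "continuous_on {0..T} k"
    using uniform_limit_theorem[OF _ lim] h by simp
  define G where "G = t powr \<alpha> / Gamma (\<alpha> + 1)"
  have G: "0 \<le> G" using \<alpha> by (auto simp: G_def intro!: divide_nonneg_nonneg Gamma_real_nonneg)
  have "\<forall>\<^sub>F n in sequentially. \<forall>t\<in>{0..T}. dist (h n t) (k t) < e / (G + 1)"
    using uniform_limitD[OF lim] e G by simp
  then obtain N where N: "\<And>n t. N \<le> n \<Longrightarrow> t \<in> {0..T} \<Longrightarrow> dist (h n t) (k t) < e / (G + 1)"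
    unfolding eventually_sequentially by blast
  show "\<exists>N. \<forall>n\<ge>N. norm (frac_int \<alpha> (h n) t - frac_int \<alpha> k t) < e"
  proof (intro exI allI impI)
    fix n assume n: "N \<le> n"
    have "norm (frac_int \<alpha> (\<lambda>s. h n s - k s) t) \<le> G * (e / (G + 1))"
      unfolding G_def
    proof (rule norm_frac_int_le_const[OF \<alpha> continuous_on_diff[OF h k]])
      show "norm (h n s - k s) \<le> e / (t powr \<alpha> / Gamma (\<alpha> + 1) + 1)" if "0 \<le> s" "s \<le> T" for s
        using N[OF n, of s] that by (simp add: dist_norm G_def)
    qed (use t in auto)
    also have "\<dots> < e" using e G by (simp add: field_simps)
    finally show "norm (frac_int \<alpha> (h n) t - frac_int \<alpha> k t) < e"
      using frac_int_diff[OF \<alpha> h k, of t] t by simp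
  qed
qed

section \<open>m-dissipative operators over the reals: resolvents and Yosida approximations\<close>

locale m_dissipative =
  fixes D :: "'a::{real_inner, banach, second_countable_topology} set" and B :: "'a \<Rightarrow> 'a"
  assumes subspace: "subspace D"
    and B_add: "x \<in> D \<Longrightarrow> y \<in> D \<Longrightarrow> B (x + y) = B x + B y"
    and B_scaleR: "x \<in> D \<Longrightarrow> B (c *\<^sub>R x) = c *\<^sub>R B x"
    and dense: "closure D = UNIV"
    and dissipative: "x \<in> D \<Longrightarrow> inner (B x) x \<le> 0"
    and range: "0 < \<epsilon> \<Longrightarrow> \<exists>u\<in>D. u - \<epsilon> *\<^sub>R B u = v"
begin

lemma add_D: "x \<in> D \<Longrightarrow> y \<in> D \<Longrightarrow> x + y \<in> D"
  using subspace_add[OF subspace] .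

lemma scaleR_D: "x \<in> D \<Longrightarrow> c *\<^sub>R x \<in> D"
  using subspace_scale[OF subspace] .

lemma diff_D: "x \<in> D \<Longrightarrow> y \<in> D \<Longrightarrow> x - y \<in> D"
  using subspace_diff[OF subspace] .

lemma B_diff: "x \<in> D \<Longrightarrow> y \<in> D \<Longrightarrow> B (x - y) = B x - B y"
  using B_add[of x "(-1) *\<^sub>R y"] B_scaleR[of y "-1"] scaleR_D[of y "-1"] by simp

text \<open>
  \<open>J \<epsilon>\<close> is the resolvent \<open>(1 - \<epsilon> B)\<^sup>-\<^sup>1\<close> and \<open>Y \<epsilon> = B J \<epsilon>\<close> the Yosida approximation of \<open>B\<close>.
\<close>

definition J :: "real \<Rightarrow> 'a \<Rightarrow> 'a" where
  "J \<epsilon> v = (SOME u. u \<in> D \<and> u - \<epsilon> *\<^sub>R B u = v)"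

lemma
  assumes "0 < \<epsilon>"
  shows J_in_D: "J \<epsilon> v \<in> D" and J_eq: "J \<epsilon> v - \<epsilon> *\<^sub>R B (J \<epsilon> v) = v"
  unfolding J_def using someI_ex[of "\<lambda>u. u \<in> D \<and> u - \<epsilon> *\<^sub>R B u = v"] range[OF assms, of v] by blast+

lemma norm_le_resolvent:
  assumes "u \<in> D" "0 < \<epsilon>"
  shows "norm u \<le> norm (u - \<epsilon> *\<^sub>R B u)"
proof (cases "u = 0")
  case False
  have "norm u * norm u = inner u u" by (simp add: dot_square_norm power2_eq_square)
  also have "\<dots> \<le> inner (u - \<epsilon> *\<^sub>R B u) u"
    using dissipative[OF assms(1)] assms(2) by (simp add: inner_diff_left mult_le_0_iff)
  also have "\<dots> \<le> norm (u - \<epsilon> *\<^sub>R B u) * norm u" by (rule norm_cauchy_schwarz)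
  finally show ?thesis using False by simp
qed simp

lemma J_unique:
  assumes "u \<in> D" "0 < \<epsilon>" "u - \<epsilon> *\<^sub>R B u = v"
  shows "J \<epsilon> v = u"
proof -
  define w where "w = J \<epsilon> v - u"
  have w: "w \<in> D" using diff_D J_in_D assms by (simp add: w_def)
  have "w - \<epsilon> *\<^sub>R B w = (J \<epsilon> v - \<epsilon> *\<^sub>R B (J \<epsilon> v)) - (u - \<epsilon> *\<^sub>R B u)"
    using B_diff[OF J_in_D[OF assms(2)] assms(1)] by (simp add: w_def scaleR_diff_right)
  also have "\<dots> = 0" using J_eq[OF assms(2)] assms(3) by simp
  finally have "norm w \<le> 0" using norm_le_resolvent[OF w assms(2)] by simp
  then show ?thesis by (simp add: w_def)
qed

lemma norm_J_le: "0 < \<epsilon> \<Longrightarrow> norm (J \<epsilon> v) \<le> norm v"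
  using norm_le_resolvent[OF J_in_D, of \<epsilon> \<epsilon> v] J_eq[of \<epsilon> v] by simp

lemma bounded_linear_J:
  assumes "0 < \<epsilon>" shows "bounded_linear (J \<epsilon>)"
proof (rule bounded_linear_intro[where K=1])
  note D = J_in_D[OF assms] and E = J_eq[OF assms]
  show "J \<epsilon> (x + y) = J \<epsilon> x + J \<epsilon> y" for x y
  proof (rule J_unique[OF add_D[OF D D] assms])
    have "J \<epsilon> x + J \<epsilon> y - \<epsilon> *\<^sub>R B (J \<epsilon> x + J \<epsilon> y)
      = (J \<epsilon> x - \<epsilon> *\<^sub>R B (J \<epsilon> x)) + (J \<epsilon> y - \<epsilon> *\<^sub>R B (J \<epsilon> y))"
      by (simp add: B_add[OF D D] scaleR_add_right)
    then show "J \<epsilon> x + J \<epsilon> y - \<epsilon> *\<^sub>R B (J \<epsilon> x + J \<epsilon> y) = x + y" by (simp only: E)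
  qed
  show "J \<epsilon> (r *\<^sub>R x) = r *\<^sub>R J \<epsilon> x" for r x
  proof (rule J_unique[OF scaleR_D[OF D] assms])
    have "r *\<^sub>R J \<epsilon> x - \<epsilon> *\<^sub>R B (r *\<^sub>R J \<epsilon> x) = r *\<^sub>R (J \<epsilon> x - \<epsilon> *\<^sub>R B (J \<epsilon> x))"
      by (simp add: B_scaleR[OF D] scaleR_diff_right)
    then show "r *\<^sub>R J \<epsilon> x - \<epsilon> *\<^sub>R B (r *\<^sub>R J \<epsilon> x) = r *\<^sub>R x" by (simp only: E)
  qed
  show "norm (J \<epsilon> x) \<le> norm x * 1" for x using norm_J_le[OF assms] by simp
qed

text \<open>Bounded linearity and commutation with resolvents are immediate in this form, as
  \<open>B\<close> does not occur in it.\<close>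

definition Y :: "real \<Rightarrow> 'a \<Rightarrow> 'a" where
  "Y \<epsilon> v = (J \<epsilon> v - v) /\<^sub>R \<epsilon>"

lemma B_J:
  assumes "0 < \<epsilon>" shows "B (J \<epsilon> v) = Y \<epsilon> v"
proof -
  have "J \<epsilon> v - v = J \<epsilon> v - (J \<epsilon> v - \<epsilon> *\<^sub>R B (J \<epsilon> v))" by (simp only: J_eq[OF assms])
  then have "J \<epsilon> v - v = \<epsilon> *\<^sub>R B (J \<epsilon> v)" by simp
  then show ?thesis using assms by (simp add: Y_def)
qed

lemma bounded_linear_Y:
  assumes "0 < \<epsilon>" shows "bounded_linear (Y \<epsilon>)"
  unfolding Y_def
  by (intro bounded_linear_const_scaleR bounded_linear_sub bounded_linear_J assms
    bounded_linear_ident)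

lemma Y_dissipative:
  assumes "0 < \<epsilon>" shows "inner (Y \<epsilon> v) v \<le> 0"
proof -
  have "inner (J \<epsilon> v) v \<le> norm (J \<epsilon> v) * norm v" by (rule norm_cauchy_schwarz)
  also have "\<dots> \<le> inner v v" using norm_J_le[OF assms, of v]
    by (simp add: dot_square_norm power2_eq_square mult_right_mono)
  finally show ?thesis using assms by (simp add: Y_def inner_diff_left mult_le_0_iff)
qed

text \<open>For \<open>v\<close> in \<open>D\<close> the vector \<open>B (J \<epsilon> v) = (J
  \<epsilon> v - v) /\<^sub>R \<epsilon>\<close> lies in \<open>D\<close> again, so \<open>B\<close>
  can be applied once more, and it solves the resolvent equation with right-hand side
  \<open>B v\<close>. The second form gives convergence of order \<epsilon> on
  \<open>D\<close>.\<close>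

lemma
  assumes "0 < \<epsilon>" "v \<in> D"
  shows J_B: "J \<epsilon> (B v) = Y \<epsilon> v"
    and J_minus_id: "J \<epsilon> v - v = \<epsilon> *\<^sub>R J \<epsilon> (B v)"
proof -
  define w where "w = J \<epsilon> v"
  have w: "w \<in> D" using J_in_D assms by (simp add: w_def)
  have Bw: "B w = (w - v) /\<^sub>R \<epsilon>" using B_J[OF assms(1)] by (simp add: w_def Y_def)
  have BD: "B w \<in> D" using Bw scaleR_D diff_D w assms by simp
  have "B (B w) = (B w - B v) /\<^sub>R \<epsilon>"
    unfolding Bw using B_scaleR[OF diff_D[OF w assms(2)]] B_diff[OF w assms(2)] Bw by simp
  then have "B w - \<epsilon> *\<^sub>R B (B w) = B v" using assms by simp
  then have "J \<epsilon> (B v) = B w" by (rule J_unique[OF BD assms(1)])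
  then show *: "J \<epsilon> (B v) = Y \<epsilon> v" unfolding w_def B_J[OF assms(1)] .
  show "J \<epsilon> v - v = \<epsilon> *\<^sub>R J \<epsilon> (B v)"
    unfolding * using assms by (simp add: Y_def)
qed

lemma J_commute:
  assumes "0 < \<epsilon>" "0 < \<delta>" shows "J \<epsilon> (J \<delta> v) = J \<delta> (J \<epsilon> v)"
proof (rule J_unique[symmetric, OF J_in_D[OF assms(1)] assms(2)])
  interpret J: bounded_linear "J \<epsilon>" by (rule bounded_linear_J[OF assms(1)])
  have "J \<epsilon> (J \<delta> v) - \<delta> *\<^sub>R B (J \<epsilon> (J \<delta> v)) = J \<epsilon> (J \<delta> v - \<delta> *\<^sub>R B (J \<delta> v))"
    using J_B[OF assms(1) J_in_D[OF assms(2)]] B_J[OF assms(1)] by (simp add: J.diff J.scaleR)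
  then show "J \<epsilon> (J \<delta> v) - \<delta> *\<^sub>R B (J \<epsilon> (J \<delta> v)) = J \<epsilon> v" by (simp only: J_eq[OF assms(2)])
qed

lemma J_Y:
  assumes "0 < \<epsilon>" "0 < \<delta>" shows "J \<delta> (Y \<epsilon> v) = Y \<epsilon> (J \<delta> v)"
proof -
  interpret J: bounded_linear "J \<delta>" by (rule bounded_linear_J[OF assms(2)])
  show ?thesis using J_commute[OF assms] by (simp add: Y_def J.diff J.scaleR)
qed

text \<open>On \<open>D\<close> the error is of order \<epsilon>. By density and compactness,
  finitely many points of \<open>D\<close> come within \<open>\<eta> / 4\<close> of all of
  \<open>K\<close>, and contractivity of \<open>J \<epsilon>\<close> transfers the estimate to
  \<open>K\<close> at the cost of two quarters of \<eta>.\<close>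

lemma J_uniform:
  assumes K: "compact K" and \<eta>: "0 < \<eta>"
  obtains \<delta> where "0 < \<delta>" "\<And>\<epsilon> v. 0 < \<epsilon> \<Longrightarrow> \<epsilon> \<le> \<delta> \<Longrightarrow> v \<in> K \<Longrightarrow> norm (J \<epsilon> v - v) \<le> \<eta>"
proof -
  have "K \<subseteq> (\<Union>d\<in>D. ball d (\<eta> / 4))"
  proof
    fix v
    obtain d where "d \<in> D" "dist d v < \<eta> / 4"
      using dense \<eta> closure_approachable[of v D]
        by (metis UNIV_I zero_less_divide_iff zero_less_numeral)
    then show "v \<in> (\<Union>d\<in>D. ball d (\<eta> / 4))" by auto
  qed
  then obtain F where F: "F \<subseteq> D" "finite F" "K \<subseteq> (\<Union>d\<in>F. ball d (\<eta> / 4))"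
    using compactE_image[OF K, of D "\<lambda>d. ball d (\<eta> / 4)"] by auto
  define M where "M = 1 + (\<Sum>d\<in>F. norm (B d))"
  have M: "0 < M" by (auto simp: M_def intro!: add_pos_nonneg sum_nonneg)
  show ?thesis
  proof (rule that)
    show "0 < \<eta> / (2 * M)" using \<eta> M by simp
    fix \<epsilon> v assume \<epsilon>: "0 < \<epsilon>" "\<epsilon> \<le> \<eta> / (2 * M)" and v: "v \<in> K"
    interpret J: bounded_linear "J \<epsilon>" by (rule bounded_linear_J[OF \<epsilon>(1)])
    obtain d where d: "d \<in> F" "dist d v < \<eta> / 4" using F v by auto
    have "norm (B d) \<le> M"
      using member_le_sum[of d F "\<lambda>d. norm (B d)"] d F by (simp add: M_def)
    then have "norm (J \<epsilon> (B d)) \<le> M" using norm_J_le[OF \<epsilon>(1), of "B d"] by linarith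
    then have "norm (J \<epsilon> d - d) \<le> \<epsilon> * M"
      using J_minus_id[OF \<epsilon>(1), of d] d F \<epsilon> by auto
    also have "\<dots> \<le> \<eta> / 2" using \<epsilon> M by (simp add: field_simps)
    finally have 1: "norm (J \<epsilon> d - d) \<le> \<eta> / 2" .
    have 2: "norm (v - d) < \<eta> / 4" using d(2) by (simp add: dist_norm norm_minus_commute)
    have 3: "norm (J \<epsilon> (v - d)) < \<eta> / 4" using norm_J_le[OF \<epsilon>(1), of "v - d"] 2 by linarith
    have "J \<epsilon> v - v = J \<epsilon> (v - d) + (J \<epsilon> d - d) - (v - d)" by (simp add: J.diff)
    also have "norm \<dots> \<le> norm (J \<epsilon> (v - d)) + norm (J \<epsilon> d - d) + norm (v - d)"
      by (meson norm_triangle_ineq4 norm_triangle_le order_trans add_mono order_refl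
        norm_triangle_ineq)
    finally show "norm (J \<epsilon> v - v) \<le> \<eta>" using 1 2 3 by linarith
  qed
qed

lemma J_tendsto: "(\<lambda>n. J (inverse (real (Suc n))) v) \<longlonglongrightarrow> v"
proof (rule LIMSEQ_I)
  fix e :: real assume e: "0 < e"
  obtain \<delta> where \<delta>: "0 < \<delta>" "\<And>\<epsilon> w. 0 < \<epsilon> \<Longrightarrow> \<epsilon> \<le> \<delta> \<Longrightarrow> w \<in> {v} \<Longrightarrow> norm (J \<epsilon> w - w) \<le> e / 2"
    using J_uniform[of "{v}" "e / 2"] e by auto
  have "\<forall>\<^sub>F n in sequentially. inverse (real (Suc n)) < \<delta>"
    using order_tendstoD(2)[OF LIMSEQ_inverse_real_of_nat \<delta>(1)] .
  then obtain N where N: "\<And>n. N \<le> n \<Longrightarrow> inverse (real (Suc n)) < \<delta>"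
    unfolding eventually_sequentially by blast
  show "\<exists>N. \<forall>n\<ge>N. norm (J (inverse (real (Suc n))) v - v) < e"
  proof (intro exI allI impI)
    fix n assume "N \<le> n"
    then have "norm (J (inverse (real (Suc n))) v - v) \<le> e / 2"
      using \<delta>(2)[of "inverse (real (Suc n))" v] N[of n] by simp
    then show "norm (J (inverse (real (Suc n))) v - v) < e" using e by simp
  qed
qed

text \<open>The bounded operator \<open>J 1\<close> satisfies
  \<open>J 1 (X n - B (X n)) = X n\<close>, and this identity passes to the limit.\<close>

lemma B_closed:
  assumes X: "\<And>n. X n \<in> D" and lim: "X \<longlonglongrightarrow> x" "(\<lambda>n. B (X n)) \<longlonglongrightarrow> b"
  shows "x \<in> D" "B x = b"
proof -
  interpret J: bounded_linear "J 1" by (rule bounded_linear_J) simp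
  have "(\<lambda>n. J 1 (X n - B (X n))) \<longlonglongrightarrow> J 1 (x - b)"
    by (intro J.tendsto tendsto_diff lim)
  moreover have "J 1 (X n - B (X n)) = X n" for n
    using J_unique[OF X, of 1] by simp
  ultimately have eq: "J 1 (x - b) = x" using lim(1) LIMSEQ_unique by fastforce
  show "x \<in> D" using J_in_D[of 1 "x - b"] eq by simp
  show "B x = b" using J_eq[of 1 "x - b"] eq by simp
qed

text \<open>The hypothesis says \<open>B (J \<delta> u) = J \<delta> v\<close>; as
  \<open>J \<delta>\<close> tends to the identity along a sequence, closedness of \<open>B\<close>
  applies. Domain membership is thus tested with bounded operators only, a condition that survives
  limits of approximate solutions.\<close>

lemma in_D_of_resolvents:
  assumes "\<And>\<delta>. 0 < \<delta> \<Longrightarrow> Y \<delta> u = J \<delta> v"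
  shows "u \<in> D" "B u = v"
proof -
  let ?e = "\<lambda>n. inverse (real (Suc n))"
  have "(\<lambda>n. B (J (?e n) u)) \<longlonglongrightarrow> v"
    using J_tendsto[of v] by (simp add: B_J assms)
  then show "u \<in> D" "B u = v"
    using B_closed[OF J_in_D J_tendsto[of u], of v] by auto
qed

end

section \<open>Convergence of the Yosida scheme for the linear problem\<close>

context m_dissipative
begin

definition yosida_solution :: "real \<Rightarrow> real \<Rightarrow> real \<Rightarrow> 'a \<Rightarrow> (real \<Rightarrow> 'a) \<Rightarrow> (real \<Rightarrow> 'a) \<Rightarrow> bool" where
  "yosida_solution \<alpha> T \<epsilon> x f u \<longleftrightarrow>
     continuous_on {0..T} u \<and> continuous_on {0..T} f \<and>
     (\<forall>t\<in>{0..T}. u t = x + frac_int \<alpha> (\<lambda>s. Y \<epsilon> (u s) + f s) t)"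

lemma continuous_on_Y:
  "0 < \<epsilon> \<Longrightarrow> continuous_on S u \<Longrightarrow> continuous_on S (\<lambda>s. Y \<epsilon> (u s))"
  by (rule bounded_linear.continuous_on[OF bounded_linear_Y])

lemma continuous_on_J:
  "0 < \<epsilon> \<Longrightarrow> continuous_on S u \<Longrightarrow> continuous_on S (\<lambda>s. J \<epsilon> (u s))"
  by (rule bounded_linear.continuous_on[OF bounded_linear_J])

text \<open>\<open>Y \<delta> (J \<delta> v)\<close> is \<open>B\<close> at the twice smoothed
  vector. Two resolvents are taken because the error is \<epsilon> times \<open>J \<epsilon>\<close>
  of \<open>B\<close> applied twice to that vector; both applications together amount to the bounded
  operator \<open>Y \<delta>\<close> applied twice to \<open>v\<close>.\<close>

lemma Y_approx_B:
  assumes \<delta>: "0 < \<delta>"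
  obtains C where "0 \<le> C"
    "\<And>\<epsilon> v. 0 < \<epsilon> \<Longrightarrow> norm (Y \<epsilon> (J \<delta> (J \<delta> v)) - Y \<delta> (J \<delta> v)) \<le> \<epsilon> * (C * norm v)"
proof -
  interpret Y: bounded_linear "Y \<delta>" by (rule bounded_linear_Y[OF \<delta>])
  obtain K where K: "0 < K" "\<And>v. norm (Y \<delta> v) \<le> norm v * K" using Y.pos_bounded by blast
  show ?thesis
  proof (rule that)
    show "0 \<le> K * K" by simp
    fix \<epsilon> :: real and v assume \<epsilon>: "0 < \<epsilon>"
    define b where "b = Y \<delta> (J \<delta> v)"
    have b: "b = J \<delta> (Y \<delta> v)" using J_Y[OF \<delta> \<delta>] by (simp add: b_def)
    have bD: "b \<in> D" using J_in_D[OF \<delta>] by (simp add: b)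
    have "Y \<epsilon> (J \<delta> (J \<delta> v)) = J \<epsilon> (B (J \<delta> (J \<delta> v)))" using J_B[OF \<epsilon> J_in_D[OF \<delta>]] by simp
    also have "\<dots> = J \<epsilon> b" by (simp add: B_J[OF \<delta>] b_def)
    finally have "Y \<epsilon> (J \<delta> (J \<delta> v)) - b = \<epsilon> *\<^sub>R J \<epsilon> (B b)" using J_minus_id[OF \<epsilon> bD] by simp
    also have "norm \<dots> \<le> \<epsilon> * norm (B b)" using norm_J_le[OF \<epsilon>, of "B b"] \<epsilon>
      by (simp add: mult_left_mono)
    also have "B b = Y \<delta> (Y \<delta> v)" by (simp add: b B_J[OF \<delta>])
    also have "norm (Y \<delta> (Y \<delta> v)) \<le> (norm v * K) * K"
      using K(2)[of "Y \<delta> v"] mult_right_mono[OF K(2)[of v], of K] K(1) by linarith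
    finally show "norm (Y \<epsilon> (J \<delta> (J \<delta> v)) - Y \<delta> (J \<delta> v)) \<le> \<epsilon> * (K * K * norm v)"
      using \<epsilon> by (simp add: b_def mult_ac)
  qed
qed

context
  fixes \<alpha> :: real
  assumes \<alpha>: "0 < \<alpha>" "\<alpha> < 1"
begin

lemma yosida_solution_exists:
  "0 < \<epsilon> \<Longrightarrow> continuous_on {0..T} f \<Longrightarrow> \<exists>u. yosida_solution \<alpha> T \<epsilon> x f u"
  using bounded_volterra_solution[OF \<alpha>(1) bounded_linear_Y] unfolding yosida_solution_def by blast

lemma yosida_solution_bound:
  assumes "0 < \<epsilon>" "yosida_solution \<alpha> T \<epsilon> x f u" "t \<in> {0..T}"
  shows "norm (u t) \<le> norm x + frac_int \<alpha> (\<lambda>s. norm (f s)) t"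
proof (rule dissipative_solution_bound[OF \<alpha>, of T "Y \<epsilon>"])
  show "continuous_on {0..T} (\<lambda>s. Y \<epsilon> (u s))"
    using assms unfolding yosida_solution_def by (intro continuous_on_Y) auto
qed (use assms Y_dissipative in \<open>unfold yosida_solution_def, blast+\<close>)

lemma yosida_solution_bound_const:
  assumes "0 < \<epsilon>" "yosida_solution \<alpha> T \<epsilon> x f u" "t \<in> {0..T}"
    and "\<And>s. s \<in> {0..T} \<Longrightarrow> norm (f s) \<le> c"
  shows "norm (u t) \<le> norm x + T powr \<alpha> / Gamma (\<alpha> + 1) * c"
proof -
  have f: "continuous_on {0..T} f" using assms by (simp add: yosida_solution_def)
  have c: "0 \<le> c" using assms(4)[OF assms(3)] norm_ge_zero order_trans by blast
  have "norm (frac_int \<alpha> (\<lambda>s. norm (f s)) t) \<le> t powr \<alpha> / Gamma (\<alpha> + 1) * c"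
    using assms by (intro norm_frac_int_le_const[OF \<alpha>(1), of T] continuous_on_norm[OF f]) auto
  also have "\<dots> \<le> T powr \<alpha> / Gamma (\<alpha> + 1) * c"
    using assms(3) \<alpha> c by (intro mult_right_mono divide_right_mono powr_mono2)
      (auto intro: Gamma_real_nonneg)
  finally show ?thesis using yosida_solution_bound[OF assms(1-3)] by simp
qed

lemma yosida_solution_diff:
  assumes \<epsilon>: "0 < \<epsilon>" and u: "yosida_solution \<alpha> T \<epsilon> x f u" and v: "yosida_solution \<alpha> T \<epsilon> y g v"
  shows "yosida_solution \<alpha> T \<epsilon> (x - y) (\<lambda>s. f s - g s) (\<lambda>s. u s - v s)"
  unfolding yosida_solution_def
proof (intro conjI ballI)
  interpret Y: bounded_linear "Y \<epsilon>" by (rule bounded_linear_Y[OF \<epsilon>])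
  have c: "continuous_on {0..T} u" "continuous_on {0..T} v" "continuous_on {0..T} f" "continuous_on
    {0..T} g"
    using u v by (auto simp: yosida_solution_def)
  then show "continuous_on {0..T} (\<lambda>s. u s - v s)" "continuous_on {0..T} (\<lambda>s. f s - g s)"
    by (intro continuous_intros; simp)+
  fix t assume t: "t \<in> {0..T}"
  have "u t - v t = (x - y) + (frac_int \<alpha> (\<lambda>s. Y \<epsilon> (u s) + f s) t - frac_int \<alpha> (\<lambda>s. Y \<epsilon> (v s) + g s)
    t)"
    using u v t by (simp add: yosida_solution_def)
  also have "frac_int \<alpha> (\<lambda>s. Y \<epsilon> (u s) + f s) t - frac_int \<alpha> (\<lambda>s. Y \<epsilon> (v s) + g s) t
    = frac_int \<alpha> (\<lambda>s. (Y \<epsilon> (u s) + f s) - (Y \<epsilon> (v s) + g s)) t"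
    using t by (intro frac_int_diff[symmetric, of \<alpha> T] \<alpha> continuous_on_add continuous_on_Y \<epsilon> c) auto
  also have "(\<lambda>s. (Y \<epsilon> (u s) + f s) - (Y \<epsilon> (v s) + g s)) = (\<lambda>s. Y \<epsilon> (u s - v s) + (f s - g s))"
    by (simp add: Y.diff fun_eq_iff)
  finally show "u t - v t = x - y + frac_int \<alpha> (\<lambda>s. Y \<epsilon> (u s - v s) + (f s - g s)) t" .
qed

text \<open>A bounded operator passes through the integral. The lemma is applied to a product of
  resolvents, for smoothing, and to \<open>Y \<delta>\<close> and \<open>J \<delta>\<close>, for
  tracking \<open>B\<close> of the solution.\<close>

lemma yosida_solution_map:
  assumes \<epsilon>: "0 < \<epsilon>" and u: "yosida_solution \<alpha> T \<epsilon> x f u"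
    and P: "bounded_linear P" and comm: "\<And>v. P (Y \<epsilon> v) = Y \<epsilon> (P v)"
  shows "yosida_solution \<alpha> T \<epsilon> (P x) (\<lambda>s. P (f s)) (\<lambda>s. P (u s))"
  unfolding yosida_solution_def
proof (intro conjI ballI)
  interpret P: bounded_linear P by fact
  have c: "continuous_on {0..T} u" "continuous_on {0..T} f"
    using u by (auto simp: yosida_solution_def)
  then show "continuous_on {0..T} (\<lambda>s. P (u s))" "continuous_on {0..T} (\<lambda>s. P (f s))"
    by (intro P.continuous_on; simp)+
  fix t assume t: "t \<in> {0..T}"
  have "P (u t) = P x + P (frac_int \<alpha> (\<lambda>s. Y \<epsilon> (u s) + f s) t)"
    using u t by (simp add: yosida_solution_def P.add)
  also have "P (frac_int \<alpha> (\<lambda>s. Y \<epsilon> (u s) + f s) t) = frac_int \<alpha> (\<lambda>s. P (Y \<epsilon> (u s) + f s)) t"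
    using t by (intro frac_int_bounded_linear[symmetric, of \<alpha> T] \<alpha> P continuous_on_add
      continuous_on_Y \<epsilon> c) auto
  finally show "P (u t) = P x + frac_int \<alpha> (\<lambda>s. Y \<epsilon> (P (u s)) + P (f s)) t"
    by (simp add: P.add comm)
qed

lemma yosida_solution_unique:
  assumes "0 < \<epsilon>" "yosida_solution \<alpha> T \<epsilon> x f u" "yosida_solution \<alpha> T \<epsilon> x f v" "t \<in> {0..T}"
  shows "u t = v t"
  using yosida_solution_bound_const[OF assms(1) yosida_solution_diff[OF assms(1-3)] assms(4), of 0]
    by simp

text \<open>
  On vectors smoothed by two resolvents the Yosida approximations converge in operator norm, and
  the error made by smoothing the data is controlled uniformly in the approximation parameter.
\<close>

lemma yosida_solutions_converge:
  assumes T: "0 \<le> T" and f: "continuous_on {0..T} f"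
    and U: "\<And>n. yosida_solution \<alpha> T (inverse (real (Suc n))) x f (U n)"
  obtains u where "uniform_limit {0..T} U u sequentially"
proof -
  let ?e = "\<lambda>n. inverse (real (Suc n))"
  have e: "0 < ?e n" for n by simp
  define G where "G = T powr \<alpha> / Gamma (\<alpha> + 1) + 1"
  have G: "1 \<le> G" using \<alpha> by (auto simp: G_def intro!: divide_nonneg_nonneg Gamma_real_nonneg)
  obtain F where F: "0 \<le> F" "\<And>s. s \<in> {0..T} \<Longrightarrow> norm (f s) \<le> F"
    using continuous_on_Icc_norm_bound[OF f] by blast
  have GT: "norm y + T powr \<alpha> / Gamma (\<alpha> + 1) * c \<le> norm y + G * c" if "0 \<le> c" for y :: 'a and c
    using that by (simp add: G_def distrib_right)
  have U_bound: "norm (U n s) \<le> norm x + G * F" if "s \<in> {0..T}" for n s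
    using order_trans[OF yosida_solution_bound_const[OF e U that, of F] GT[OF F(1)]] F(2) by blast
  have "uniformly_Cauchy_on {0..T} U"
  proof (rule uniformly_Cauchy_onI)
    fix r :: real assume r: "0 < r"
    define \<eta> where "\<eta> = r / (8 * G)"
    have \<eta>: "0 < \<eta>" using r G by (simp add: \<eta>_def)
    \<comment> \<open>One \<delta> has to serve the initial value and the source at all
      times.\<close>
    have "compact (insert x (f ` {0..T}))" by (intro compact_insert compact_continuous_image f) simp
    then obtain \<delta> where \<delta>: "0 < \<delta>" and \<delta>': "\<And>\<epsilon> v. 0 < \<epsilon> \<Longrightarrow> \<epsilon> \<le> \<delta> \<Longrightarrow> v \<in> insert x (f ` {0..T}) \<Longrightarrow>
      norm (J \<epsilon> v - v) \<le> \<eta> / 2"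
      using J_uniform[of _ "\<eta> / 2"] \<eta> by (metis half_gt_zero)
    interpret J: bounded_linear "J \<delta>" by (rule bounded_linear_J[OF \<delta>])
    define P where "P v = J \<delta> (J \<delta> v)" for v
    have P: "bounded_linear P" unfolding P_def
      using bounded_linear_compose[OF J.bounded_linear_axioms J.bounded_linear_axioms]
        by (simp add: o_def)
    have P_close: "norm (v - P v) \<le> \<eta>" if "v \<in> insert x (f ` {0..T})" for v
    proof -
      have "norm (J \<delta> v - v) \<le> \<eta> / 2" using \<delta>'[OF \<delta> order_refl that] .
      moreover have "norm (J \<delta> (J \<delta> v - v)) \<le> norm (J \<delta> v - v)" by (rule norm_J_le[OF \<delta>])
      moreover have "norm (P v - v) = norm (J \<delta> (J \<delta> v - v) + (J \<delta> v - v))"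
        by (simp add: P_def J.diff)
      ultimately have "norm (P v - v) \<le> \<eta>"
        using norm_triangle_ineq[of "J \<delta> (J \<delta> v - v)" "J \<delta> v - v"] by linarith
      then show ?thesis by (simp add: norm_minus_commute)
    qed
    have P_comm: "P (Y \<epsilon> v) = Y \<epsilon> (P v)" if "0 < \<epsilon>" for \<epsilon> v
      using J_Y[OF that \<delta>] by (simp add: P_def)
    obtain C where C: "0 \<le> C" "\<And>\<epsilon> v. 0 < \<epsilon> \<Longrightarrow> norm (Y \<epsilon> (P v) - Y \<delta> (J \<delta> v)) \<le> \<epsilon> * (C * norm v)"
      using Y_approx_B[OF \<delta>] unfolding P_def by blast
    define M where "M = norm x + G * F"
    have M: "0 \<le> M" using G F by (simp add: M_def)
    have PU: "yosida_solution \<alpha> T (?e n) (P x) (\<lambda>s. P (f s)) (\<lambda>s. P (U n s))" for n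
      by (rule yosida_solution_map[OF e U P P_comm[OF e]])
    \<comment> \<open>\<open>U n - P (U n)\<close> solves the same equation with data
      \<open>x - P x\<close> and \<open>f - P f\<close>, all of norm at most \<eta>, so the bound is
      independent of \<open>n\<close>.\<close>
    have near: "norm (U n t - P (U n t)) \<le> r / 4" if t: "t \<in> {0..T}" for n t
    proof -
      have "norm (U n t - P (U n t)) \<le> norm (x - P x) + T powr \<alpha> / Gamma (\<alpha> + 1) * \<eta>"
        using P_close by (intro yosida_solution_bound_const[OF e yosida_solution_diff[OF e U PU] t])
          auto
      also have "\<dots> \<le> \<eta> + (G - 1) * \<eta>" using P_close[of x] by (simp add: G_def)
      also have "\<dots> = G * \<eta>" by (simp add: algebra_simps)
      also have "\<dots> \<le> r / 4" using G r by (simp add: \<eta>_def)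
      finally show ?thesis .
    qed
    have smooth: "norm (P (U n t) - P (U m t)) \<le> G * ((?e n + ?e m) * (C * M))" if t: "t \<in> {0..T}"
      for n m t
    proof -
      \<comment> \<open>With this source \<open>P (U m)\<close> solves the equation of index
        \<open>n\<close>. The consistency error is a difference of two Yosida approximations on
        twice smoothed vectors, hence of order \<open>?e n + ?e m\<close>.\<close>
      define g where "g s = P (f s) + (Y (?e m) (P (U m s)) - Y (?e n) (P (U m s)))" for s
      have cP: "continuous_on {0..T} (\<lambda>s. P (U m s))" "continuous_on {0..T} (\<lambda>s. P (f s))"
        using PU[of m] by (auto simp: yosida_solution_def)
      have "yosida_solution \<alpha> T (?e n) (P x) g (\<lambda>s. P (U m s))"
        unfolding yosida_solution_def
      proof (intro conjI cP ballI)
        show "continuous_on {0..T} g" unfolding g_def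
          by (intro continuous_intros continuous_on_Y e cP)
        show "P (U m t) = P x + frac_int \<alpha> (\<lambda>s. Y (?e n) (P (U m s)) + g s) t" if "t \<in> {0..T}" for t
          using PU[of m] that by (simp add: yosida_solution_def g_def add.commute)
      qed
      from yosida_solution_diff[OF e PU this]
      have "norm (P (U n t) - P (U m t)) \<le> norm (P x - P x) + T powr \<alpha> / Gamma (\<alpha> + 1) *
        ((?e n + ?e m) * (C * M))"
      proof (rule yosida_solution_bound_const[OF e _ t])
        fix s assume s: "s \<in> {0..T}"
        have CM: "C * norm (U m s) \<le> C * M" using U_bound[OF s] C
          by (simp add: M_def mult_left_mono)
        have "norm (Y (?e k) (P (U m s)) - Y \<delta> (J \<delta> (U m s))) \<le> ?e k * (C * M)" for k
          by (rule order_trans[OF C(2)[OF e] mult_left_mono[OF CM less_imp_le[OF e]]])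
        from this[of n] this[of m]
        have "norm (Y (?e n) (P (U m s)) - Y (?e m) (P (U m s))) \<le> ?e n * (C * M) + ?e m * (C * M)"
          by (rule norm_diff_triangle_le[OF _
            order_eq_refl[OF norm_minus_commute, THEN order_trans]])
        then show "norm (P (f s) - g s) \<le> (?e n + ?e m) * (C * M)"
          by (simp add: g_def distrib_right)
      qed
      also have "\<dots> \<le> norm (P x - P x) + G * ((?e n + ?e m) * (C * M))"
        using C M e[of n] e[of m] by (intro GT mult_nonneg_nonneg add_nonneg_nonneg) auto
      finally show ?thesis by simp
    qed
    have "(\<lambda>n. G * ((?e n + ?e n) * (C * M))) \<longlonglongrightarrow> G * ((0 + 0) * (C * M))"
      by (intro tendsto_intros LIMSEQ_inverse_real_of_nat)
    then have "\<forall>\<^sub>F n in sequentially. G * ((?e n + ?e n) * (C * M)) < r / 4"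
      by (rule order_tendstoD(2)) (use r in simp)
    then obtain N where N: "G * ((?e N + ?e N) * (C * M)) < r / 4"
      unfolding eventually_sequentially by blast
    show "\<exists>N. \<forall>t\<in>{0..T}. \<forall>m\<ge>N. \<forall>n\<ge>N. dist (U m t) (U n t) < r"
    proof (intro exI ballI allI impI)
      fix t m n assume t: "t \<in> {0..T}" and mn: "N \<le> m" "N \<le> n"
      have "?e m \<le> ?e N" "?e n \<le> ?e N" using mn by (auto intro!: le_imp_inverse_le)
      then have "G * ((?e m + ?e n) * (C * M)) \<le> G * ((?e N + ?e N) * (C * M))"
        using G C M by (intro mult_left_mono mult_right_mono add_mono) auto
      then have 1: "norm (P (U m t) - P (U n t)) < r / 4" using smooth[OF t, of m n] N by linarith
      have 2: "norm (U m t - P (U m t)) \<le> r / 4" "norm (P (U n t) - U n t) \<le> r / 4"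
        using near[OF t] by (auto simp: norm_minus_commute)
      have "U m t - U n t = (U m t - P (U m t)) + (P (U m t) - P (U n t)) + (P (U n t) - U n t)"
        by simp
      then have "norm (U m t - U n t) \<le> norm (U m t - P (U m t)) + norm (P (U m t) - P (U n t))
        + norm (P (U n t) - U n t)"
        by (metis norm_triangle_le norm_triangle_ineq add_mono order_refl)
      then show "dist (U m t) (U n t) < r" using 1 2 r by (simp add: dist_norm)
    qed
  qed
  then have "uniformly_convergent_on {0..T} U" by (rule Cauchy_uniformly_convergent)
  then show ?thesis using that unfolding uniformly_convergent_on_def by blast
qed

text \<open>A second scheme, with data \<open>B x\<close> and \<open>B (f t)\<close>, produces the
  candidate \<open>v\<close> for \<open>B u\<close>. For the approximations
  \<open>Y \<delta> (U n t) = J \<delta> (V n t)\<close> holds by uniqueness, and the limit of this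
  relation identifies \<open>v\<close> through \<open>in_D_of_resolvents\<close>.\<close>

lemma linear_problem_solvable:
  assumes T: "0 \<le> T" and x: "x \<in> D" and fD: "\<And>t. t \<in> {0..T} \<Longrightarrow> f t \<in> D"
    and f: "continuous_on {0..T} f" and Bf: "continuous_on {0..T} (\<lambda>t. B (f t))"
  obtains u where "\<And>t. t \<in> {0..T} \<Longrightarrow> u t \<in> D" "continuous_on {0..T} u" "continuous_on {0..T}
    (\<lambda>t. B (u t))"
    "\<And>t. t \<in> {0..T} \<Longrightarrow> u t = x + frac_int \<alpha> (\<lambda>s. B (u s) + f s) t"
proof -
  let ?e = "\<lambda>n. inverse (real (Suc n))"
  have e: "0 < ?e n" for n by simp
  have "\<exists>u. yosida_solution \<alpha> T (?e n) x f u" "\<exists>v. yosida_solution \<alpha> T (?e n) (B x) (\<lambda>t. B (f t)) v"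
    for n
    by (intro yosida_solution_exists e f Bf)+
  then obtain U V where U: "\<And>n. yosida_solution \<alpha> T (?e n) x f (U n)"
    and V: "\<And>n. yosida_solution \<alpha> T (?e n) (B x) (\<lambda>t. B (f t)) (V n)" by metis
  obtain u where u: "uniform_limit {0..T} U u sequentially"
    by (rule yosida_solutions_converge[OF T f U])
  obtain v where v: "uniform_limit {0..T} V v sequentially"
    by (rule yosida_solutions_converge[OF T Bf V])
  have cU: "continuous_on {0..T} (U n)" and cV: "continuous_on {0..T} (V n)" for n
    using U[of n] V[of n] by (auto simp: yosida_solution_def)
  have cu: "continuous_on {0..T} u" using uniform_limit_theorem[OF _ u] cU by simp
  have cv: "continuous_on {0..T} v" using uniform_limit_theorem[OF _ v] cV by simp
  have YU: "Y \<delta> (U n t) = J \<delta> (V n t)" if \<delta>: "0 < \<delta>" and t: "t \<in> {0..T}" for \<delta> n t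
  proof (rule yosida_solution_unique[OF e _ _ t])
    have YY: "Y \<delta> (Y (?e n) v) = Y (?e n) (Y \<delta> v)" for v
    proof -
      interpret Y: bounded_linear "Y (?e n)" by (rule bounded_linear_Y[OF e])
      show ?thesis using J_Y[OF e \<delta>, of n v] unfolding Y_def[of \<delta>]
        by (simp add: Y.diff Y.scaleR del: of_nat_Suc)
    qed
    show "yosida_solution \<alpha> T (?e n) (Y \<delta> x) (\<lambda>s. Y \<delta> (f s)) (\<lambda>s. Y \<delta> (U n s))"
      by (rule yosida_solution_map[OF e U bounded_linear_Y[OF \<delta>] YY])
    have *: "yosida_solution \<alpha> T (?e n) (J \<delta> (B x)) (\<lambda>s. J \<delta> (B (f s))) (\<lambda>s. J \<delta> (V n s))"
      by (rule yosida_solution_map[OF e V bounded_linear_J[OF \<delta>] J_Y[OF e \<delta>]])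
    have eq: "J \<delta> (B (f s)) = Y \<delta> (f s)" if "s \<in> {0..T}" for s using J_B[OF \<delta> fD[OF that]] .
    show "yosida_solution \<alpha> T (?e n) (Y \<delta> x) (\<lambda>s. Y \<delta> (f s)) (\<lambda>s. J \<delta> (V n s))"
      unfolding yosida_solution_def
    proof (intro conjI ballI)
      show "continuous_on {0..T} (\<lambda>s. J \<delta> (V n s))" by (rule continuous_on_J[OF \<delta> cV])
      show "continuous_on {0..T} (\<lambda>s. Y \<delta> (f s))" by (rule continuous_on_Y[OF \<delta> f])
      fix t assume t: "t \<in> {0..T}"
      have "frac_int \<alpha> (\<lambda>s. Y (?e n) (J \<delta> (V n s)) + J \<delta> (B (f s))) t
        = frac_int \<alpha> (\<lambda>s. Y (?e n) (J \<delta> (V n s)) + Y \<delta> (f s)) t"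
        by (rule frac_int_cong) (use eq t in auto)
      then show "J \<delta> (V n t) = Y \<delta> x + frac_int \<alpha> (\<lambda>s. Y (?e n) (J \<delta> (V n s)) + Y \<delta> (f s)) t"
        using * t J_B[OF \<delta> x] by (simp add: yosida_solution_def)
    qed
  qed
  have Yu: "Y \<delta> (u t) = J \<delta> (v t)" if \<delta>: "0 < \<delta>" and t: "t \<in> {0..T}" for \<delta> t
  proof (rule LIMSEQ_unique)
    interpret Y: bounded_linear "Y \<delta>" by (rule bounded_linear_Y[OF \<delta>])
    interpret J: bounded_linear "J \<delta>" by (rule bounded_linear_J[OF \<delta>])
    show "(\<lambda>n. Y \<delta> (U n t)) \<longlonglongrightarrow> Y \<delta> (u t)"
      by (intro Y.tendsto tendsto_uniform_limitI[OF u t])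
    show "(\<lambda>n. Y \<delta> (U n t)) \<longlonglongrightarrow> J \<delta> (v t)"
      unfolding YU[OF \<delta> t] by (intro J.tendsto tendsto_uniform_limitI[OF v t])
  qed
  have uD: "u t \<in> D" and Bu: "B (u t) = v t" if "t \<in> {0..T}" for t
    using in_D_of_resolvents[of "u t" "v t"] Yu[OF _ that] by auto
  \<comment> \<open>By \<open>YU\<close> with \<open>?e n\<close> for \<delta>, the left side is
    \<open>J (?e n) (V n s)\<close>. It is close to \<open>J (?e n) (v s)\<close> by contractivity,
    and this to \<open>v s\<close> uniformly, as \<open>v\<close> has compact range. This allows the
    limit inside the integral.\<close>
  have JV: "uniform_limit {0..T} (\<lambda>n s. Y (?e n) (U n s)) v sequentially"
  proof (rule uniform_limitI)
    fix r :: real assume r: "0 < r"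
    have "compact (v ` {0..T})" by (intro compact_continuous_image cv) simp
    then obtain \<delta> where \<delta>: "0 < \<delta>" "\<And>\<epsilon> w. 0 < \<epsilon> \<Longrightarrow> \<epsilon> \<le> \<delta> \<Longrightarrow> w \<in> v ` {0..T} \<Longrightarrow> norm (J \<epsilon> w - w) \<le> r / 2"
      using J_uniform[of _ "r / 2"] r by (metis half_gt_zero)
    have "\<forall>\<^sub>F n in sequentially. ?e n < \<delta>"
      using order_tendstoD(2)[OF LIMSEQ_inverse_real_of_nat \<delta>(1)] .
    moreover have "\<forall>\<^sub>F n in sequentially. \<forall>t\<in>{0..T}. dist (V n t) (v t) < r / 2"
      using uniform_limitD[OF v, of "r / 2"] r by simp
    ultimately show "\<forall>\<^sub>F n in sequentially. \<forall>t\<in>{0..T}. dist (Y (?e n) (U n t)) (v t) < r"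
    proof eventually_elim
      case (elim n)
      show ?case
      proof
        fix t assume t: "t \<in> {0..T}"
        interpret J: bounded_linear "J (?e n)" by (rule bounded_linear_J[OF e])
        have "norm (J (?e n) (V n t - v t)) < r / 2"
          using norm_J_le[OF e[of n], of "V n t - v t"] elim(2) t by (force simp: dist_norm)
        moreover have "norm (J (?e n) (v t) - v t) \<le> r / 2" using \<delta>(2)[OF e] elim(1) t by simp
        moreover have "norm (Y (?e n) (U n t) - v t) = norm (J (?e n) (V n t - v t)
          + (J (?e n) (v t) - v t))"
          by (simp add: YU[OF e t] J.diff del: of_nat_Suc)
        ultimately have "norm (Y (?e n) (U n t) - v t) < r"
          using norm_triangle_ineq[of "J (?e n) (V n t - v t)" "J (?e n) (v t) - v t"] by linarith
        then show "dist (Y (?e n) (U n t)) (v t) < r"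
          by (simp add: dist_norm)
      qed
    qed
  qed
  have eq: "u t = x + frac_int \<alpha> (\<lambda>s. v s + f s) t" if t: "t \<in> {0..T}" for t
  proof (rule LIMSEQ_unique[OF tendsto_uniform_limitI[OF u t]])
    have "uniform_limit {0..T} (\<lambda>n s. Y (?e n) (U n s) + f s) (\<lambda>s. v s + f s) sequentially"
      by (intro uniform_limit_intros JV)
    then have "(\<lambda>n. frac_int \<alpha> (\<lambda>s. Y (?e n) (U n s) + f s) t) \<longlonglongrightarrow> frac_int \<alpha> (\<lambda>s. v s + f s) t"
      by (rule uniform_limit_frac_int[OF \<alpha>(1) continuous_on_add[OF continuous_on_Y[OF e cU] f] _ t])
    then have "(\<lambda>n. x + frac_int \<alpha> (\<lambda>s. Y (?e n) (U n s) + f s) t) \<longlonglongrightarrow> x + frac_int \<alpha> (\<lambda>s. v s + f s)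
      t"
      by (intro tendsto_intros)
    moreover have "U n t = x + frac_int \<alpha> (\<lambda>s. Y (?e n) (U n s) + f s) t" for n
      using U[of n] t by (simp add: yosida_solution_def)
    ultimately show "(\<lambda>n. U n t) \<longlonglongrightarrow> x + frac_int \<alpha> (\<lambda>s. v s + f s) t" by presburger
  qed
  show ?thesis
  proof (rule that)
    show "u t \<in> D" if "t \<in> {0..T}" for t using uD[OF that] .
    show "continuous_on {0..T} u" by (rule cu)
    show "continuous_on {0..T} (\<lambda>t. B (u t))"
      using continuous_on_cong[of "{0..T}" "{0..T}" "\<lambda>t. B (u t)" v] Bu cv by simp
    fix t assume t: "t \<in> {0..T}"
    have "frac_int \<alpha> (\<lambda>s. B (u s) + f s) t = frac_int \<alpha> (\<lambda>s. v s + f s) t"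
      by (rule frac_int_cong) (use Bu t in auto)
    then show "u t = x + frac_int \<alpha> (\<lambda>s. B (u s) + f s) t" using eq[OF t] by (simp only:)
  qed
qed

text \<open>For the second bound, \<open>B u\<close> should solve the equation with data
  \<open>B x\<close> and \<open>B f\<close>, but it may leave \<open>D\<close>. The regularised
  function \<open>J \<delta> (B (u t)) = Y \<delta> (u t)\<close> stays in \<open>D\<close>;
  applying \<open>Y \<delta>\<close> to the equation gives the problem it solves, and the bound
  survives the limit of \<delta> to \<open>0\<close>.\<close>

lemma linear_problem_bounds:
  assumes T: "0 \<le> T" and uD: "\<And>t. t \<in> {0..T} \<Longrightarrow> u t \<in> D" and xD: "x \<in> D"
    and fD: "\<And>t. t \<in> {0..T} \<Longrightarrow> f t \<in> D"
    and u: "continuous_on {0..T} u" and Bu: "continuous_on {0..T} (\<lambda>t. B (u t))"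
    and f: "continuous_on {0..T} f" and Bf: "continuous_on {0..T} (\<lambda>t. B (f t))"
    and eq: "\<And>t. t \<in> {0..T} \<Longrightarrow> u t = x + frac_int \<alpha> (\<lambda>s. B (u s) + f s) t"
    and t: "t \<in> {0..T}"
  shows "norm (u t) \<le> norm x + frac_int \<alpha> (\<lambda>s. norm (f s)) t"
    and "norm (B (u t)) \<le> norm (B x) + frac_int \<alpha> (\<lambda>s. norm (B (f s))) t"
proof -
  show "norm (u t) \<le> norm x + frac_int \<alpha> (\<lambda>s. norm (f s)) t"
    by (rule dissipative_solution_bound[OF \<alpha> Bu f dissipative[OF uD] eq t])
  have "norm (J \<delta> (B (u t))) \<le> norm (B x) + frac_int \<alpha> (\<lambda>s. norm (B (f s))) t" if \<delta>: "0 < \<delta>" for \<delta>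
  proof -
    interpret J: bounded_linear "J \<delta>" by (rule bounded_linear_J[OF \<delta>])
    interpret Y: bounded_linear "Y \<delta>" by (rule bounded_linear_Y[OF \<delta>])
    define w where "w s = J \<delta> (B (u s))" for s
    define g where "g s = J \<delta> (B (f s))" for s
    have Bw: "B (w s) = Y \<delta> (B (u s))" for s by (simp add: w_def B_J[OF \<delta>])
    have w: "w s = Y \<delta> (u s)" if "s \<in> {0..T}" for s using J_B[OF \<delta> uD[OF that]] by (simp add: w_def)
    have g: "g s = Y \<delta> (f s)" if "s \<in> {0..T}" for s using J_B[OF \<delta> fD[OF that]] by (simp add: g_def)
    have cg: "continuous_on {0..T} g" unfolding g_def by (rule continuous_on_J[OF \<delta> Bf])
    have "norm (w t) \<le> norm (Y \<delta> x) + frac_int \<alpha> (\<lambda>s. norm (g s)) t"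
    proof (rule dissipative_solution_bound[OF \<alpha> _ cg _ _ t])
      show "continuous_on {0..T} (\<lambda>s. B (w s))" unfolding Bw by (rule continuous_on_Y[OF \<delta> Bu])
      show "inner (B (w s)) (w s) \<le> 0" for s unfolding w_def by (rule dissipative[OF J_in_D[OF \<delta>]])
      fix s assume s: "s \<in> {0..T}"
      have "w s = Y \<delta> x + Y \<delta> (frac_int \<alpha> (\<lambda>s. B (u s) + f s) s)"
        using w[OF s] eq[OF s] Y.add by simp
      also have "Y \<delta> (frac_int \<alpha> (\<lambda>s. B (u s) + f s) s) = frac_int \<alpha> (\<lambda>s. Y \<delta> (B (u s) + f s)) s"
        using s by (intro frac_int_bounded_linear[symmetric, of \<alpha> T] \<alpha> bounded_linear_Y[OF \<delta>]
          continuous_on_add Bu f) auto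
      also have "\<dots> = frac_int \<alpha> (\<lambda>s. B (w s) + g s) s"
        by (rule frac_int_cong) (use g s in \<open>auto simp: Bw Y.add\<close>)
      finally show "w s = Y \<delta> x + frac_int \<alpha> (\<lambda>s. B (w s) + g s) s" .
    qed
    moreover have "norm (Y \<delta> x) \<le> norm (B x)"
      using norm_J_le[OF \<delta>, of "B x"] J_B[OF \<delta> xD] by simp
    moreover have "frac_int \<alpha> (\<lambda>s. norm (g s)) t \<le> frac_int \<alpha> (\<lambda>s. norm (B (f s))) t"
      using t by (intro frac_int_mono[OF \<alpha>(1), of T] continuous_on_norm cg Bf) (auto simp: g_def
        norm_J_le[OF \<delta>])
    ultimately show ?thesis by (simp add: w_def)
  qed
  then have "\<forall>n. norm (J (inverse (real (Suc n))) (B (u t))) \<le> norm (B x) + frac_int \<alpha>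
    (\<lambda>s. norm (B (f s))) t"
    by simp
  then show "norm (B (u t)) \<le> norm (B x) + frac_int \<alpha> (\<lambda>s. norm (B (f s))) t"
    using LIMSEQ_le_const2[OF tendsto_norm[OF J_tendsto[of "B (u t)"]]] by blast
qed

end

end

section \<open>Selfadjoint operators\<close>

lemma cinner_scaleC_right: "cinner x (a *\<^sub>C y) = cnj a * cinner x (y :: 'a::complex_hilbert)"
  by (simp add: cinner_commute[of x] cinner_scaleC_left)

lemma Re_cinner: "Re (cinner x y) = inner x (y :: 'a::complex_hilbert)"
  by (simp add: inner_eq_Re_cinner)

text \<open>Together with \<open>Re_cinner\<close> this reduces complex statements to the real inner
  product, for which limits and orthogonality are treated.\<close>

lemma Im_cinner: "Im (cinner x y) = inner x (\<i> *\<^sub>C (y :: 'a::complex_hilbert))"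
  by (simp add: inner_eq_Re_cinner cinner_scaleC_right)

lemma cinner_self: "cinner x x = complex_of_real (inner x (x :: 'a::complex_hilbert))"
proof -
  have "Im (cinner x x) = 0"
    using arg_cong[OF cinner_commute[of x x], of Im] by simp
  then show ?thesis by (simp add: complex_eq_iff Re_cinner)
qed

lemma norm_scaleC: "norm (a *\<^sub>C x) = cmod a * norm (x :: 'a::complex_hilbert)"
proof -
  have "complex_of_real (inner (a *\<^sub>C x) (a *\<^sub>C x)) = (a * cnj a) * complex_of_real (inner x x)"
    by (simp add: cinner_self[symmetric] cinner_scaleC_left cinner_scaleC_right)
  also have "\<dots> = complex_of_real ((cmod a)\<^sup>2 * inner x x)"
    by (simp add: complex_norm_square[symmetric])
  finally have "inner (a *\<^sub>C x) (a *\<^sub>C x) = (cmod a)\<^sup>2 * inner x x"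
    using of_real_eq_iff by blast
  then show ?thesis by (simp add: norm_eq_sqrt_inner real_sqrt_mult)
qed

lemma bounded_linear_scaleC: "bounded_linear (\<lambda>x :: 'a::complex_hilbert. a *\<^sub>C x)"
proof (rule bounded_linear_intro[where K="cmod a"])
  show "a *\<^sub>C (r *\<^sub>R x) = r *\<^sub>R (a *\<^sub>C x)" for r and x :: 'a
    by (simp add: scaleC_of_real[symmetric] scaleC_scaleC mult.commute)
qed (simp_all add: scaleC_add_right norm_scaleC mult.commute)

lemma scaleC_neg_one: "(- 1) *\<^sub>C x = - (x :: 'a::complex_hilbert)"
  using scaleC_of_real[of "- 1" x] by simp

lemma i_scaleC_i [simp]: "\<i> *\<^sub>C (\<i> *\<^sub>C x) = - (x :: 'a::complex_hilbert)"
  by (simp add: scaleC_scaleC scaleC_neg_one)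

lemma tendsto_cinner_right:
  assumes "(f \<longlongrightarrow> l) F" shows "((\<lambda>n. cinner x (f n)) \<longlongrightarrow> cinner x (l :: 'a::complex_hilbert)) F"
proof -
  have eq: "cinner x y = Complex (inner x y) (inner x (\<i> *\<^sub>C y))" for y :: 'a
    by (simp add: complex_eq_iff Re_cinner Im_cinner)
  show ?thesis unfolding eq
    by (intro tendsto_Complex tendsto_inner tendsto_const assms
        bounded_linear.tendsto[OF bounded_linear_scaleC])
qed

section \<open>Vectors orthogonal to a closed subspace\<close>

lemma closest_point_in_subspace:
  fixes M :: "'a::{real_inner, complete_space} set"
  assumes M: "subspace M" "closed M"
  obtains p where "p \<in> M" "\<And>m. m \<in> M \<Longrightarrow> dist v p \<le> dist v m"
proof -
  have ne: "M \<noteq> {}" using subspace_0[OF M(1)] by auto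
  define d where "d = infdist v M"
  have d0: "0 \<le> d" by (simp add: d_def infdist_nonneg)
  have d_le: "d \<le> dist v m" if "m \<in> M" for m using infdist_le[OF that] by (simp add: d_def)
  have "\<exists>m\<in>M. dist v m < d + inverse (real (Suc n))" for n
  proof -
    have "infdist v M < d + inverse (real (Suc n))" by (simp add: d_def)
    then show ?thesis
      using ne cInf_lessD[of "dist v ` M"] by (auto simp: infdist_def split: if_splits)
  qed
  then obtain m where m: "\<And>n. m n \<in> M" "\<And>n. dist v (m n) < d + inverse (real (Suc n))" by metis
  \<comment> \<open>Parallelogram law: the midpoint of \<open>m j\<close> and \<open>m k\<close> is
    in \<open>M\<close> and thus no closer to \<open>v\<close> than \<open>d\<close>, which forces a
    minimising sequence to be Cauchy.\<close>
  have para: "(dist (m j) (m k))\<^sup>2 \<le> 2 * (dist v (m j))\<^sup>2 + 2 * (dist v (m k))\<^sup>2 - 4 * d\<^sup>2" for j k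
  proof -
    define c where "c = (1 / 2) *\<^sub>R (m j + m k)"
    have "c \<in> M" unfolding c_def by (intro subspace_scale subspace_add M(1) m)
    then have "d\<^sup>2 \<le> (norm (v - c))\<^sup>2" using d_le d0 by (auto simp: dist_norm intro!: power_mono)
    moreover have "(norm (m j - m k))\<^sup>2 + 4 * (norm (v - c))\<^sup>2
      = 2 * (norm (v - m j))\<^sup>2 + 2 * (norm (v - m k))\<^sup>2"
      unfolding power2_norm_eq_inner c_def
      by (simp add: inner_diff_left inner_diff_right inner_add_left inner_add_right inner_commute
        algebra_simps)
    ultimately show ?thesis by (simp add: dist_norm)
  qed
  have "Cauchy m"
  proof (rule metric_CauchyI)
    fix e :: real assume e: "0 < e"
    have "(\<lambda>n. 4 * (d + inverse (real (Suc n)))\<^sup>2 - 4 * d\<^sup>2) \<longlonglongrightarrow> 4 * (d + 0)\<^sup>2 - 4 * d\<^sup>2"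
      by (intro tendsto_intros LIMSEQ_inverse_real_of_nat)
    then have "\<forall>\<^sub>F n in sequentially. 4 * (d + inverse (real (Suc n)))\<^sup>2 - 4 * d\<^sup>2 < e\<^sup>2"
      by (rule order_tendstoD(2)) (use e in simp)
    then obtain N where N: "4 * (d + inverse (real (Suc N)))\<^sup>2 - 4 * d\<^sup>2 < e\<^sup>2"
      unfolding eventually_sequentially by blast
    show "\<exists>N. \<forall>j\<ge>N. \<forall>k\<ge>N. dist (m j) (m k) < e"
    proof (intro exI allI impI)
      fix j k assume jk: "N \<le> j" "N \<le> k"
      have le: "(dist v (m i))\<^sup>2 \<le> (d + inverse (real (Suc N)))\<^sup>2" if "N \<le> i" for i
      proof (rule power_mono)
        have "inverse (real (Suc i)) \<le> inverse (real (Suc N))" using that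
          by (auto intro!: le_imp_inverse_le)
        then show "dist v (m i) \<le> d + inverse (real (Suc N))" using m(2)[of i] by linarith
      qed simp
      have "(dist (m j) (m k))\<^sup>2 < e\<^sup>2" using para[of j k] le[OF jk(1)] le[OF jk(2)] N by linarith
      then show "dist (m j) (m k) < e" using e by (rule power_less_imp_less_base[OF _ less_imp_le])
    qed
  qed
  then obtain p where p: "m \<longlonglongrightarrow> p" using Cauchy_convergent convergent_def by blast
  have "p \<in> M" using M(2) m(1) p closed_sequentially by blast
  moreover have "dist v p \<le> d"
  proof (rule LIMSEQ_le)
    show "(\<lambda>n. dist v (m n)) \<longlonglongrightarrow> dist v p" by (intro tendsto_intros p)
    show "(\<lambda>n. d + inverse (real (Suc n))) \<longlonglongrightarrow> d"
      using tendsto_add[OF tendsto_const LIMSEQ_inverse_real_of_nat, of d] by simp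
  qed (use m(2) less_imp_le in blast)
  ultimately show ?thesis using that d_le order_trans by blast
qed

lemma closed_subspace_orthogonal:
  fixes M :: "'a::{real_inner, complete_space} set"
  assumes M: "subspace M" "closed M" and v: "v \<notin> M"
  obtains z where "z \<noteq> 0" "\<And>m. m \<in> M \<Longrightarrow> inner z m = 0"
proof -
  obtain p where p: "p \<in> M" "\<And>m. m \<in> M \<Longrightarrow> dist v p \<le> dist v m"
    using closest_point_in_subspace[OF M] by blast
  define z where "z = v - p"
  show ?thesis
  proof (rule that)
    show "z \<noteq> 0" using p v by (auto simp: z_def)
    fix m assume m: "m \<in> M"
    show "inner z m = 0"
    proof (cases "m = 0")
      case False
      \<comment> \<open>This minimises \<open>norm (z - s *\<^sub>R m)\<close> over
        \<open>s\<close>; any nonzero inner product would strictly decrease the distance.\<close>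
      define s where "s = inner z m / inner m m"
      have "dist v p \<le> dist v (p + s *\<^sub>R m)"
        by (intro p subspace_add subspace_scale M m)
      then have "(norm z)\<^sup>2 \<le> (norm (z - s *\<^sub>R m))\<^sup>2"
        by (auto simp: z_def dist_norm diff_diff_eq intro!: power_mono)
      also have "\<dots> = inner z z - 2 * s * inner z m + s * s * inner m m"
        unfolding power2_norm_eq_inner
        by (simp add: inner_diff_left inner_diff_right inner_commute algebra_simps)
      also have "s * s * inner m m = s * inner z m" using False by (simp add: s_def)
      finally have "s * inner z m \<le> 0" by (simp add: power2_norm_eq_inner)
      moreover have "s * inner z m = (inner z m)\<^sup>2 / inner m m"
        by (simp add: s_def power2_eq_square)
      moreover have "0 < inner m m" using False by simp
      ultimately show ?thesis by (simp add: divide_le_0_iff)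
    qed simp
  qed
qed

section \<open>From selfadjointness to m-dissipativity\<close>

lemma selfadjoint_symmetric:
  assumes "selfadjoint D A" "x \<in> D" "y \<in> D"
  shows "cinner (A x) y = cinner x (A y)"
proof -
  have "(y, A y) \<in> adjoint_graph D A" using assms by (simp add: selfadjoint_def)
  then show ?thesis using assms(2) by (simp add: adjoint_graph_def)
qed

lemma selfadjointD:
  assumes "selfadjoint D A" "\<And>x. x \<in> D \<Longrightarrow> cinner (A x) y = cinner x z"
  shows "y \<in> D \<and> A y = z"
proof -
  have "(y, z) \<in> adjoint_graph D A" using assms(2) by (simp add: adjoint_graph_def)
  then show ?thesis using assms(1) by (simp add: selfadjoint_def)
qed

text \<open>The relation defining the adjoint is preserved under limits in the second argument of
  \<open>cinner\<close>, and it characterises the graph of \<open>A\<close>.\<close>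

lemma selfadjoint_closed:
  assumes sa: "selfadjoint D A" and X: "\<And>n. X n \<in> D" and lim: "X \<longlonglongrightarrow> x" "(\<lambda>n. A (X n)) \<longlonglongrightarrow> b"
  shows "x \<in> D \<and> A x = b"
proof (rule selfadjointD[OF sa])
  fix y assume y: "y \<in> D"
  have "(\<lambda>n. cinner (A y) (X n)) \<longlonglongrightarrow> cinner (A y) x" by (rule tendsto_cinner_right[OF lim(1)])
  moreover have "cinner (A y) (X n) = cinner y (A (X n))" for n
    by (rule selfadjoint_symmetric[OF sa y X])
  ultimately show "cinner (A y) x = cinner y b"
    using tendsto_cinner_right[OF lim(2), of y] LIMSEQ_unique by auto
qed

text \<open>
  A vector orthogonal to the range of \<open>1 - \<epsilon> \<i> A\<close> would be an eigenvector of \<open>A\<close>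
  with the nonreal eigenvalue \<open>\<i> / \<epsilon>\<close>.
\<close>

lemma selfadjoint_m_dissipative:
  fixes D :: "'a::{complex_hilbert, second_countable_topology} set"
  assumes sa: "selfadjoint D A"
  shows "m_dissipative D (\<lambda>x. \<i> *\<^sub>C A x)"
proof -
  have op: "operator_on D A" and dense: "closure D = UNIV" using sa by (auto simp: selfadjoint_def)
  have D0: "0 \<in> D" and Dadd: "x \<in> D \<Longrightarrow> y \<in> D \<Longrightarrow> x + y \<in> D"
    and Aadd: "x \<in> D \<Longrightarrow> y \<in> D \<Longrightarrow> A (x + y) = A x + A y"
    and Dscale: "x \<in> D \<Longrightarrow> c *\<^sub>C x \<in> D" and Ascale: "x \<in> D \<Longrightarrow> A (c *\<^sub>C x) = c *\<^sub>C A x" for x y c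
    using op unfolding operator_on_def by blast+
  define B where "B x = \<i> *\<^sub>C A x" for x
  interpret iC: bounded_linear "\<lambda>x :: 'a. \<i> *\<^sub>C x" by (rule bounded_linear_scaleC)
  have DscaleR: "r *\<^sub>R x \<in> D" if "x \<in> D" for r x using Dscale[OF that, of "complex_of_real r"]
    by (simp add: scaleC_of_real)
  have sub: "subspace D" unfolding subspace_def using D0 Dadd DscaleR by auto
  have Badd: "B (x + y) = B x + B y" if "x \<in> D" "y \<in> D" for x y
    using Aadd[OF that] by (simp add: B_def iC.add)
  have BscaleR: "B (r *\<^sub>R x) = r *\<^sub>R B x" if "x \<in> D" for r x
    using Ascale[OF that, of "complex_of_real r"] by (simp add: B_def scaleC_of_real iC.scaleR)
  have BscaleC: "B (\<i> *\<^sub>C x) = \<i> *\<^sub>C B x" if "x \<in> D" for x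
    using Ascale[OF that] by (simp add: B_def)
  \<comment> \<open>Symmetry makes \<open>cinner (A x) x\<close> real, so multiplication by
    \<open>\<i>\<close> leaves no real part.\<close>
  have skew: "inner (B x) x = 0" if x: "x \<in> D" for x
  proof -
    have "cinner (A x) x = cnj (cinner (A x) x)"
      using selfadjoint_symmetric[OF sa x x] cinner_commute[of x "A x"] by simp
    from arg_cong[OF this, of Im] have "Im (cinner (A x) x) = 0" by simp
    then show ?thesis by (simp add: inner_eq_Re_cinner B_def cinner_scaleC_left)
  qed
  have B_A: "A x = - (\<i> *\<^sub>C B x)" for x by (simp add: B_def)
  have range: "\<exists>u\<in>D. u - \<epsilon> *\<^sub>R B u = v" if \<epsilon>: "0 < \<epsilon>" for \<epsilon> v
  proof (rule ccontr)
    define M where "M = (\<lambda>u. u - \<epsilon> *\<^sub>R B u) ` D"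
    assume "\<not> (\<exists>u\<in>D. u - \<epsilon> *\<^sub>R B u = v)"
    then have v: "v \<notin> M" by (auto simp: M_def)
    have subM: "subspace M"
      unfolding subspace_def
    proof (intro conjI ballI allI)
      have "B 0 = 0" using BscaleR[OF D0, of 0] by simp
      then show "0 \<in> M" unfolding M_def by (intro image_eqI[OF _ D0]) simp
      show "x + y \<in> M" if xy: "x \<in> M" "y \<in> M" for x y
      proof -
        obtain a b where ab: "a \<in> D" "x = a - \<epsilon> *\<^sub>R B a" "b \<in> D" "y = b - \<epsilon> *\<^sub>R B b"
          using xy unfolding M_def by blast
        then have "x + y = (a + b) - \<epsilon> *\<^sub>R B (a + b)" by (simp add: Badd scaleR_add_right)
        then show ?thesis unfolding M_def by (rule image_eqI) (intro Dadd ab)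
      qed
      show "c *\<^sub>R x \<in> M" if x: "x \<in> M" for c x
      proof -
        obtain a where a: "a \<in> D" "x = a - \<epsilon> *\<^sub>R B a" using x unfolding M_def by blast
        then have "c *\<^sub>R x = (c *\<^sub>R a) - \<epsilon> *\<^sub>R B (c *\<^sub>R a)" by (simp add: BscaleR scaleR_diff_right)
        then show ?thesis unfolding M_def by (rule image_eqI) (intro DscaleR a)
      qed
    qed
    \<comment> \<open>The cross term drops out because \<open>B\<close> is skew. Being bounded
      below, \<open>1 - \<epsilon> B\<close> pulls Cauchy sequences of values back to Cauchy
      sequences of arguments, which yields a closed range.\<close>
    have below: "norm u \<le> norm (u - \<epsilon> *\<^sub>R B u)" if u: "u \<in> D" for u
    proof -
      have "(norm (u - \<epsilon> *\<^sub>R B u))\<^sup>2 = inner u u + \<epsilon>\<^sup>2 * inner (B u) (B u)"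
        using skew[OF u] unfolding power2_norm_eq_inner
        by (simp add: inner_diff_left inner_diff_right inner_commute power2_eq_square)
      then have "(norm u)\<^sup>2 \<le> (norm (u - \<epsilon> *\<^sub>R B u))\<^sup>2" by (simp add: power2_norm_eq_inner)
      then show ?thesis by (rule power2_le_imp_le) simp
    qed
    have "closed M"
      unfolding closed_sequential_limits
    proof (intro allI impI, elim conjE)
      fix w l assume w: "\<forall>n. w n \<in> M" and lim: "w \<longlonglongrightarrow> l"
      have "\<forall>n. \<exists>a. a \<in> D \<and> w n = a - \<epsilon> *\<^sub>R B a" using w unfolding M_def by blast
      then obtain u where "\<forall>n. u n \<in> D \<and> w n = u n - \<epsilon> *\<^sub>R B (u n)" unfolding choice_iff by blast
      then have u: "\<And>n. u n \<in> D" "\<And>n. w n = u n - \<epsilon> *\<^sub>R B (u n)" by auto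
      have "Cauchy u"
      proof (rule metric_CauchyI)
        fix e :: real assume "0 < e"
        then obtain N where N: "\<forall>m\<ge>N. \<forall>n\<ge>N. dist (w m) (w n) < e"
          using LIMSEQ_imp_Cauchy[OF lim] metric_CauchyD by blast
        have "dist (u m) (u n) \<le> dist (w m) (w n)" for m n
        proof -
          have uD: "u m + (-1) *\<^sub>R u n \<in> D" by (intro Dadd DscaleR u)
          have "B (u m + (-1) *\<^sub>R u n) = B (u m) - B (u n)"
            by (simp only: Badd[OF u(1) DscaleR[OF u(1)]] BscaleR[OF u(1)]) simp
          then have Bd: "B (u m - u n) = B (u m) - B (u n)" by simp
          have "w m - w n = (u m - u n) - \<epsilon> *\<^sub>R B (u m - u n)"
            unfolding Bd u(2) scaleR_diff_right by simp
          then show ?thesis using below[OF uD]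
            by (simp only: dist_norm scaleR_minus_left scaleR_one add_uminus_conv_diff)
        qed
        then show "\<exists>N. \<forall>m\<ge>N. \<forall>n\<ge>N. dist (u m) (u n) < e" using N le_less_trans by blast
      qed
      then obtain u' where u': "u \<longlonglongrightarrow> u'" using Cauchy_convergent convergent_def by blast
      have "(\<lambda>n. (u n - w n) /\<^sub>R \<epsilon>) \<longlonglongrightarrow> (u' - l) /\<^sub>R \<epsilon>" by (intro tendsto_intros u' lim)
      moreover have "(u n - w n) /\<^sub>R \<epsilon> = B (u n)" for n using \<epsilon> by (simp add: u(2))
      ultimately have "(\<lambda>n. B (u n)) \<longlonglongrightarrow> (u' - l) /\<^sub>R \<epsilon>" by simp
      then have "(\<lambda>n. A (u n)) \<longlonglongrightarrow> - (\<i> *\<^sub>C ((u' - l) /\<^sub>R \<epsilon>))"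
        unfolding B_A by (intro tendsto_minus iC.tendsto)
      then have "u' \<in> D" "A u' = - (\<i> *\<^sub>C ((u' - l) /\<^sub>R \<epsilon>))"
        using selfadjoint_closed[OF sa u(1) u'] by auto
      then have "B u' = (u' - l) /\<^sub>R \<epsilon>" by (simp add: B_def iC.neg)
      then have "l = u' - \<epsilon> *\<^sub>R B u'" using \<epsilon> by simp
      then show "l \<in> M" using \<open>u' \<in> D\<close> by (auto simp: M_def)
    qed
    then obtain z where z: "z \<noteq> 0" "\<And>m. m \<in> M \<Longrightarrow> inner z m = 0"
      using closed_subspace_orthogonal[OF subM _ v] by blast
    \<comment> \<open>The factor \<open>1 / (\<i> * complex_of_real \<epsilon>)\<close> is
      conjugated on its way into the second argument of \<open>cinner\<close>.\<close>
    define c where "c = \<i> / complex_of_real \<epsilon>"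
    have "z \<in> D \<and> A z = c *\<^sub>C z"
    proof (rule selfadjointD[OF sa])
      fix u assume u: "u \<in> D"
      define m where "m = u - \<epsilon> *\<^sub>R B u"
      have "m \<in> M" using u by (auto simp: M_def m_def)
      \<comment> \<open>Orthogonality to \<open>M\<close> is so far only real. As \<open>B\<close>
        commutes with \<open>\<i>\<close>, the range is invariant under \<open>\<i>\<close>, and
        testing with \<open>\<i> *\<^sub>C m\<close> removes the imaginary part of the complex inner
        product as well.\<close>
      moreover have "\<i> *\<^sub>C m \<in> M"
      proof -
        have "\<i> *\<^sub>C m = \<i> *\<^sub>C u - \<epsilon> *\<^sub>R B (\<i> *\<^sub>C u)"
          using BscaleC[OF u] by (simp add: m_def iC.diff iC.scaleR)
        then show ?thesis using Dscale[OF u] by (auto simp: M_def)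
      qed
      ultimately have "cinner z m = 0" using z(2) by (simp add: complex_eq_iff Re_cinner Im_cinner)
      then have zm: "cinner m z = 0" using cinner_commute[of m z] by simp
      have "u = m + (\<epsilon> *\<^sub>R B u)" by (simp add: m_def)
      also have "\<epsilon> *\<^sub>R B u = (\<i> * complex_of_real \<epsilon>) *\<^sub>C A u"
        unfolding B_def by (simp add: scaleC_of_real[symmetric] scaleC_scaleC mult.commute)
      finally have "cinner u z = cinner (m + (\<i> * complex_of_real \<epsilon>) *\<^sub>C A u) z" by simp
      also have "\<dots> = (\<i> * complex_of_real \<epsilon>) * cinner (A u) z"
        by (simp add: cinner_add_left zm cinner_scaleC_left)
      finally have "cinner u z = (\<i> * complex_of_real \<epsilon>) * cinner (A u) z" .
      then show "cinner (A u) z = cinner u (c *\<^sub>C z)"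
        using \<epsilon> by (simp add: cinner_scaleC_right c_def)
    qed
    then have "z \<in> D" and Az: "A z = c *\<^sub>C z" by auto
    have "cinner (A z) z = cinner z (A z)" by (rule selfadjoint_symmetric[OF sa \<open>z \<in> D\<close> \<open>z \<in> D\<close>])
    then have "c * cinner z z = cnj c * cinner z z"
      by (simp add: Az cinner_scaleC_left cinner_scaleC_right)
    moreover have "cinner z z \<noteq> 0" using z(1) by (simp add: cinner_self)
    ultimately have "c = cnj c" by simp
    then show False using \<epsilon> by (simp add: c_def complex_eq_iff)
  qed
  show ?thesis
    unfolding m_dissipative_def
    using sub Badd BscaleR dense skew range unfolding B_def by simp
qed

section \<open>Growth of the Gamma function and the Mittag-Leffler series\<close>

lemma Gamma_ge_power:
  assumes s: "0 \<le> s" and N: "0 \<le> N"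
  shows "N powr s * exp (- (N + 1)) \<le> Gamma (s + 1 :: real)"
proof -
  have G: "((\<lambda>t. t powr s / exp t) has_integral Gamma (s + 1)) {0..}"
    using Gamma_integral_real[of "s + 1"] s by simp
  \<comment> \<open>Of the Gamma integral only the stretch \<open>{N..N+1}\<close> is kept. Since
    \<open>N\<close> is free, the bound beats every geometric growth in \<open>s\<close>.\<close>
  have "((\<lambda>t. if t \<in> {N..N+1} then N powr s * exp (- (N + 1)) else 0) has_integral (N powr s * exp
    (- (N + 1)))) {0..}"
  proof -
    have "((\<lambda>t. N powr s * exp (- (N + 1))) has_integral (N powr s * exp (- (N + 1)))) {N..N + 1}"
      using has_integral_const_real[of "N powr s * exp (- (N + 1))" N "N + 1"] by simp
    then show ?thesis using N by (subst has_integral_restrict) auto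
  qed
  then show ?thesis
  proof (rule has_integral_le[OF _ G])
    fix t :: real assume t: "t \<in> {0..}"
    show "(if t \<in> {N..N+1} then N powr s * exp (- (N + 1)) else 0) \<le> t powr s / exp t"
    proof (cases "t \<in> {N..N+1}")
      case True
      have "N powr s * exp (- (N + 1)) \<le> t powr s * exp (- t)"
        using True N s by (intro mult_mono powr_mono2) auto
      then show ?thesis using True by (simp add: exp_minus divide_inverse)
    qed auto
  qed
qed

text \<open>The term of index \<open>0\<close> is \<open>1\<close> and the others are nonnegative.
  What has to be shown is summability, without which \<open>suminf\<close> carries no
  information.\<close>

lemma mittag_leffler_ge_1:
  fixes z :: real
  assumes \<alpha>: "0 < \<alpha>" and z: "0 \<le> z"
  shows "1 \<le> mittag_leffler \<alpha> 1 z"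
proof -
  let ?f = "\<lambda>k. z ^ k / of_real (Gamma (\<alpha> * real k + 1))"
  \<comment> \<open>Then \<open>N powr (\<alpha> * real k)\<close> is
    \<open>(2 * z + 1) ^ k\<close>, and the series is dominated by a geometric one of ratio
    \<open>z / (2 * z + 1) < 1\<close>.\<close>
  define N where "N = (2 * z + 1) powr (1 / \<alpha>)"
  have N: "0 < N" using z by (simp add: N_def)
  have G: "0 < Gamma (\<alpha> * real k + 1)" for k using \<alpha>
    by (intro Gamma_real_pos) (simp add: add_nonneg_pos)
  have f0: "0 \<le> ?f k" for k using z G[of k] by simp
  have bound: "?f k \<le> exp (N + 1) * (z / (2 * z + 1)) ^ k" for k
  proof -
    have "(2 * z + 1) ^ k = (2 * z + 1) powr real k" using z by (intro powr_realpow[symmetric]) simp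
    also have "\<dots> = N powr (\<alpha> * real k)" using \<alpha> by (simp add: N_def powr_powr)
    finally have "(2 * z + 1) ^ k * exp (- (N + 1)) \<le> Gamma (\<alpha> * real k + 1)"
      using Gamma_ge_power[of "\<alpha> * real k" N] \<alpha> N by simp
    then have "?f k \<le> z ^ k / ((2 * z + 1) ^ k * exp (- (N + 1)))"
      using z mult_pos_pos[OF G[of k], of "(2 * z + 1) ^ k * exp (- (N + 1))"]
      by (simp only: of_real_eq_id id_apply) (intro divide_left_mono, simp_all)
    also have "\<dots> = exp (N + 1) * (z / (2 * z + 1)) ^ k"
      by (simp add: power_divide exp_minus[of "N + 1"] divide_inverse mult_ac power_mult_distrib
        power_inverse del: minus_add_distrib)
    finally show ?thesis .
  qed
  have "summable ?f"
  proof (rule summable_comparison_test')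
    show "summable (\<lambda>k. exp (N + 1) * (z / (2 * z + 1)) ^ k)"
      using z by (intro summable_mult summable_geometric) (simp add: field_simps)
    show "norm (?f k) \<le> exp (N + 1) * (z / (2 * z + 1)) ^ k" if "0 \<le> k" for k
      using bound[of k] f0[of k] by (metis abs_of_nonneg real_norm_def)
  qed
  then have "sum ?f {0} \<le> suminf ?f" by (rule sum_le_suminf) (use f0 in auto)
  then show ?thesis by (simp add: mittag_leffler_def)
qed

section \<open>The nonlinear problem\<close>

lemma graph_norm_nonneg: "0 \<le> graph_norm A x"
  by (simp add: graph_norm_def)

lemma operator_onD:
  assumes "operator_on D A"
  shows "0 \<in> D" "x \<in> D \<Longrightarrow> y \<in> D \<Longrightarrow> x + y \<in> D" "x \<in> D \<Longrightarrow> y \<in> D \<Longrightarrow> A (x + y) = A x + A y"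
    "x \<in> D \<Longrightarrow> c *\<^sub>C x \<in> D" "x \<in> D \<Longrightarrow> A (c *\<^sub>C x) = c *\<^sub>C A x"
  using assms by (simp_all add: operator_on_def)

lemma operator_on_scaleR:
  assumes "operator_on D A" "x \<in> D"
  shows "r *\<^sub>R x \<in> D" "A (r *\<^sub>R x) = r *\<^sub>R A x"
  using operator_onD(4,5)[OF assms, of "complex_of_real r"] by (simp_all add: scaleC_of_real)

lemma operator_on_diff:
  assumes "operator_on D A" "x \<in> D" "y \<in> D"
  shows "x - y \<in> D" "A (x - y) = A x - A y"
  using operator_onD(2,3)[OF assms(1,2) operator_on_scaleR(1)[OF assms(1,3), of "- 1"]]
    operator_on_scaleR(2)[OF assms(1,3), of "- 1"] by simp_all

section \<open>The Lipschitz assumption on balls of the graph norm\<close>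

lemma AE_lebesgue_on_interval_ex:
  assumes ae: "AE t in lebesgue_on S. P t" and S: "S \<in> sets lebesgue" and sub: "{a<..<b} \<subseteq> S"
    and ab: "a < (b :: real)"
  shows "\<exists>t\<in>{a<..<b}. P t"
proof (rule ccontr)
  assume none: "\<not> (\<exists>t\<in>{a<..<b}. P t)"
  have "AE t in lebesgue. t \<in> S \<longrightarrow> P t"
    using ae S by (subst (asm) AE_restrict_space_iff) auto
  then have "AE t in lebesgue. t \<notin> {a<..<b}"
    by eventually_elim (use none sub in blast)
  then have "{a<..<b} \<in> null_sets lebesgue"
    by (subst AE_iff_null_sets) auto
  then have "negligible {a<..<b}" by (simp add: negligible_iff_null_sets)
  then show False using open_not_negligible[of "{a<..<b}"] ab by simp
qed

text \<open>The value \<open>e\<close> fills a set of positive measure and attains the bound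
  \<open>R\<close>, so the essential supremum does not depend on \<open>a\<close>. Times
  \<open>t \<le> 0\<close> lie outside the interval, which leaves the initial value \<open>c\<close>
  free.\<close>

lemma Linf_norm_two_step:
  fixes A :: "'a::{real_normed_vector, second_countable_topology} \<Rightarrow> 'a"
  assumes a: "graph_norm A a \<le> R" and e: "graph_norm A e = R"
  shows "Linf_norm A {0<..<2} (\<lambda>t. if t \<le> 0 then c else if t < 1 then a else e) = ereal R"
proof (rule antisym)
  let ?u = "\<lambda>t :: real. if t \<le> 0 then c else if t < 1 then a else e"
  let ?M = "lebesgue_on {0<..<2 :: real}"
  have "(\<lambda>t. ereal (graph_norm A (?u t))) = (\<lambda>t. if t \<le> 0 then ereal (graph_norm A c) else
    if t < 1 then ereal (graph_norm A a) else ereal (graph_norm A e))"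
    by auto
  also have "\<dots> \<in> borel_measurable borel" by measurable
  finally have "(\<lambda>t. ereal (graph_norm A (?u t))) \<in> borel_measurable lborel" by simp
  then have m: "(\<lambda>t. ereal (graph_norm A (?u t))) \<in> borel_measurable ?M"
    by (intro measurable_restrict_space1 measurable_completion)
  show "Linf_norm A {0<..<2} ?u \<le> ereal R"
    unfolding Linf_norm_def
  proof (rule esssup_I[OF m])
    show "AE t in ?M. ereal (graph_norm A (?u t)) \<le> ereal R"
      by (intro AE_I2) (use a e in auto)
  qed
  have "\<exists>t\<in>{1<..<2}. ereal (graph_norm A (?u t)) \<le> Linf_norm A {0<..<2} ?u"
    unfolding Linf_norm_def by (rule AE_lebesgue_on_interval_ex[OF esssup_AE]) auto
  then show "ereal R \<le> Linf_norm A {0<..<2} ?u" using e by auto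
qed

text \<open>
  The assumption is applied to step functions on \<open>]0, 2[\<close> whose value at \<open>0\<close> is \<open>0\<close>, so that
  \<open>\<rho>\<close> does not enter the constant. A fixed vector of graph norm \<open>R\<close> on the second half of the
  interval makes the essential bounds equal to \<open>R\<close>, hence the constant uniform on the ball.
\<close>

lemma lipschitz_nonlinearity_on_balls:
  fixes A F :: "'a::{complex_hilbert, second_countable_topology} \<Rightarrow> 'a"
  assumes op: "operator_on D A" and \<rho>: "extended_norm_on D \<rho>" and F: "lipschitz_nonlinearity D A \<rho>
    F"
  obtains K :: "real \<Rightarrow> real" where "\<And>R. 0 \<le> K R"
    "\<And>R a b. a \<in> D \<Longrightarrow> b \<in> D \<Longrightarrow> graph_norm A a \<le> R \<Longrightarrow> graph_norm A b \<le> R \<Longrightarrow>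
      graph_norm A (F a - F b) \<le> K R * graph_norm A (a - b)"
proof -
  obtain L :: "ennreal \<Rightarrow> ennreal \<Rightarrow> ereal \<Rightarrow> ereal \<Rightarrow> real" where L:
    "\<And>I u v. is_interval I \<Longrightarrow> I \<subseteq> {0..} \<Longrightarrow> (\<forall>t\<ge>0. u t \<in> D \<and> v t \<in> D) \<Longrightarrow>
          \<rho> (u 0) < \<infinity> \<Longrightarrow> \<rho> (v 0) < \<infinity> \<Longrightarrow> Linf_norm A I u < \<infinity> \<Longrightarrow> Linf_norm A I v < \<infinity> \<Longrightarrow>
          (AE t in lebesgue_on I. graph_norm A (F (u t) - F (v t))
               \<le> L (\<rho> (u 0)) (\<rho> (v 0)) (Linf_norm A I u) (Linf_norm A I v) * graph_norm A (u t
                 - v t))"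
    using F unfolding lipschitz_nonlinearity_def by blast
  have F0: "F 0 = 0" using F by (simp add: lipschitz_nonlinearity_def)
  have \<rho>0: "\<rho> 0 = 0" using \<rho> operator_onD(1)[OF op] by (simp add: extended_norm_on_def)
  \<comment> \<open>The two zeros are the value of \<rho> at the common initial value
    \<open>0\<close>; the absolute value only secures the sign.\<close>
  define K where "K R = \<bar>L 0 0 (ereal R) (ereal R)\<bar>" for R
  show ?thesis
  proof (rule that)
    show "0 \<le> K R" for R by (simp add: K_def)
    fix R a b assume ab: "a \<in> D" "b \<in> D" "graph_norm A a \<le> R" "graph_norm A b \<le> R"
    show "graph_norm A (F a - F b) \<le> K R * graph_norm A (a - b)"
    \<comment> \<open>In the trivial domain there is no vector of graph norm \<open>R > 0\<close> to
      fill the second half of the interval.\<close>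
    proof (cases "D = {0}")
      case True
      then have "a = 0" "b = 0" using ab by auto
      moreover have "A 0 = 0" using operator_on_diff(2)[OF op ab(1,1)] by simp
      ultimately show ?thesis by (simp add: graph_norm_def)
    next
      case False
      then obtain y where y: "y \<in> D" "y \<noteq> 0" using operator_onD(1)[OF op] by auto
      have gy: "0 < graph_norm A y" using y by (simp add: graph_norm_def add_pos_nonneg)
      define e where "e = (R / graph_norm A y) *\<^sub>R y"
      have R: "0 \<le> R" using ab(3) graph_norm_nonneg order_trans by blast
      have eD: "e \<in> D" using operator_on_scaleR[OF op y(1)] by (simp add: e_def)
      have "graph_norm A e = \<bar>R / graph_norm A y\<bar> * graph_norm A y"
        using operator_on_scaleR(2)[OF op y(1)] by (simp add: e_def graph_norm_def distrib_left)
      then have e: "graph_norm A e = R" using gy R by simp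
      let ?u = "\<lambda>t :: real. if t \<le> 0 then 0 else if t < 1 then a else e"
      let ?v = "\<lambda>t :: real. if t \<le> 0 then 0 else if t < 1 then b else e"
      have Lu: "Linf_norm A {0<..<2} ?u = ereal R" and Lv: "Linf_norm A {0<..<2} ?v = ereal R"
        using Linf_norm_two_step[OF ab(3) e] Linf_norm_two_step[OF ab(4) e] by auto
      have "AE t in lebesgue_on {0<..<2}. graph_norm A (F (?u t) - F (?v t))
         \<le> L (\<rho> (?u 0)) (\<rho> (?v 0)) (Linf_norm A {0<..<2} ?u) (Linf_norm A {0<..<2} ?v) * graph_norm
           A (?u t - ?v t)"
        by (rule L) (use ab eD \<rho>0 operator_onD(1)[OF op] Lu Lv in \<open>auto simp: is_interval_convex_1\<close>)
      then have "\<exists>t\<in>{0<..<1}. graph_norm A (F (?u t) - F (?v t))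
         \<le> L (\<rho> (?u 0)) (\<rho> (?v 0)) (Linf_norm A {0<..<2} ?u) (Linf_norm A {0<..<2} ?v) * graph_norm
           A (?u t - ?v t)"
        by (rule AE_lebesgue_on_interval_ex) auto
      then have "graph_norm A (F a - F b) \<le> L 0 0 (ereal R) (ereal R) * graph_norm A (a - b)"
        unfolding Lu Lv using \<rho>0 by auto
      also have "\<dots> \<le> K R * graph_norm A (a - b)"
        by (intro mult_right_mono graph_norm_nonneg) (simp add: K_def)
      finally show ?thesis .
    qed
  qed
qed

section \<open>Continuous functions with values in the domain\<close>

lemma continuous_graph_iff:
  assumes op: "operator_on D A"
  shows "continuous_graph D A S u \<longleftrightarrow>
    (\<forall>t\<in>S. u t \<in> D) \<and> continuous_on S u \<and> continuous_on S (\<lambda>t. A (u t))"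
proof (cases "\<forall>t\<in>S. u t \<in> D")
  case D: True
  have ev: "\<forall>\<^sub>F s in at t within S. s \<in> S" for t by (simp add: eventually_at_filter)
  have "((\<lambda>s. graph_norm A (u s - u t)) \<longlongrightarrow> 0) (at t within S) \<longleftrightarrow>
      (u \<longlongrightarrow> u t) (at t within S) \<and> ((\<lambda>s. A (u s)) \<longlongrightarrow> A (u t)) (at t within S)"
    if t: "t \<in> S" for t
  proof
    assume lim: "((\<lambda>s. graph_norm A (u s - u t)) \<longlongrightarrow> 0) (at t within S)"
    have "((\<lambda>s. u s - u t) \<longlongrightarrow> 0) (at t within S)"
      by (rule Lim_null_comparison[OF _ lim]) (simp add: graph_norm_def)
    moreover have "((\<lambda>s. A (u s) - A (u t)) \<longlongrightarrow> 0) (at t within S)"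
    proof (rule Lim_null_comparison[OF _ lim])
      show "\<forall>\<^sub>F s in at t within S. norm (A (u s) - A (u t)) \<le> graph_norm A (u s - u t)"
        using ev by eventually_elim (use D t operator_on_diff(2)[OF op]
          in \<open>simp add: graph_norm_def\<close>)
    qed
    ultimately show "(u \<longlongrightarrow> u t) (at t within S) \<and> ((\<lambda>s. A (u s)) \<longlongrightarrow> A (u t)) (at t within S)"
      using Lim_null by blast
  next
    assume lim: "(u \<longlongrightarrow> u t) (at t within S) \<and> ((\<lambda>s. A (u s)) \<longlongrightarrow> A (u t)) (at t within S)"
    have "((\<lambda>s. norm (u s - u t) + norm (A (u s) - A (u t))) \<longlongrightarrow> norm (u t - u t) + norm (A (u t)
      - A (u t))) (at t within S)"
      using lim by (intro tendsto_intros) auto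
    then have "((\<lambda>s. norm (u s - u t) + norm (A (u s) - A (u t))) \<longlongrightarrow> 0) (at t within S)" by simp
    moreover have "\<forall>\<^sub>F s in at t within S. norm (u s - u t) + norm (A (u s) - A (u t))
      = graph_norm A (u s - u t)"
      using ev by eventually_elim (use D t operator_on_diff(2)[OF op] in \<open>simp add: graph_norm_def\<close>)
    ultimately show "((\<lambda>s. graph_norm A (u s - u t)) \<longlongrightarrow> 0) (at t within S)"
      by (rule Lim_transform_eventually)
  qed
  then show ?thesis using D unfolding continuous_graph_def continuous_on_def by blast
qed (auto simp: continuous_graph_def)

text \<open>By continuity, a value above the essential supremum would force such values on a whole
  subinterval of \<open>{0<..<T}\<close>, also when it occurs at an endpoint. The supremum is
  finite, so \<open>real_of_ereal\<close> loses nothing.\<close>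

lemma graph_norm_le_Linf_norm:
  assumes op: "operator_on D A" and u: "continuous_graph D A {0..T} u" and T: "0 < T"
    and t: "t \<in> {0..T}"
  shows "graph_norm A (u t) \<le> real_of_ereal (Linf_norm A {0<..<T} u)"
proof -
  define g where "g t = graph_norm A (u t)" for t
  have g: "continuous_on {0..T} g"
    using u unfolding continuous_graph_iff[OF op] g_def graph_norm_def
      by (intro continuous_intros) auto
  define N where "N = Linf_norm A {0<..<T} u"
  have ae: "AE t in lebesgue_on {0<..<T}. ereal (g t) \<le> N"
    unfolding N_def Linf_norm_def g_def by (rule esssup_AE)
  obtain M where M: "0 \<le> M" "\<And>s. s \<in> {0..T} \<Longrightarrow> norm (g s) \<le> M"
    using continuous_on_Icc_norm_bound[OF g] by blast
  have "N \<le> ereal M"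
    unfolding N_def Linf_norm_def g_def[symmetric]
  proof (rule esssup_I)
    have "continuous_on {0<..<T} g" using g by (rule continuous_on_subset) auto
    then have "g \<in> borel_measurable (lebesgue_on {0<..<T})"
      by (intro continuous_imp_measurable_on_sets_lebesgue) auto
    then show "(\<lambda>t. ereal (g t)) \<in> borel_measurable (lebesgue_on {0<..<T})" by measurable
    show "AE t in lebesgue_on {0<..<T}. ereal (g t) \<le> ereal M"
    proof (intro AE_I2)
      fix t assume "t \<in> space (lebesgue_on {0<..<T})"
      then have "t \<in> {0..T}" by auto
      then have "\<bar>g t\<bar> \<le> M" using M(2) by simp
      then show "ereal (g t) \<le> ereal M" by simp
    qed
  qed
  moreover have "ereal 0 \<le> N"
  proof -
    obtain s where "ereal (g s) \<le> N" using AE_lebesgue_on_interval_ex[OF ae _ _ T] by auto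
    moreover have "0 \<le> g s" by (simp add: g_def graph_norm_nonneg)
    ultimately show ?thesis using order_trans ereal_less_eq(3) by blast
  qed
  ultimately obtain n where n: "N = ereal n" by (cases N) auto
  have "g t \<le> n"
  proof (rule ccontr)
    assume "\<not> g t \<le> n"
    then have "0 < g t - n" by simp
    then obtain d where d: "0 < d" "\<And>s. s \<in> {0..T} \<Longrightarrow> dist s t < d \<Longrightarrow> dist (g s) (g t) < g t - n"
      using g t unfolding continuous_on_iff by metis
    have "\<exists>s\<in>{max 0 (t - d)<..<min T (t + d)}. ereal (g s) \<le> N"
      by (rule AE_lebesgue_on_interval_ex[OF ae]) (use t T d(1) in auto)
    then obtain s where s: "s \<in> {max 0 (t - d)<..<min T (t + d)}" "g s \<le> n" by (auto simp: n)
    have "dist (g s) (g t) < g t - n" using s by (intro d(2)) (auto simp: dist_real_def)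
    then show False using s(2) by (simp add: dist_real_def)
  qed
  then show ?thesis by (simp add: g_def n flip: N_def)
qed

lemma scaleC_minus_right: "a *\<^sub>C (- x) = - (a *\<^sub>C x)" for x :: "'a::complex_hilbert"
  by (rule linear_neg[OF bounded_linear.linear[OF bounded_linear_scaleC]])

lemma scaleC_diff_right: "a *\<^sub>C (x - y) = a *\<^sub>C x - a *\<^sub>C y" for x :: "'a::complex_hilbert"
  by (rule linear_diff[OF bounded_linear.linear[OF bounded_linear_scaleC]])

section \<open>The semilinear problem in Volterra form\<close>

locale semilinear_problem =
  fixes \<alpha> :: real and D :: "'a::{complex_hilbert, second_countable_topology} set"
    and A F :: "'a \<Rightarrow> 'a" and K :: "real \<Rightarrow> real"
  assumes \<alpha>: "0 < \<alpha>" "\<alpha> < 1" and selfadjoint: "selfadjoint D A"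
    and F_D: "x \<in> D \<Longrightarrow> F x \<in> D" and F_0: "F 0 = 0" and K_nonneg: "0 \<le> K R"
    and F_lipschitz: "a \<in> D \<Longrightarrow> b \<in> D \<Longrightarrow> graph_norm A a \<le> R \<Longrightarrow> graph_norm A b \<le> R \<Longrightarrow>
      graph_norm A (F a - F b) \<le> K R * graph_norm A (a - b)"
begin

lemma op: "operator_on D A"
  using selfadjoint by (simp add: selfadjoint_def)

sublocale m_dissipative D "\<lambda>x. \<i> *\<^sub>C A x"
  by (rule selfadjoint_m_dissipative[OF selfadjoint])

lemma norm_iA: "norm (\<i> *\<^sub>C A x) = norm (A x)"
  by (simp add: norm_scaleC)

lemma graph_norm_i: "x \<in> D \<Longrightarrow> graph_norm A (\<i> *\<^sub>C x) = graph_norm A x"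
  by (simp add: graph_norm_def operator_onD(5)[OF op] norm_scaleC)

lemma A_diff: "x \<in> D \<Longrightarrow> y \<in> D \<Longrightarrow> A (x - y) = A x - A y"
  by (rule operator_on_diff(2)[OF op])

lemma continuous_on_iC: "continuous_on S u \<Longrightarrow> continuous_on S (\<lambda>t. \<i> *\<^sub>C (u t :: 'a))"
  by (rule bounded_linear.continuous_on[OF bounded_linear_scaleC])

lemma continuous_on_iA: "continuous_on S (\<lambda>t. \<i> *\<^sub>C A (u t)) \<longleftrightarrow> continuous_on S (\<lambda>t. A (u t))"
  using continuous_on_iC[of S "\<lambda>t. A (u t)"]
    continuous_on_minus[OF continuous_on_iC[of S "\<lambda>t. \<i> *\<^sub>C A (u t)"]] by auto

definition volterra_solution :: "real \<Rightarrow> 'a \<Rightarrow> (real \<Rightarrow> 'a) \<Rightarrow> (real \<Rightarrow> 'a) \<Rightarrow> bool" where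
  "volterra_solution T x f u \<longleftrightarrow>
     x \<in> D \<and> continuous_graph D A {0..T} u \<and> continuous_graph D A {0..T} f \<and>
     (\<forall>t\<in>{0..T}. u t = x + frac_int \<alpha> (\<lambda>s. \<i> *\<^sub>C A (u s) + f s) t)"

lemma volterra_solutionD:
  assumes "volterra_solution T x f u"
  shows "x \<in> D" "t \<in> {0..T} \<Longrightarrow> u t \<in> D" "t \<in> {0..T} \<Longrightarrow> f t \<in> D"
    "continuous_on {0..T} u" "continuous_on {0..T} (\<lambda>t. A (u t))"
    "continuous_on {0..T} f" "continuous_on {0..T} (\<lambda>t. A (f t))"
    "t \<in> {0..T} \<Longrightarrow> u t = x + frac_int \<alpha> (\<lambda>s. \<i> *\<^sub>C A (u s) + f s) t"
  using assms by (auto simp: volterra_solution_def continuous_graph_iff[OF op])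

lemma continuous_on_graph_norm:
  "continuous_graph D A S u \<Longrightarrow> continuous_on S (\<lambda>t. graph_norm A (u t))"
  unfolding continuous_graph_iff[OF op] graph_norm_def by (intro continuous_intros) auto

lemma continuous_graph_diff:
  assumes "continuous_graph D A S u" "continuous_graph D A S v"
  shows "continuous_graph D A S (\<lambda>t. u t - v t)"
proof -
  have "continuous_on S (\<lambda>t. A (u t) - A (v t))"
    using assms by (intro continuous_intros) (auto simp: continuous_graph_iff[OF op])
  then have "continuous_on S (\<lambda>t. A (u t - v t))"
    by (rule continuous_on_eq) (use assms in \<open>auto simp: continuous_graph_iff[OF op] A_diff\<close>)
  then show ?thesis
    using assms unfolding continuous_graph_iff[OF op]
    by (auto intro: continuous_on_diff operator_on_diff(1)[OF op])
qed

lemma volterra_solution_diff: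
  assumes u: "volterra_solution T x f u" and v: "volterra_solution T y g v"
  shows "volterra_solution T (x - y) (\<lambda>t. f t - g t) (\<lambda>t. u t - v t)"
proof -
  note U = volterra_solutionD[OF u] and V = volterra_solutionD[OF v]
  have "u t - v t = (x - y) + frac_int \<alpha> (\<lambda>s. \<i> *\<^sub>C A (u s - v s) + (f s - g s)) t"
    if t: "t \<in> {0..T}" for t
  proof -
    have "u t - v t = (x - y) + (frac_int \<alpha> (\<lambda>s. \<i> *\<^sub>C A (u s) + f s) t - frac_int \<alpha>
      (\<lambda>s. \<i> *\<^sub>C A (v s) + g s) t)"
      using U(8)[OF t] V(8)[OF t] by (metis add_diff_add)
    also have "frac_int \<alpha> (\<lambda>s. \<i> *\<^sub>C A (u s) + f s) t - frac_int \<alpha> (\<lambda>s. \<i> *\<^sub>C A (v s) + g s) t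
      = frac_int \<alpha> (\<lambda>s. (\<i> *\<^sub>C A (u s) + f s) - (\<i> *\<^sub>C A (v s) + g s)) t"
      using t by (intro frac_int_diff[symmetric, of \<alpha> T] \<alpha> continuous_on_add continuous_on_iC U V)
        auto
    also have "\<dots> = frac_int \<alpha> (\<lambda>s. \<i> *\<^sub>C A (u s - v s) + (f s - g s)) t"
      by (rule frac_int_cong) (use t U(2) V(2) in \<open>simp add: B_diff\<close>)
    finally show ?thesis .
  qed
  then show ?thesis
    using u v unfolding volterra_solution_def
    by (auto intro: continuous_graph_diff operator_on_diff(1)[OF op])
qed

lemma volterra_solution_bound:
  assumes u: "volterra_solution T x f u" and t: "t \<in> {0..T}"
  shows "graph_norm A (u t) \<le> graph_norm A x + frac_int \<alpha> (\<lambda>s. graph_norm A (f s)) t"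
proof -
  note U = volterra_solutionD[OF u]
  have T: "0 \<le> T" using t by simp
  have iAf: "continuous_on {0..T} (\<lambda>t. \<i> *\<^sub>C A (f t))" by (intro continuous_on_iC U)
  note bounds = linear_problem_bounds[OF \<alpha> T U(2,1,3,4) continuous_on_iC[OF U(5)] U(6) iAf U(8) t]
  have "graph_norm A (u t) \<le> (norm x + frac_int \<alpha> (\<lambda>s. norm (f s)) t) + (norm (A x) + frac_int \<alpha>
    (\<lambda>s. norm (A (f s))) t)"
    unfolding graph_norm_def using bounds by (simp add: norm_iA add_mono)
  also have "\<dots> = graph_norm A x + frac_int \<alpha> (\<lambda>s. graph_norm A (f s)) t"
    unfolding graph_norm_def using t
    by (subst frac_int_add[of \<alpha> T]) (auto intro!: \<alpha> continuous_on_norm U)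
  finally show ?thesis .
qed

lemma volterra_solution_exists:
  assumes T: "0 \<le> T" and x: "x \<in> D" and f: "continuous_graph D A {0..T} f"
  shows "\<exists>u. volterra_solution T x f u"
proof -
  have f': "\<And>t. t \<in> {0..T} \<Longrightarrow> f t \<in> D" "continuous_on {0..T} f" "continuous_on {0..T}
    (\<lambda>t. \<i> *\<^sub>C A (f t))"
    using f by (auto simp: continuous_graph_iff[OF op] intro: continuous_on_iC)
  obtain u where u: "\<And>t. t \<in> {0..T} \<Longrightarrow> u t \<in> D" "continuous_on {0..T} u" "continuous_on {0..T}
    (\<lambda>t. \<i> *\<^sub>C A (u t))"
    "\<And>t. t \<in> {0..T} \<Longrightarrow> u t = x + frac_int \<alpha> (\<lambda>s. \<i> *\<^sub>C A (u s) + f s) t"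
    using linear_problem_solvable[OF \<alpha> T x f'] by blast
  have "continuous_graph D A {0..T} u" using u
    by (simp add: continuous_graph_iff[OF op] continuous_on_iA)
  then have "volterra_solution T x f u" unfolding volterra_solution_def using x f u(4) by blast
  then show ?thesis by blast
qed

lemma continuous_graph_F:
  assumes u: "continuous_graph D A {0..T} u"
  shows "continuous_graph D A {0..T} (\<lambda>t. F (u t))"
  unfolding continuous_graph_def
proof (intro conjI ballI)
  have D: "u s \<in> D" if "s \<in> {0..T}" for s using u that by (simp add: continuous_graph_def)
  show "F (u t) \<in> D" if "t \<in> {0..T}" for t by (rule F_D[OF D[OF that]])
  obtain R where R: "0 \<le> R" "\<And>s. s \<in> {0..T} \<Longrightarrow> norm (graph_norm A (u s)) \<le> R"
    using continuous_on_Icc_norm_bound[OF continuous_on_graph_norm[OF u]] by blast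
  fix t assume t: "t \<in> {0..T}"
  have "((\<lambda>s. K R * graph_norm A (u s - u t)) \<longlongrightarrow> K R * 0) (at t within {0..T})"
    using u t by (intro tendsto_intros) (auto simp: continuous_graph_def)
  then have lim: "((\<lambda>s. K R * graph_norm A (u s - u t)) \<longlongrightarrow> 0) (at t within {0..T})" by simp
  have "\<forall>\<^sub>F s in at t within {0..T}. s \<in> {0..T}" by (simp add: eventually_at_filter)
  then have "\<forall>\<^sub>F s in at t within {0..T}. norm (graph_norm A (F (u s) - F (u t)))
    \<le> K R * graph_norm A (u s - u t)"
  proof eventually_elim
    case (elim s)
    have "graph_norm A (F (u s) - F (u t)) \<le> K R * graph_norm A (u s - u t)"
      using R(2)[OF t] R(2)[OF elim] by (intro F_lipschitz D elim t) auto
    then show ?case by (simp add: graph_norm_nonneg)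
  qed
  then show "((\<lambda>s. graph_norm A (F (u s) - F (u t))) \<longlongrightarrow> 0) (at t within {0..T})"
    by (rule Lim_null_comparison[OF _ lim])
qed

lemma continuous_graph_i:
  assumes "continuous_graph D A S u"
  shows "continuous_graph D A S (\<lambda>t. \<i> *\<^sub>C u t)"
proof -
  have "continuous_on S (\<lambda>t. A (\<i> *\<^sub>C u t)) \<longleftrightarrow> continuous_on S (\<lambda>t. \<i> *\<^sub>C A (u t))"
    by (rule continuous_on_cong) (use assms operator_onD(5)[OF op]
      in \<open>auto simp: continuous_graph_def\<close>)
  then show ?thesis
    using assms operator_onD(4)[OF op]
      by (auto simp: continuous_graph_iff[OF op] intro: continuous_on_iC)
qed

lemma strict_solution_imp_volterra:
  assumes T: "0 < T" and u: "strict_solution \<alpha> D A F T x u"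
  shows "volterra_solution T x (\<lambda>t. \<i> *\<^sub>C F (u t)) u"
proof -
  have cg: "continuous_graph D A {0..T} u" and diff: "RL_differentiable \<alpha> T (\<lambda>t. u t - u 0)"
    and cont: "continuous_on {0..T} (RL_deriv \<alpha> T (\<lambda>t. u t - u 0))" and u0: "u 0 = x"
    and eq: "\<And>t. t \<in> {0<..T} \<Longrightarrow> \<i> *\<^sub>C caputo_deriv \<alpha> T u t + A (u t) + F (u t) = 0"
    using u by (auto simp: strict_solution_def)
  have iF: "continuous_graph D A {0..T} (\<lambda>t. \<i> *\<^sub>C F (u t))"
    by (intro continuous_graph_i continuous_graph_F cg)
  define q where "q t = \<i> *\<^sub>C A (u t) + \<i> *\<^sub>C F (u t)" for t
  define r where "r = RL_deriv \<alpha> T (\<lambda>t. u t - x)"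
  have q: "continuous_on {0..T} q"
  proof -
    have "continuous_on {0..T} (\<lambda>t. A (u t))" "continuous_on {0..T} (\<lambda>t. \<i> *\<^sub>C F (u t))"
      using cg iF by (auto simp: continuous_graph_iff[OF op])
    then show ?thesis unfolding q_def by (rule continuous_on_add[OF continuous_on_iC])
  qed
  have r: "continuous_on {0..T} r" using cont u0 by (simp add: r_def)
  have rq: "r t - q t = 0" if "t \<in> {0<..T}" for t
  proof -
    have "\<i> *\<^sub>C r t + (A (u t) + F (u t)) = 0"
      using eq[OF that] u0 by (simp add: caputo_deriv_def r_def add.assoc)
    then have "\<i> *\<^sub>C r t = - (A (u t) + F (u t))" by (rule eq_neg_iff_add_eq_0[THEN iffD2])
    then have "\<i> *\<^sub>C (\<i> *\<^sub>C r t) = \<i> *\<^sub>C (- (A (u t) + F (u t)))" by simp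
    then have "- r t = - (\<i> *\<^sub>C (A (u t) + F (u t)))"
      by (simp only: i_scaleC_i scaleC_minus_right)
    then have "r t = \<i> *\<^sub>C (A (u t) + F (u t))" by (simp only: neg_equal_iff_equal)
    then show ?thesis by (simp add: q_def scaleC_add_right)
  qed
  \<comment> \<open>The equation is imposed for \<open>t > 0\<close> only; both sides are continuous
    on \<open>{0..T}\<close>, so it extends to \<open>0\<close>.\<close>
  have "r t - q t = 0" if t: "t \<in> {0..T}" for t
    by (rule continuous_constant_on_closure[of "{0<..T}" "\<lambda>t. r t - q t"])
      (use rq t T r q in \<open>auto intro!: continuous_intros\<close>)
  then have rq: "r t = q t" if "t \<in> {0..T}" for t using that by simp
  have der: "(frac_int (1 - \<alpha>) (\<lambda>s. u s - x) has_vector_derivative q t) (at t within {0..T})"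
    if t: "t \<in> {0..T}" for t
  proof -
    have "frac_int (1 - \<alpha>) (\<lambda>s. u s - x) differentiable (at t within {0..T})"
      using diff t u0 by (simp add: RL_differentiable_def)
    then show ?thesis
      using rq[OF t] by (simp add: vector_derivative_works r_def RL_deriv_def)
  qed
  have "u t = x + frac_int \<alpha> q t" if "t \<in> {0..T}" for t
    by (rule volterra_of_RL[OF \<alpha> T _ q der that]) (use cg
      in \<open>simp add: continuous_graph_iff[OF op]\<close>)
  moreover have "x \<in> D" using cg u0 T by (force simp: continuous_graph_def)
  ultimately show ?thesis
    using cg iF unfolding volterra_solution_def q_def by blast
qed

lemma volterra_imp_strict_solution:
  assumes T: "0 < T" and u: "volterra_solution T x (\<lambda>t. \<i> *\<^sub>C F (u t)) u"
  shows "strict_solution \<alpha> D A F T x u"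
proof -
  note U = volterra_solutionD[OF u]
  define q where "q t = \<i> *\<^sub>C A (u t) + \<i> *\<^sub>C F (u t)" for t
  have q: "continuous_on {0..T} q" unfolding q_def
    by (intro continuous_on_add continuous_on_iC[OF U(5)] U(6))
  have eq: "u t = x + frac_int \<alpha> q t" if "t \<in> {0..T}" for t using U(8)[OF that]
    by (simp add: q_def[abs_def])
  have u0: "u 0 = x" using eq[of 0] T by simp
  have der: "(frac_int (1 - \<alpha>) (\<lambda>s. u s - x) has_vector_derivative q t) (at t within {0..T})"
    if "t \<in> {0..T}" for t
    by (rule RL_of_volterra[OF \<alpha> q eq that])
  have RL: "RL_deriv \<alpha> T (\<lambda>s. u s - x) t = q t" if t: "t \<in> {0..T}" for t
    unfolding RL_deriv_def using vector_derivative_within_cbox[of 0 T t] der[OF t] t T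
      by (simp add: box_real)
  show ?thesis
    unfolding strict_solution_def u0
  proof (intro conjI ballI refl)
    show "continuous_graph D A {0..T} u" using u by (simp add: volterra_solution_def)
    show "RL_differentiable \<alpha> T (\<lambda>t. u t - x)"
      unfolding RL_differentiable_def using der differentiableI_vector by blast
    show "continuous_on {0..T} (RL_deriv \<alpha> T (\<lambda>t. u t - x))"
      using q by (rule continuous_on_eq) (simp add: RL)
    fix t assume t: "t \<in> {0<..T}"
    have "caputo_deriv \<alpha> T u t = q t" using RL[of t] t by (simp add: caputo_deriv_def u0)
    then show "\<i> *\<^sub>C caputo_deriv \<alpha> T u t + A (u t) + F (u t) = 0"
      by (simp add: q_def scaleC_add_right)
  qed
qed

text \<open>The difference solves the linear problem with source
  \<open>\<i> *\<^sub>C (F (u t) - F (v t))\<close>, whose graph norm is at most \<open>K R\<close>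
  times that of the difference, so \<open>frac_gronwall\<close> applies. The weight is fitted to a
  horizon \<open>T0 \<ge> T\<close>, which makes the constant the same for all shorter
  intervals.\<close>

lemma strict_solution_dependence:
  assumes T: "0 < T" "T \<le> T0" and r: "0 \<le> r"
    and weight: "\<And>t. t \<in> {0..T0} \<Longrightarrow> K R * frac_int \<alpha> (\<lambda>s. exp (r * s)) t \<le> exp (r * t) / 2"
    and u: "strict_solution \<alpha> D A F T x u" and v: "strict_solution \<alpha> D A F T y v"
    and uR: "\<And>t. t \<in> {0..T} \<Longrightarrow> graph_norm A (u t) \<le> R" and vR: "\<And>t. t \<in> {0..T} \<Longrightarrow> graph_norm A (v t)
      \<le> R"
    and t: "t \<in> {0..T}"
  shows "graph_norm A (u t - v t) \<le> 2 * exp (r * T0) * graph_norm A (x - y)"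
proof -
  define w where "w t = u t - v t" for t
  define f where "f t = \<i> *\<^sub>C F (u t) - \<i> *\<^sub>C F (v t)" for t
  have vs: "volterra_solution T (x - y) f w"
    unfolding w_def f_def using volterra_solution_diff[OF strict_solution_imp_volterra[OF T(1) u]
      strict_solution_imp_volterra[OF T(1) v]] .
  have cw: "continuous_on {0..T} (\<lambda>t. graph_norm A (w t))" and cf: "continuous_on {0..T}
    (\<lambda>t. graph_norm A (f t))"
    using vs by (auto simp: volterra_solution_def intro: continuous_on_graph_norm)
  have uD: "u s \<in> D" and vD: "v s \<in> D" if "s \<in> {0..T}" for s
    using u v that by (auto simp: strict_solution_def continuous_graph_def)
  have f_le: "graph_norm A (f s) \<le> K R * graph_norm A (w s)" if s: "s \<in> {0..T}" for s
  proof -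
    have "f s = \<i> *\<^sub>C (F (u s) - F (v s))" by (simp add: f_def scaleC_diff_right)
    then have "graph_norm A (f s) = graph_norm A (F (u s) - F (v s))"
      using graph_norm_i[OF operator_on_diff(1)[OF op F_D[OF uD[OF s]] F_D[OF vD[OF s]]]] by simp
    then show ?thesis unfolding w_def using F_lipschitz[OF uD[OF s] vD[OF s] uR[OF s] vR[OF s]]
      by simp
  qed
  have "graph_norm A (w t) \<le> 2 * graph_norm A (x - y) * exp (r * T)"
  proof (rule frac_gronwall[OF \<alpha>(1) K_nonneg graph_norm_nonneg r _ cw _ t])
    fix s assume s: "s \<in> {0..T}"
    show "K R * frac_int \<alpha> (\<lambda>s. exp (r * s)) s \<le> exp (r * s) / 2" using weight[of s] s T by simp
    have "graph_norm A (w s) \<le> graph_norm A (x - y) + frac_int \<alpha> (\<lambda>s. graph_norm A (f s)) s"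
      by (rule volterra_solution_bound[OF vs s])
    also have "frac_int \<alpha> (\<lambda>s. graph_norm A (f s)) s \<le> frac_int \<alpha> (\<lambda>s. K R * graph_norm A (w s)) s"
      using s f_le by (intro frac_int_mono[OF \<alpha>(1) cf] continuous_on_mult_left[OF cw]) auto
    also have "\<dots> = K R * frac_int \<alpha> (\<lambda>s. graph_norm A (w s)) s"
      using s by (intro frac_int_bounded_linear[OF \<alpha>(1) cw bounded_linear_mult_right]) auto
    finally show "graph_norm A (w s) \<le> graph_norm A (x - y) + K R * frac_int \<alpha> (\<lambda>s. graph_norm A
      (w s)) s" by simp
  qed
  also have "\<dots> \<le> 2 * graph_norm A (x - y) * exp (r * T0)"
    using T r by (intro mult_left_mono mult_nonneg_nonneg graph_norm_nonneg)
      (auto intro: mult_left_mono)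
  finally show ?thesis by (simp add: w_def mult_ac)
qed

lemma norm_graph_pair_le: "norm (x, A x) \<le> graph_norm A x" and graph_norm_le_pair: "graph_norm A x
  \<le> 2 * norm (x, A x)"
proof -
  show "norm (x, A x) \<le> graph_norm A x" by (simp add: graph_norm_def norm_Pair_le)
  show "graph_norm A x \<le> 2 * norm (x, A x)"
    using norm_fst_le[of x "A x"] norm_snd_le[of "A x" x] by (simp add: graph_norm_def)
qed

text \<open>The iteration runs on pairs \<open>(u, A u)\<close>: in the product space a uniform
  limit of graph-valued functions stays in the graph because \<open>A\<close> is closed, which takes
  the place of completeness of \<open>D(A)\<close>. The map sends \<open>z\<close> to the solution
  of the linear problem whose source is built from \<open>F (fst (z t))\<close>. With the given
  \<open>R\<close> the initial value uses less than \<open>R / 2\<close> and the source at most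
  \<open>R / 4\<close>, so the ball is preserved.\<close>

lemma local_existence:
  assumes T: "0 < T" and x: "x \<in> D" and R: "R = 2 * graph_norm A x + 1"
    and small: "T powr \<alpha> / Gamma (\<alpha> + 1) * K R \<le> 1 / 4"
  shows "\<exists>u. strict_solution \<alpha> D A F T x u"
proof -
  define S where "S = {z :: real \<Rightarrow> 'a \<times> 'a. continuous_on {0..T} z \<and>
    (\<forall>t\<in>{0..T}. fst (z t) \<in> D \<and> snd (z t) = A (fst (z t)) \<and> graph_norm A (fst (z t)) \<le> R)}"
  define V where "V z = (SOME u. volterra_solution T x (\<lambda>t. \<i> *\<^sub>C F (fst (z t))) u)"
    for z :: "real \<Rightarrow> 'a \<times> 'a"
  define \<Phi> where "\<Phi> z t = (V z t, A (V z t))" for z t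
  have R0: "0 \<le> R" using R graph_norm_nonneg[of A x] by simp
  have cg: "continuous_graph D A {0..T} (\<lambda>t. fst (z t))" if z: "z \<in> S" for z
  proof -
    have "continuous_on {0..T} (\<lambda>t. snd (z t))" using z
      by (auto simp: S_def intro: continuous_on_snd)
    then have "continuous_on {0..T} (\<lambda>t. A (fst (z t)))"
      by (rule continuous_on_eq) (use z in \<open>auto simp: S_def\<close>)
    then show ?thesis using z by (auto simp: S_def continuous_graph_iff[OF op] intro:
      continuous_on_fst)
  qed
  have V: "volterra_solution T x (\<lambda>t. \<i> *\<^sub>C F (fst (z t))) (V z)" if "z \<in> S" for z
    unfolding V_def
    by (rule someI_ex[OF volterra_solution_exists[OF less_imp_le[OF T] x
            continuous_graph_i[OF continuous_graph_F[OF cg[OF that]]]]])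
  have frac_le: "frac_int \<alpha> p t \<le> c / 4"
    if p: "continuous_on {0..T} p" and t: "t \<in> {0..T}" and c: "0 \<le> c"
      and le: "\<And>s. s \<in> {0..T} \<Longrightarrow> p s \<le> K R * c" for p :: "real \<Rightarrow> real" and t c
  proof -
    have "frac_int \<alpha> p t \<le> frac_int \<alpha> (\<lambda>_. K R * c) t"
      using t le by (intro frac_int_mono[OF \<alpha>(1) p continuous_on_const]) auto
    also have "\<dots> = t powr \<alpha> / Gamma (\<alpha> + 1) * (K R * c)" using t \<alpha> by (simp add: frac_int_const)
    also have "\<dots> \<le> T powr \<alpha> / Gamma (\<alpha> + 1) * (K R * c)"
      using t \<alpha> c K_nonneg[of R]
      by (intro mult_right_mono divide_right_mono powr_mono2 mult_nonneg_nonneg)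
        (auto intro: Gamma_real_nonneg)
    also have "\<dots> \<le> 1 / 4 * c" using mult_right_mono[OF small c] by (simp add: mult_ac)
    finally show ?thesis by simp
  qed
  have graph_F: "graph_norm A (\<i> *\<^sub>C F (fst (z t))) \<le> K R * R" if z: "z \<in> S" and t: "t \<in> {0..T}"
    for z t
  proof -
    have zt: "fst (z t) \<in> D" "graph_norm A (fst (z t)) \<le> R" using z t by (auto simp: S_def)
    have A0: "graph_norm A 0 \<le> R" using A_diff[OF x x] R0 by (simp add: graph_norm_def)
    have "graph_norm A (F (fst (z t)) - F 0) \<le> K R * graph_norm A (fst (z t) - 0)"
      by (rule F_lipschitz[OF zt(1) operator_onD(1)[OF op] zt(2) A0])
    also have "\<dots> \<le> K R * R" using zt K_nonneg by (simp add: mult_left_mono)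
    finally show ?thesis using graph_norm_i[OF F_D[OF zt(1)]] by (simp add: F_0)
  qed
  have "\<exists>z\<in>S. \<forall>t\<in>{0..T}. \<Phi> z t = z t"
  proof (rule weighted_contraction_fixpoint[where \<omega>="\<lambda>_. 1" and W=1])
    show "(\<lambda>_. (x, A x)) \<in> S" using x R graph_norm_nonneg[of A x] by (simp add: S_def)
    show "continuous_on {0..T} z" if "z \<in> S" for z using that by (simp add: S_def)
    show "\<Phi> z \<in> S" if z: "z \<in> S" for z
      unfolding S_def mem_Collect_eq
    proof (intro conjI ballI)
      note U = volterra_solutionD[OF V[OF z]]
      show "continuous_on {0..T} (\<Phi> z)" unfolding \<Phi>_def by (intro continuous_on_Pair U)
      fix t assume t: "t \<in> {0..T}"
      show "fst (\<Phi> z t) \<in> D" "snd (\<Phi> z t) = A (fst (\<Phi> z t))" using U(2)[OF t] by (auto simp: \<Phi>_def)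
      have "frac_int \<alpha> (\<lambda>s. graph_norm A (\<i> *\<^sub>C F (fst (z s)))) t \<le> R / 4"
        by (rule frac_le[OF continuous_on_graph_norm[OF
          continuous_graph_i[OF continuous_graph_F[OF cg[OF z]]]] t R0 graph_F[OF z]])
      then show "graph_norm A (fst (\<Phi> z t)) \<le> R"
        using volterra_solution_bound[OF V[OF z] t] R graph_norm_nonneg[of A x] by (simp add: \<Phi>_def)
    qed
    show "z \<in> S" if X: "\<And>n. X n \<in> S" and lim: "uniform_limit {0..T} X z sequentially" for X z
      unfolding S_def mem_Collect_eq
    proof (intro conjI ballI)
      show "continuous_on {0..T} z" using uniform_limit_theorem[OF _ lim] X by (simp add: S_def)
      fix t assume t: "t \<in> {0..T}"
      have l: "(\<lambda>n. X n t) \<longlonglongrightarrow> z t" by (rule tendsto_uniform_limitI[OF lim t])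
      have lf: "(\<lambda>n. fst (X n t)) \<longlonglongrightarrow> fst (z t)" and ls: "(\<lambda>n. snd (X n t)) \<longlonglongrightarrow> snd (z t)"
        by (intro tendsto_fst tendsto_snd l)+
      have XD: "fst (X n t) \<in> D" and Xs: "snd (X n t) = A (fst (X n t))" and XR: "graph_norm A
        (fst (X n t)) \<le> R" for n
        using X[of n] t by (auto simp: S_def)
      have *: "fst (z t) \<in> D \<and> A (fst (z t)) = snd (z t)"
        by (rule selfadjoint_closed[OF selfadjoint XD lf]) (use ls in \<open>simp add: Xs\<close>)
      then show "fst (z t) \<in> D" "snd (z t) = A (fst (z t))" by auto
      have "(\<lambda>n. norm (fst (X n t)) + norm (snd (X n t))) \<longlonglongrightarrow> norm (fst (z t)) + norm (snd (z t))"
        by (intro tendsto_intros lf ls)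
      then have "norm (fst (z t)) + norm (snd (z t)) \<le> R"
        by (rule LIMSEQ_le_const2) (use XR in \<open>auto simp: graph_norm_def Xs\<close>)
      then show "graph_norm A (fst (z t)) \<le> R" using * by (simp add: graph_norm_def)
    qed
    show "(1 :: real) \<le> 1 \<and> (1 :: real) \<le> 1" by simp
    fix z z' :: "real \<Rightarrow> 'a \<times> 'a" and c t
    assume z: "z \<in> S" "z' \<in> S" and c: "0 \<le> c" and t: "t \<in> {0..T}"
      and le: "\<And>t. t \<in> {0..T} \<Longrightarrow> norm (z t - z' t) \<le> c * 1"
    define f where "f s = \<i> *\<^sub>C F (fst (z s)) - \<i> *\<^sub>C F (fst (z' s))" for s
    have vs: "volterra_solution T (x - x) f (\<lambda>s. V z s - V z' s)"
      unfolding f_def by (rule volterra_solution_diff[OF V[OF z(1)] V[OF z(2)]])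
    \<comment> \<open>The factor \<open>2\<close> is the price of passing from the norm of the pair
      to the graph norm; with the smallness \<open>1 / 4\<close> it leaves the contraction factor
      \<open>1 / 2\<close>.\<close>
    have "graph_norm A (f s) \<le> K R * (2 * c)" if s: "s \<in> {0..T}" for s
    proof -
      have zs: "fst (z s) \<in> D" "fst (z' s) \<in> D" "graph_norm A (fst (z s))
        \<le> R" "graph_norm A (fst (z' s)) \<le> R"
        "snd (z s) = A (fst (z s))" "snd (z' s) = A (fst (z' s))"
        using z s by (auto simp: S_def)
      have "f s = \<i> *\<^sub>C (F (fst (z s)) - F (fst (z' s)))" by (simp add: f_def scaleC_diff_right)
      then have "graph_norm A (f s) = graph_norm A (F (fst (z s)) - F (fst (z' s)))"
        using graph_norm_i[OF operator_on_diff(1)[OF op F_D[OF zs(1)] F_D[OF zs(2)]]] by simp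
      also have "\<dots> \<le> K R * graph_norm A (fst (z s) - fst (z' s))" by (rule F_lipschitz[OF zs(1-4)])
      also have "graph_norm A (fst (z s) - fst (z' s)) \<le> 2 * norm (fst (z s) - fst (z' s),
        A (fst (z s) - fst (z' s)))"
        by (rule graph_norm_le_pair)
      also have "(fst (z s) - fst (z' s), A (fst (z s) - fst (z' s))) = z s - z' s"
        using zs by (simp add: A_diff prod_eq_iff)
      also have "2 * norm (z s - z' s) \<le> 2 * c" using le[OF s] by simp
      finally show ?thesis using K_nonneg by (simp add: mult_left_mono)
    qed
    then have "frac_int \<alpha> (\<lambda>s. graph_norm A (f s)) t \<le> 2 * c / 4"
      using vs c by (intro frac_le[OF _ t] continuous_on_graph_norm)
        (auto simp: volterra_solution_def)
    moreover have "graph_norm A (x - x) = 0" using A_diff[OF x x] by (simp add: graph_norm_def)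
    ultimately have "graph_norm A (V z t - V z' t) \<le> c / 2"
      using volterra_solution_bound[OF vs t] by simp
    moreover have "\<Phi> z t - \<Phi> z' t = (V z t - V z' t, A (V z t - V z' t))"
      using volterra_solutionD(2)[OF V[OF z(1)] t] volterra_solutionD(2)[OF V[OF z(2)] t]
      by (simp add: \<Phi>_def A_diff)
    ultimately show "norm (\<Phi> z t - \<Phi> z' t) \<le> c / 2 * 1"
      using norm_graph_pair_le[of "V z t - V z' t"] by simp
  qed
  then obtain z where z: "z \<in> S" "\<And>t. t \<in> {0..T} \<Longrightarrow> \<Phi> z t = z t" by blast
  have zV: "fst (z t) = V z t" if "t \<in> {0..T}" for t using z(2)[OF that] by (metis \<Phi>_def fst_conv)
  have "volterra_solution T x (\<lambda>t. \<i> *\<^sub>C F (V z t)) (V z)"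
    unfolding volterra_solution_def
  proof (intro conjI ballI)
    note U = volterra_solutionD[OF V[OF z(1)]]
    show "x \<in> D" by (rule x)
    show cV: "continuous_graph D A {0..T} (V z)" using V[OF z(1)]
      by (simp add: volterra_solution_def)
    show "continuous_graph D A {0..T} (\<lambda>t. \<i> *\<^sub>C F (V z t))"
      by (intro continuous_graph_i continuous_graph_F cV)
    fix t assume t: "t \<in> {0..T}"
    have "frac_int \<alpha> (\<lambda>s. \<i> *\<^sub>C A (V z s) + \<i> *\<^sub>C F (fst (z s))) t = frac_int \<alpha> (\<lambda>s. \<i> *\<^sub>C A (V z s)
      + \<i> *\<^sub>C F (V z s)) t"
      by (rule frac_int_cong) (use t zV in auto)
    then show "V z t = x + frac_int \<alpha> (\<lambda>s. \<i> *\<^sub>C A (V z s) + \<i> *\<^sub>C F (V z s)) t"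
      using U(8)[OF t] by (simp only:)
  qed
  then show ?thesis using volterra_imp_strict_solution[OF T] by blast
qed

end

text \<open>The radius for the Lipschitz constant is the larger of the two essential bounds, and
  each radius has its own weight exponent, fixed before the solutions. Hence \<open>C\<close> sees
  the solutions only through those bounds, and the horizon \<open>T0\<close> makes it common to all
  \<open>T \<le> T0\<close>.\<close>

lemma (in semilinear_problem) strict_solution_stability:
  fixes \<rho> :: "'a \<Rightarrow> ennreal"
  obtains C :: "ennreal \<Rightarrow> ennreal \<Rightarrow> ereal \<Rightarrow> ereal \<Rightarrow> real"
  where "\<And>r s a b. 0 < C r s a b"
    and "\<And>T x y u v t. 0 < T \<Longrightarrow> T \<le> T0 \<Longrightarrow> strict_solution \<alpha> D A F T x u \<Longrightarrow>
      strict_solution \<alpha> D A F T y v \<Longrightarrow>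
      t \<in> {0..T} \<Longrightarrow> graph_norm A (u t - v t)
        \<le> C (\<rho> x) (\<rho> y) (Linf_norm A {0<..<T} u) (Linf_norm A {0<..<T} v)
          * mittag_leffler \<alpha> 1 (Gamma \<alpha> * t powr \<alpha>) * graph_norm A (x - y)"
proof -
  have "\<exists>r\<ge>0. \<forall>t\<in>{0..T0}. K R * frac_int \<alpha> (\<lambda>s. exp (r * s)) t \<le> exp (r * t) / 2" for R
    using exp_weight_exists[OF \<alpha>(1) K_nonneg] by metis
  then obtain r where r: "\<And>R. 0 \<le> r R"
    "\<And>R t. t \<in> {0..T0} \<Longrightarrow> K R * frac_int \<alpha> (\<lambda>s. exp (r R * s)) t \<le> exp (r R * t) / 2"
    by metis
  define C :: "ennreal \<Rightarrow> ennreal \<Rightarrow> ereal \<Rightarrow> ereal \<Rightarrow> real"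
    where "C p s a b = 2 * exp (r (max (real_of_ereal a) (real_of_ereal b)) * T0)" for p s a b
  show ?thesis
  proof (rule that)
    show "0 < C p s a b" for p s a b by (simp add: C_def)
    fix T x y u v t
    assume T: "0 < T" "T \<le> T0" and u: "strict_solution \<alpha> D A F T x u" and v: "strict_solution \<alpha> D A
      F T y v"
      and t: "t \<in> {0..T}"
    define R where "R = max (real_of_ereal (Linf_norm A {0<..<T} u)) (real_of_ereal
      (Linf_norm A {0<..<T} v))"
    let ?C = "C (\<rho> x) (\<rho> y) (Linf_norm A {0<..<T} u) (Linf_norm A {0<..<T} v)"
    have C: "?C = 2 * exp (r R * T0)" by (simp add: C_def R_def)
    have "graph_norm A (u s) \<le> R" "graph_norm A (v s) \<le> R" if "s \<in> {0..T}" for s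
      using graph_norm_le_Linf_norm[OF op _ T(1) that, of u]
        graph_norm_le_Linf_norm[OF op _ T(1) that, of v] u v
      by (simp_all add: strict_solution_def R_def le_max_iff_disj)
    then have "graph_norm A (u t - v t) \<le> 2 * exp (r R * T0) * graph_norm A (x - y)"
      by (intro strict_solution_dependence[OF T r(1) r(2) u v _ _ t])
    also have "\<dots> = ?C * 1 * graph_norm A (x - y)" by (simp add: C)
    also have "\<dots> \<le> ?C * mittag_leffler \<alpha> 1 (Gamma \<alpha> * t powr \<alpha>) * graph_norm A (x - y)"
      using mittag_leffler_ge_1[of \<alpha> "Gamma \<alpha> * t powr \<alpha>"] \<alpha>
      by (intro mult_right_mono mult_left_mono graph_norm_nonneg) (auto simp: C Gamma_real_nonneg)
    finally show "graph_norm A (u t - v t)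
        \<le> ?C * mittag_leffler \<alpha> 1 (Gamma \<alpha> * t powr \<alpha>) * graph_norm A (x - y)" .
  qed
qed

theorem theorem1p1:
  fixes \<alpha> :: real
    and D :: "'a::{complex_hilbert, second_countable_topology} set"
    and A F :: "'a \<Rightarrow> 'a"
    and \<rho> :: "'a \<Rightarrow> ennreal"
  assumes "0 < \<alpha>" "\<alpha> < 1"
    and "selfadjoint D A"
    and "extended_norm_on D \<rho>"
    and "lipschitz_nonlinearity D A \<rho> F"
  shows "\<exists>\<tau> :: real \<Rightarrow> ennreal \<Rightarrow> real.
    (\<forall>a r. \<tau> a r > 0) \<and>
    (\<forall>x\<in>D. data_norm A \<rho> x < \<infinity> \<longrightarrow>
       (let T = \<tau> (graph_norm A x) (\<rho> x) in
         \<exists>u. strict_solution \<alpha> D A F T x u \<and>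
             (\<forall>v. strict_solution \<alpha> D A F T x v \<longrightarrow> (\<forall>t\<in>{0..T}. v t = u t)))) \<and>
    (\<exists>C :: ennreal \<Rightarrow> ennreal \<Rightarrow> ereal \<Rightarrow> ereal \<Rightarrow> real.
       (\<forall>r s a b. C r s a b > 0) \<and>
       (\<forall>x\<in>D. \<forall>y\<in>D. \<forall>u v. data_norm A \<rho> x < \<infinity> \<longrightarrow>
          (let T = \<tau> (graph_norm A x) (\<rho> x) in
            strict_solution \<alpha> D A F T x u \<longrightarrow> strict_solution \<alpha> D A F T y v \<longrightarrow>
            (\<forall>t\<in>{0..T}. graph_norm A (u t - v t)
               \<le> C (\<rho> x) (\<rho> y) (Linf_norm A {0<..<T} u) (Linf_norm A {0<..<T} v)
                   * mittag_leffler \<alpha> 1 (Gamma \<alpha> * t powr \<alpha>) * graph_norm A (x - y))))) \<and>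
    (\<forall>T>0. \<exists>C :: ennreal \<Rightarrow> ennreal \<Rightarrow> ereal \<Rightarrow> ereal \<Rightarrow> real.
       (\<forall>r s a b. C r s a b > 0) \<and>
       (\<forall>x\<in>D. \<forall>y\<in>D. \<forall>u v. data_norm A \<rho> x < \<infinity> \<longrightarrow>
          strict_solution \<alpha> D A F T x u \<longrightarrow> strict_solution \<alpha> D A F T y v \<longrightarrow>
          (\<forall>t\<in>{0..T}. graph_norm A (u t - v t)
             \<le> C (\<rho> x) (\<rho> y) (Linf_norm A {0<..<T} u) (Linf_norm A {0<..<T} v)
                 * mittag_leffler \<alpha> 1 (Gamma \<alpha> * t powr \<alpha>) * graph_norm A (x - y))))"
proof -
  have op: "operator_on D A" using assms(3) by (simp add: selfadjoint_def)
  obtain K :: "real \<Rightarrow> real" where K: "\<And>R. 0 \<le> K R"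
    "\<And>R a b. a \<in> D \<Longrightarrow> b \<in> D \<Longrightarrow> graph_norm A a \<le> R \<Longrightarrow> graph_norm A b \<le> R \<Longrightarrow>
      graph_norm A (F a - F b) \<le> K R * graph_norm A (a - b)"
    using lipschitz_nonlinearity_on_balls[OF op assms(4,5)] by blast
  interpret semilinear_problem \<alpha> D A F K
    using assms K by unfold_locales (auto simp: lipschitz_nonlinearity_def)
  have G: "0 < Gamma (\<alpha> + 1)" using \<alpha> by (intro Gamma_real_pos) simp
  \<comment> \<open>An admissible value of \<open>T powr \<alpha>\<close> in the smallness condition
    of \<open>local_existence\<close> with \<open>R = 2 * a + 1\<close>; adding \<open>1\<close> to
    \<open>K\<close> keeps the denominator positive.\<close>
  define \<sigma> where "\<sigma> a = Gamma (\<alpha> + 1) / (4 * (K (2 * a + 1) + 1))" for a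
  have \<sigma>: "0 < \<sigma> a" for a using G K(1)[of "2 * a + 1"] by (simp add: \<sigma>_def add_nonneg_pos)
  \<comment> \<open>Capping the time at \<open>1\<close> lets a single constant, taken for the
    horizon \<open>1\<close>, cover all initial values although their existence times
    differ.\<close>
  define \<tau> :: "real \<Rightarrow> ennreal \<Rightarrow> real" where "\<tau> a r = min 1 (\<sigma> a powr (1 / \<alpha>))" for a r
  have \<tau>: "0 < \<tau> a r" "\<tau> a r \<le> 1" for a r using \<sigma>[of a] by (auto simp: \<tau>_def)
  have small: "\<tau> a r powr \<alpha> / Gamma (\<alpha> + 1) * K (2 * a + 1) \<le> 1 / 4" for a r
  proof -
    have "\<tau> a r powr \<alpha> \<le> (\<sigma> a powr (1 / \<alpha>)) powr \<alpha>"
      using \<tau>(1)[of a r] \<alpha> by (intro powr_mono2) (auto simp: \<tau>_def)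
    also have "\<dots> = \<sigma> a" using \<alpha> \<sigma>[of a] by (simp add: powr_powr)
    finally have "\<tau> a r powr \<alpha> / Gamma (\<alpha> + 1) * K (2 * a + 1) \<le> \<sigma> a / Gamma (\<alpha> + 1) * K (2 * a
      + 1)"
      using G K(1) by (intro mult_right_mono divide_right_mono) auto
    also have "\<dots> = K (2 * a + 1) / (4 * (K (2 * a + 1) + 1))" using G by (simp add: \<sigma>_def)
    also have "\<dots> \<le> 1 / 4" using K(1)[of "2 * a + 1"] by (simp add: field_simps)
    finally show ?thesis .
  qed
  obtain C1 :: "ennreal \<Rightarrow> ennreal \<Rightarrow> ereal \<Rightarrow> ereal \<Rightarrow> real" where C1_pos: "\<And>r s a b. 0 < C1 r s a b"
    and C1: "\<And>T x y u v t. 0 < T \<Longrightarrow> T \<le> 1 \<Longrightarrow> strict_solution \<alpha> D A F T x u \<Longrightarrow>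
      strict_solution \<alpha> D A F T y v \<Longrightarrow>
      t \<in> {0..T} \<Longrightarrow> graph_norm A (u t - v t)
        \<le> C1 (\<rho> x) (\<rho> y) (Linf_norm A {0<..<T} u) (Linf_norm A {0<..<T} v)
          * mittag_leffler \<alpha> 1 (Gamma \<alpha> * t powr \<alpha>) * graph_norm A (x - y)"
    using strict_solution_stability[of 1 \<rho>] by blast
  show ?thesis
  proof (intro exI[of _ \<tau>] conjI allI impI ballI)
    show "0 < \<tau> a r" for a r by (rule \<tau>)
  next
    fix x assume x: "x \<in> D" and "data_norm A \<rho> x < \<infinity>"
    define T where "T = \<tau> (graph_norm A x) (\<rho> x)"
    obtain u where u: "strict_solution \<alpha> D A F T x u"
      using local_existence[OF _ x refl] \<tau>(1) small unfolding T_def by blast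
    have "v t = u t" if v: "strict_solution \<alpha> D A F T x v" and t: "t \<in> {0..T}" for v t
    proof -
      \<comment> \<open>Uniqueness is the stability estimate for equal initial values.\<close>
      have "graph_norm A (x - x) = 0" using A_diff[OF x x] by (simp add: graph_norm_def)
      then have "graph_norm A (v t - u t) \<le> 0"
        using C1[OF _ _ v u t] \<tau> by (simp add: T_def)
      then have "norm (v t - u t) \<le> 0" unfolding graph_norm_def by (smt (verit) norm_ge_zero)
      then show ?thesis by simp
    qed
    then show "let T = \<tau> (graph_norm A x) (\<rho> x) in
         \<exists>u. strict_solution \<alpha> D A F T x u \<and>
             (\<forall>v. strict_solution \<alpha> D A F T x v \<longrightarrow> (\<forall>t\<in>{0..T}. v t = u t))"
      using u unfolding Let_def T_def by blast
  next
    show "\<exists>C :: ennreal \<Rightarrow> ennreal \<Rightarrow> ereal \<Rightarrow> ereal \<Rightarrow> real.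
       (\<forall>r s a b. C r s a b > 0) \<and>
       (\<forall>x\<in>D. \<forall>y\<in>D. \<forall>u v. data_norm A \<rho> x < \<infinity> \<longrightarrow>
          (let T = \<tau> (graph_norm A x) (\<rho> x) in
            strict_solution \<alpha> D A F T x u \<longrightarrow> strict_solution \<alpha> D A F T y v \<longrightarrow>
            (\<forall>t\<in>{0..T}. graph_norm A (u t - v t)
               \<le> C (\<rho> x) (\<rho> y) (Linf_norm A {0<..<T} u) (Linf_norm A {0<..<T} v)
                   * mittag_leffler \<alpha> 1 (Gamma \<alpha> * t powr \<alpha>) * graph_norm A (x - y))))"
      unfolding Let_def using C1_pos C1[OF \<tau>] by blast
  next
    fix T :: real assume T: "0 < T"
    \<comment> \<open>For a prescribed interval the horizon is its own length
      \<open>T\<close>.\<close>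
    obtain C :: "ennreal \<Rightarrow> ennreal \<Rightarrow> ereal \<Rightarrow> ereal \<Rightarrow> real" where C_pos: "\<And>r s a b. 0 < C r s a b"
      and C: "\<And>T' x y u v t. 0 < T' \<Longrightarrow> T' \<le> T \<Longrightarrow> strict_solution \<alpha> D A F T' x u \<Longrightarrow>
        strict_solution \<alpha> D A F T' y v \<Longrightarrow>
      t \<in> {0..T'} \<Longrightarrow> graph_norm A (u t - v t)
        \<le> C (\<rho> x) (\<rho> y) (Linf_norm A {0<..<T'} u) (Linf_norm A {0<..<T'} v)
          * mittag_leffler \<alpha> 1 (Gamma \<alpha> * t powr \<alpha>) * graph_norm A (x - y)"
      using strict_solution_stability[of T \<rho>] by blast
    show "\<exists>C :: ennreal \<Rightarrow> ennreal \<Rightarrow> ereal \<Rightarrow> ereal \<Rightarrow> real.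
       (\<forall>r s a b. C r s a b > 0) \<and>
       (\<forall>x\<in>D. \<forall>y\<in>D. \<forall>u v. data_norm A \<rho> x < \<infinity> \<longrightarrow>
          strict_solution \<alpha> D A F T x u \<longrightarrow> strict_solution \<alpha> D A F T y v \<longrightarrow>
          (\<forall>t\<in>{0..T}. graph_norm A (u t - v t)
             \<le> C (\<rho> x) (\<rho> y) (Linf_norm A {0<..<T} u) (Linf_norm A {0<..<T} v)
                 * mittag_leffler \<alpha> 1 (Gamma \<alpha> * t powr \<alpha>) * graph_norm A (x - y)))"
      using C_pos C[OF T order_refl] by blast
  qed
qed

end
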